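(* Let $E$ and $F$ be two Banach lattices such that the norm of $F$ is order continuous. Then the following assertions are equivalent: (1) Each positive almost L-weakly compact operator $T:E\rightarrow F$ is semi-compact; (2) One of the following conditions is valid: (a) the norm of the dual $E'$ is order continuous; (b) $E$ or $F$ is finite dimensional.
   Context: All Banach spaces and Banach lattices are real, and operators are continuous linear maps. $B_E$ denotes the closed unit ball of $E$, $E_+$ the positive cone of $E$, and $E'$ the norm dual of $E$ (a Banach lattice). An operator $T:X\to F$ from a Banach space to a Banach lattice is semi-compact if for each $\varepsilon>0$ there exists $u\in F_+$ such that $T(B_X)\subset[-u,u]+\varepsilon B_F$. A nonempty norm bounded subset $A$ of a Banach lattice $F$ is L-weakly compact if $\|y_n\|\to 0$ for every disjoint sequence $(y_n)$ contained in the solid hull $\{y\in F: |y|\le |a| \text{ for some } a\in A\}$ of $A$. An operator $T$ from a Banach space $X$ into a Banach lattice $F$ is almost L-weakly compact if $T$ maps relatively weakly compact subsets of $X$ onto L-weakly compact subsets of $F$. The norm of a Banach lattice $G$ is order continuous if $\|x_\alpha\|\downarrow 0$ for every net $(x_\alpha)$ in $G$ with $x_\alpha\downarrow 0$. *)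

theory Defs
  imports
    "HOL-Analysis.Analysis"
    "HOL-Library.Lattice_Algebras"
    "HOL-Library.Lub_Glb"
begin

section \<open>Banach lattices\<close>

text \<open>In \<^class>\<open>lattice_ab_group_add_abs\<close> the absolute value is \<open>\<bar>x\<bar> = sup x (- x)\<close>.\<close>

class banach_lattice = banach + ordered_real_vector + lattice_ab_group_add_abs +
  assumes lattice_norm: "\<bar>x\<bar> \<le> \<bar>y\<bar> \<Longrightarrow> norm x \<le> norm y"

instance real :: banach_lattice
  by standard simp

text \<open>
  The operator order: \<open>S \<le> T\<close> iff \<open>T - S\<close> maps the positive cone into the positive cone.
  So \<open>0 \<le> T\<close> says that \<open>T\<close> is a positive operator, and for codomain \<^typ>\<open>real\<close> this, together
  with the operator norm, is the Banach lattice structure of the dual \<open>E'\<close>.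
\<close>

instantiation blinfun :: (banach_lattice, banach_lattice) order
begin

definition less_eq_blinfun :: "('a \<Rightarrow>\<^sub>L 'b) \<Rightarrow> ('a \<Rightarrow>\<^sub>L 'b) \<Rightarrow> bool"
  where "S \<le> T \<longleftrightarrow> (\<forall>x\<ge>0. blinfun_apply S x \<le> blinfun_apply T x)"

definition less_blinfun :: "('a \<Rightarrow>\<^sub>L 'b) \<Rightarrow> ('a \<Rightarrow>\<^sub>L 'b) \<Rightarrow> bool"
  where "S < T \<longleftrightarrow> S \<le> T \<and> \<not> T \<le> (S :: 'a \<Rightarrow>\<^sub>L 'b)"

instance
proof
  fix S T U :: "'a \<Rightarrow>\<^sub>L 'b"
  show "S < T \<longleftrightarrow> S \<le> T \<and> \<not> T \<le> S"
    by (rule less_blinfun_def)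
  show "S \<le> S"
    by (simp add: less_eq_blinfun_def)
  show "S \<le> U" if "S \<le> T" "T \<le> U"
    using that unfolding less_eq_blinfun_def by (blast intro: order_trans)
  show "S = T" if "S \<le> T" "T \<le> S"
  proof (rule blinfun_eqI)
    fix x :: 'a
    have pos: "blinfun_apply S y = blinfun_apply T y" if "0 \<le> y" for y
      using that \<open>S \<le> T\<close> \<open>T \<le> S\<close> unfolding less_eq_blinfun_def by (blast intro: antisym)
    have "blinfun_apply S (pprt x) = blinfun_apply T (pprt x)"
      by (rule pos) simp
    moreover have "blinfun_apply S (- nprt x) = blinfun_apply T (- nprt x)"
      by (rule pos) simp
    ultimately have "blinfun_apply S (pprt x + nprt x) = blinfun_apply T (pprt x + nprt x)"
      by (simp add: blinfun.add_right blinfun.minus_right)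
    then show "blinfun_apply S x = blinfun_apply T x"
      by (simp flip: prts)
  qed
qed

end

section \<open>Order continuous norms\<close>

text \<open>A net is a family indexed by a nonempty directed preordered set \<open>(I, R)\<close>.\<close>

definition directed :: "'i set \<Rightarrow> ('i \<Rightarrow> 'i \<Rightarrow> bool) \<Rightarrow> bool"
  where "directed I R \<longleftrightarrow>
    I \<noteq> {} \<and>
    (\<forall>i\<in>I. R i i) \<and>
    (\<forall>i\<in>I. \<forall>j\<in>I. \<forall>k\<in>I. R i j \<longrightarrow> R j k \<longrightarrow> R i k) \<and>
    (\<forall>i\<in>I. \<forall>j\<in>I. \<exists>k\<in>I. R i k \<and> R j k)"

text \<open>\<open>x\<^sub>\<alpha> \<down> l\<close>\<close>

definition decreases_to :: "'i set \<Rightarrow> ('i \<Rightarrow> 'i \<Rightarrow> bool) \<Rightarrow> ('i \<Rightarrow> 'a::order) \<Rightarrow> 'a \<Rightarrow> bool"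
  where "decreases_to I R x l \<longleftrightarrow>
    (\<forall>i\<in>I. \<forall>j\<in>I. R i j \<longrightarrow> x j \<le> x i) \<and> isGlb UNIV (x ` I) l"

text \<open>
  HOL cannot quantify over index types inside a definition, so the nets are indexed by subsets of
  the space itself. This is no restriction: a decreasing net can be reindexed by its range, see
  \<open>order_continuous_normD\<close> below, where the index type is arbitrary.
\<close>

definition order_continuous_norm :: "'a::{order, real_normed_vector} itself \<Rightarrow> bool"
  where "order_continuous_norm _ \<longleftrightarrow>
    (\<forall>(I :: 'a set) R (x :: 'a \<Rightarrow> 'a).
      directed I R \<and> decreases_to I R x 0 \<longrightarrow> decreases_to I R (\<lambda>i. norm (x i)) 0)"

lemma order_continuous_normD:
  fixes I :: "'i set" and x :: "'i \<Rightarrow> 'a::{order, real_normed_vector}"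
  assumes oc: "order_continuous_norm TYPE('a)"
    and dir: "directed I R" and dec: "decreases_to I R x 0"
  shows "decreases_to I R (\<lambda>i. norm (x i)) 0"
proof -
  have "directed (x ` I) (\<lambda>a b. b \<le> a)"
    unfolding directed_def
  proof (intro conjI ballI impI)
    show "x ` I \<noteq> {}"
      using dir by (simp add: directed_def)
    fix a b assume "a \<in> x ` I" "b \<in> x ` I"
    then obtain i j where ij: "i \<in> I" "j \<in> I" "a = x i" "b = x j"
      by blast
    obtain k where "k \<in> I" "R i k" "R j k"
      using dir ij unfolding directed_def by meson
    with ij dec show "\<exists>c\<in>x ` I. c \<le> a \<and> c \<le> b"
      unfolding decreases_to_def by blast
  qed (auto intro: order_trans)
  moreover have "decreases_to (x ` I) (\<lambda>a b. b \<le> a) (\<lambda>a. a) 0"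
    using dec by (simp add: decreases_to_def)
  ultimately have "decreases_to (x ` I) (\<lambda>a b. b \<le> a) norm 0"
    using oc unfolding order_continuous_norm_def by blast
  with dec show ?thesis
    by (simp add: decreases_to_def image_image)
qed

section \<open>Classes of operators\<close>

definition semi_compact :: "('a::banach \<Rightarrow>\<^sub>L 'b::banach_lattice) \<Rightarrow> bool"
  where "semi_compact T \<longleftrightarrow>
    (\<forall>\<epsilon>>0. \<exists>u\<ge>0. blinfun_apply T ` cball 0 1 \<subseteq>
      {v + \<epsilon> *\<^sub>R w | v w. v \<in> {-u..u} \<and> w \<in> cball 0 1})"

definition solid_hull :: "'a::banach_lattice set \<Rightarrow> 'a set"
  where "solid_hull A = {y. \<exists>a\<in>A. \<bar>y\<bar> \<le> \<bar>a\<bar>}"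

definition disjoint_seq :: "(nat \<Rightarrow> 'a::banach_lattice) \<Rightarrow> bool"
  where "disjoint_seq y \<longleftrightarrow> (\<forall>m n. m \<noteq> n \<longrightarrow> inf \<bar>y m\<bar> \<bar>y n\<bar> = 0)"

definition L_weakly_compact :: "'a::banach_lattice set \<Rightarrow> bool"
  where "L_weakly_compact A \<longleftrightarrow>
    A \<noteq> {} \<and> bounded A \<and>
    (\<forall>y. disjoint_seq y \<and> range y \<subseteq> solid_hull A \<longrightarrow> (\<lambda>n. norm (y n)) \<longlonglongrightarrow> 0)"

text \<open>
  The weak topology: functions on the dual carry the topology of pointwise convergence, which is
  pulled back along the evaluation map.
\<close>

definition weak_topology :: "'a::real_normed_vector topology"
  where "weak_topology =
    pullback_topology UNIV (\<lambda>x (\<phi> :: 'a \<Rightarrow>\<^sub>L real). blinfun_apply \<phi> x) euclidean"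

definition relatively_weakly_compact :: "'a::real_normed_vector set \<Rightarrow> bool"
  where "relatively_weakly_compact A \<longleftrightarrow> compactin weak_topology (weak_topology closure_of A)"

text \<open>
  The empty set is relatively weakly compact, but L-weakly compact sets are nonempty by
  definition; hence \<open>A \<noteq> {}\<close>, without which no operator would qualify.
\<close>

definition almost_L_weakly_compact :: "('a::banach \<Rightarrow>\<^sub>L 'b::banach_lattice) \<Rightarrow> bool"
  where "almost_L_weakly_compact T \<longleftrightarrow>
    (\<forall>A. A \<noteq> {} \<and> relatively_weakly_compact A \<longrightarrow> L_weakly_compact (blinfun_apply T ` A))"

definition finite_dimensional :: "'a::real_vector itself \<Rightarrow> bool"
  where "finite_dimensional _ \<longleftrightarrow>
    (\<exists>B :: 'a set. finite_dimensional_vector_space scaleR B)"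

end

theory Submission
  imports Defs
begin

text \<open>
  Throughout, \<open>x\<^sup>+\<close> is the positive part of \<open>x\<close> and \<open>x \<and> u\<close> the infimum; the identity
  \<open>x = x \<and> u + (x - u)\<^sup>+\<close> cuts a positive element into an order bounded part and an excess. A positive
  operator is semi-compact as soon as it makes the excesses of the unit ball uniformly small for some
  \<open>u\<close>, and \<open>small_above_if_disjoint_null\<close> shows that this happens whenever the operator is null on
  all disjoint sequences of the positive unit ball. So everything is decided on disjoint sequences.

  The norm of \<open>E'\<close> is order continuous exactly if every positive functional is null on the disjoint
  sequences of the positive unit ball (\<open>disjoint_null_if_dual_oc\<close>, \<open>dual_oc_if_disjoint_null\<close>). In this
  case such a sequence \<open>w\<close> is weakly null, so an almost L-weakly compact \<open>T \<ge> 0\<close> maps its range to an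
  L-weakly compact set, whose excesses over a suitable \<open>u\<close> are small. The truncations \<open>T w\<^sub>n \<and> u\<close> tend to
  \<open>0\<close> in norm, since in a Banach lattice with order continuous norm positive weakly null sequences have
  norm null truncations (\<open>inf_null_if_weakly_null\<close>; this uses a Hahn--Banach theorem for positive norming
  functionals). Thus \<open>T w\<^sub>n\<close> tends to \<open>0\<close> and \<open>T\<close> is semi-compact. If \<open>E\<close> or \<open>F\<close> is finite
  dimensional, disjoint sequences in that space are eventually \<open>0\<close>, and the same principle applies.

  Conversely, let \<open>E'\<close> fail to be order continuous and let \<open>F\<close> be infinite dimensional. Some
  \<open>\<phi> \<ge> 0\<close> is bounded away from \<open>0\<close> on a disjoint sequence \<open>x\<^sub>n\<close> of the ball of \<open>E\<close>, and \<open>F\<close> contains a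
  disjoint normalized sequence \<open>y\<^sub>n \<ge> 0\<close> (\<open>infinite_dimensional_disjoint_seq\<close>, by an argument with atoms).
  The components \<open>\<phi>\<^sub>n\<close> of \<open>\<phi>\<close> carried by the \<open>x\<^sub>n\<close> satisfy \<open>\<Sum> \<bar>\<phi>\<^sub>n(z)\<bar> \<le> \<phi>(\<bar>z\<bar>)\<close>, so that
  \<open>T z = \<Sum> \<phi>\<^sub>n(z) y\<^sub>n\<close> is a positive operator that factors through \<open>\<ell>\<^sup>1\<close>. By the Schur property
  (\<open>relatively_weakly_compact_l1_subseq\<close>) it maps relatively weakly compact sets to relatively norm compact
  sets, which are L-weakly compact in \<open>F\<close>. It is not semi-compact, because \<open>T x\<^sub>n = \<phi>(x\<^sub>n) y\<^sub>n\<close> is disjoint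
  and bounded away from \<open>0\<close>, whereas order bounded disjoint sequences in \<open>F\<close> are null.
\<close>

section \<open>Order and norm in a Banach lattice\<close>

lemma norm_abs_lattice [simp]: "norm \<bar>x\<bar> = norm (x :: 'a::banach_lattice)"
  by (rule antisym) (rule lattice_norm, simp)+

lemma norm_mono_nonneg: "0 \<le> x \<Longrightarrow> x \<le> y \<Longrightarrow> norm x \<le> norm (y :: 'a::banach_lattice)"
  by (rule lattice_norm) (metis abs_of_nonneg order_trans)

lemma abs_leI_lattice: "x \<le> u \<Longrightarrow> - x \<le> u \<Longrightarrow> \<bar>x\<bar> \<le> (u :: 'a::banach_lattice)"
  by (simp add: abs_leI)

lemma norm_le_norm_of_abs_le: "\<bar>x\<bar> \<le> y \<Longrightarrow> norm x \<le> norm (y :: 'a::banach_lattice)"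
  by (rule lattice_norm) (metis abs_ge_self order_trans)

text \<open>
  The splitting \<open>x = x \<and> u + (x - u)\<^sup>+\<close> into an order bounded part and an excess over
  \<open>u\<close>, which require different arguments wherever a norm has to be shown small.
\<close>
lemma inf_add_pprt_diff: "inf x u + pprt (x - u) = (x :: 'a::banach_lattice)"
proof -
  have "x - inf x u = pprt (x - u)"
    unfolding diff_inf_eq_sup add_sup_distrib_left pprt_def by (simp add: sup_commute)
  then show ?thesis
    by (metis add.commute diff_add_cancel)
qed

lemma pprt_le_abs: "pprt x \<le> \<bar>x :: 'a::banach_lattice\<bar>"
  by (simp add: pprt_def abs_ge_self)

lemma norm_pprt_le: "norm (pprt x) \<le> norm (x :: 'a::banach_lattice)"
  using lattice_norm[of "pprt x" x] by (simp add: pprt_le_abs)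

lemma inf_add_le:
  fixes a b c :: "'a::banach_lattice"
  assumes "0 \<le> a" "0 \<le> b" "0 \<le> c"
  shows "inf (a + b) c \<le> inf a c + inf b c"
proof -
  have "inf (a + b) c \<le> a + b" by simp
  moreover have "inf (a + b) c \<le> a + c"
    using assms by (metis add_increasing inf.coboundedI2 order_refl)
  moreover have "inf (a + b) c \<le> c + b"
    using assms by (metis add_increasing2 inf.coboundedI2 order_refl)
  moreover have "inf (a + b) c \<le> c + c"
    using assms by (metis add_increasing2 inf.coboundedI2 order_refl)
  ultimately show ?thesis
    by (simp add: add_sup_inf_distribs)
qed

lemma scaleR_inf:
  fixes a b :: "'a::banach_lattice"
  assumes "0 \<le> c"
  shows "c *\<^sub>R inf a b = inf (c *\<^sub>R a) (c *\<^sub>R b)"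
proof (cases "c = 0")
  case False
  then have c: "c > 0" using assms by simp
  show ?thesis
  proof (rule antisym)
    show "c *\<^sub>R inf a b \<le> inf (c *\<^sub>R a) (c *\<^sub>R b)"
      using assms by (simp add: scaleR_left_mono)
    have "inverse c *\<^sub>R inf (c *\<^sub>R a) (c *\<^sub>R b) \<le> inverse c *\<^sub>R (c *\<^sub>R a)"
         "inverse c *\<^sub>R inf (c *\<^sub>R a) (c *\<^sub>R b) \<le> inverse c *\<^sub>R (c *\<^sub>R b)"
      using c by (intro scaleR_left_mono; simp)+
    then have "inverse c *\<^sub>R inf (c *\<^sub>R a) (c *\<^sub>R b) \<le> inf a b"
      using c by simp
    then have "c *\<^sub>R (inverse c *\<^sub>R inf (c *\<^sub>R a) (c *\<^sub>R b)) \<le> c *\<^sub>R inf a b"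
      using assms by (rule scaleR_left_mono)
    then show "inf (c *\<^sub>R a) (c *\<^sub>R b) \<le> c *\<^sub>R inf a b"
      using c by simp
  qed
qed simp

lemma scaleR_pprt:
  fixes a :: "'a::banach_lattice"
  assumes "0 \<le> c"
  shows "c *\<^sub>R pprt a = pprt (c *\<^sub>R a)"
proof -
  have "c *\<^sub>R pprt a = - (c *\<^sub>R inf (- a) 0)"
    by (simp add: pprt_def neg_inf_eq_sup flip: scaleR_minus_right)
  also have "\<dots> = pprt (c *\<^sub>R a)"
    using assms by (simp add: pprt_def scaleR_inf neg_inf_eq_sup)
  finally show ?thesis .
qed

lemma inf_zero_mono:
  fixes a b :: "'a::banach_lattice"
  assumes "inf a b = 0" "0 \<le> c" "c \<le> a" "0 \<le> d" "d \<le> b"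
  shows "inf c d = 0"
  by (rule antisym) (use assms inf_mono[of c a d b] in auto)

lemma inf_scaleR_zero:
  fixes a b :: "'a::banach_lattice"
  assumes "inf a b = 0" "0 \<le> s" "0 \<le> t"
  shows "inf (s *\<^sub>R a) (t *\<^sub>R b) = 0"
proof -
  have ab: "0 \<le> a" "0 \<le> b"
    using assms(1) by (metis inf.cobounded1, metis inf.cobounded2)
  have "inf (max s t *\<^sub>R a) (max s t *\<^sub>R b) = 0"
    using assms by (simp flip: scaleR_inf)
  then show ?thesis
    by (rule inf_zero_mono) (use ab assms in \<open>auto intro: scaleR_right_mono scaleR_nonneg_nonneg\<close>)
qed

lemma inf_sum_zero:
  fixes b :: "'i \<Rightarrow> 'a::banach_lattice"
  assumes "finite S" "0 \<le> a" "\<And>i. i \<in> S \<Longrightarrow> 0 \<le> b i" "\<And>i. i \<in> S \<Longrightarrow> inf (b i) a = 0"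
  shows "inf (sum b S) a = 0"
  using assms
proof (induction S)
  case empty
  then show ?case by (simp add: inf_absorb1)
next
  case (insert i S)
  then have "inf (b i + sum b S) a \<le> inf (b i) a + inf (sum b S) a"
    by (intro inf_add_le sum_nonneg) auto
  also have "\<dots> = 0"
    using insert by simp
  finally show ?case
    using insert by (intro antisym) (simp_all add: sum_nonneg)
qed

text \<open>
  Disjoint elements have their supremum as their sum, so sums of disjoint elements stay below
  every common upper bound.
\<close>
lemma disjoint_sum_le:
  fixes b :: "'i \<Rightarrow> 'a::banach_lattice"
  assumes "finite S" "0 \<le> x" "\<And>i. i \<in> S \<Longrightarrow> 0 \<le> b i" "\<And>i. i \<in> S \<Longrightarrow> b i \<le> x"
    and "\<And>i j. i \<in> S \<Longrightarrow> j \<in> S \<Longrightarrow> i \<noteq> j \<Longrightarrow> inf (b i) (b j) = 0"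
  shows "sum b S \<le> x"
  using assms
proof (induction S)
  case (insert i S)
  have "inf (sum b S) (b i) = 0"
    by (rule inf_sum_zero) (use insert in auto)
  then have "b i + sum b S = sup (b i) (sum b S)"
    by (simp only: add_eq_inf_sup[of "b i"] inf_commute) simp
  also have "\<dots> \<le> x"
    using insert by simp
  finally show ?case
    using insert by simp
qed simp

lemma pprt_disjoint: "inf (pprt a) (pprt (- a)) = (0 :: 'a::banach_lattice)"
proof -
  have "inf (pprt a) (pprt (- a)) = pprt (- a) + inf (pprt a - pprt (- a)) 0"
    by (simp add: add_inf_distrib_left)
  also have "pprt a - pprt (- a) = a"
    by (simp add: pprt_neg flip: prts)
  finally show ?thesis
    by (simp add: nprt_def[symmetric] pprt_neg)
qed

lemma pprt_diff_le:
  fixes p q :: "'a::banach_lattice"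
  assumes "0 \<le> q"
  shows "pprt p - pprt (p - q) \<le> q" "0 \<le> pprt p - pprt (p - q)"
proof -
  have "p \<le> q + pprt (p - q)"
    by (metis diff_le_eq add.commute pprt_def sup_ge1)
  then have "pprt p \<le> q + pprt (p - q)"
    unfolding pprt_def[of p] using assms by (simp add: add_nonneg_nonneg)
  then show "pprt p - pprt (p - q) \<le> q"
    by (simp add: diff_le_eq)
  show "0 \<le> pprt p - pprt (p - q)"
    using assms by (simp add: pprt_mono)
qed

text \<open>
  The positive cone is closed because \<open>(-l)\<^sup>+ \<le> \<bar>x - l\<bar>\<close> for every \<open>x \<ge> 0\<close>.
\<close>
lemma tendsto_nonneg:
  fixes x :: "nat \<Rightarrow> 'a::banach_lattice"
  assumes lim: "x \<longlonglongrightarrow> l" and pos: "\<forall>\<^sub>F n in sequentially. 0 \<le> x n"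
  shows "0 \<le> l"
proof -
  have "\<forall>\<^sub>F n in sequentially. norm (pprt (- l)) \<le> norm (x n - l)"
    using pos
  proof eventually_elim
    fix n assume "0 \<le> x n"
    then have "- l \<le> x n - l"
      by simp
    then have "pprt (- l) \<le> \<bar>x n - l\<bar>"
      by (metis pprt_le_abs pprt_mono order_trans)
    then show "norm (pprt (- l)) \<le> norm (x n - l)"
      using norm_mono_nonneg[of "pprt (- l)"] by fastforce
  qed
  moreover have "(\<lambda>n. norm (x n - l)) \<longlonglongrightarrow> 0"
    using lim by (simp add: LIM_zero tendsto_norm_zero)
  ultimately have "norm (pprt (- l)) \<le> 0"
    by (intro tendsto_lowerbound[of _ 0 sequentially]) auto
  then show ?thesis
    by (metis le_zero_iff_zero_pprt neg_le_0_iff_le norm_le_zero_iff)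
qed

lemma tendsto_le_lattice:
  fixes x y :: "nat \<Rightarrow> 'a::banach_lattice"
  assumes "x \<longlonglongrightarrow> l" "y \<longlonglongrightarrow> m" "\<forall>\<^sub>F n in sequentially. x n \<le> y n"
  shows "l \<le> m"
  using tendsto_nonneg[of "\<lambda>n. y n - x n" "m - l"] assms by (simp add: tendsto_diff)

lemma archimedean_lattice:
  fixes w v :: "'a::banach_lattice"
  assumes "\<And>k::nat. of_nat k *\<^sub>R w \<le> v"
  shows "w \<le> 0"
proof -
  have "w \<le> inverse (real (Suc k)) *\<^sub>R v" for k
    using scaleR_left_mono[OF assms[of "Suc k"], of "inverse (real (Suc k))"] by simp
  moreover have "(\<lambda>k. inverse (real (Suc k)) *\<^sub>R v) \<longlonglongrightarrow> 0"
    using tendsto_scaleR[OF LIMSEQ_inverse_real_of_nat tendsto_const] by simp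
  ultimately show ?thesis
    by (intro tendsto_le_lattice[OF tendsto_const]) auto
qed

section \<open>Disjoint sequences\<close>

lemma disjoint_seq_nonneg:
  assumes "\<And>n. 0 \<le> y n"
  shows "disjoint_seq y \<longleftrightarrow> (\<forall>m n. m \<noteq> n \<longrightarrow> inf (y m) (y n) = 0)"
  using assms by (simp add: disjoint_seq_def)

lemma disjoint_seq_abs: "disjoint_seq y \<Longrightarrow> disjoint_seq (\<lambda>n. \<bar>y n\<bar>)"
  by (simp add: disjoint_seq_def)

lemma disjoint_seq_subseq: "disjoint_seq y \<Longrightarrow> strict_mono r \<Longrightarrow> disjoint_seq (\<lambda>n. y (r n))"
  by (simp add: disjoint_seq_def strict_mono_eq)

lemma disjoint_seq_mono:
  assumes "disjoint_seq y" "\<And>n. 0 \<le> y n" "\<And>n. 0 \<le> z n" "\<And>n. z n \<le> y n"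
  shows "disjoint_seq z"
proof -
  have "inf (z m) (z n) = 0" if "m \<noteq> n" for m n
  proof (rule inf_zero_mono)
    show "inf (y m) (y n) = 0"
      using assms(1) that unfolding disjoint_seq_nonneg[of y, OF assms(2)] by blast
  qed (fact assms)+
  then show ?thesis
    unfolding disjoint_seq_nonneg[of z, OF assms(3)] by blast
qed

lemma member_le_sum_lattice:
  fixes f :: "'i \<Rightarrow> 'a::banach_lattice"
  assumes "finite S" "i \<in> S" "\<And>j. j \<in> S \<Longrightarrow> 0 \<le> f j"
  shows "f i \<le> sum f S"
  using sum_mono2[of S "{i}" f] assms by simp

text \<open>
  This device turns information about disjoint sequences into approximate order boundedness of
  \<open>T\<close> on \<open>A\<close>. If no \<open>u\<close> works, one picks \<open>x\<^sub>0, x\<^sub>1, \<dots>\<close> in \<open>A\<close> such that \<open>T\<close> is large on the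
  excess of \<open>x\<^bsub>n+1\<^esub>\<close> over \<open>4\<^sup>n (x\<^sub>0 + \<dots> + x\<^sub>n)\<close>. These excesses need not be disjoint, but they become
  disjoint once \<open>2\<^sup>-\<^sup>n y\<close> is cut off as well, where \<open>y = \<Sum> 2\<^sup>-\<^sup>i x\<^sub>i\<close>: for \<open>m < n\<close> the part left of
  \<open>x\<^bsub>m+1\<^esub>\<close> lives where \<open>x\<^bsub>n+1\<^esub> < 4\<^sup>n x\<^bsub>m+1\<^esub>\<close> and the part left of \<open>x\<^bsub>n+1\<^esub>\<close> where the opposite
  inequality holds. The additional cut costs at most \<open>2\<^sup>-\<^sup>n y\<close>, so \<open>T\<close> remains large on the
  disjoint sequence.
\<close>
lemma small_above_if_disjoint_null:
  fixes T :: "'a::banach_lattice \<Rightarrow> 'b::real_normed_vector"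
  assumes T: "bounded_linear T"
    and nonneg: "\<And>x. x \<in> A \<Longrightarrow> 0 \<le> x"
    and bdd: "bounded A"
    and down: "\<And>x y. x \<in> A \<Longrightarrow> 0 \<le> y \<Longrightarrow> y \<le> x \<Longrightarrow> y \<in> A"
    and null: "\<And>y. disjoint_seq y \<Longrightarrow> range y \<subseteq> A \<Longrightarrow> (\<lambda>n. norm (T (y n))) \<longlonglongrightarrow> 0"
    and \<epsilon>: "\<epsilon> > 0"
  shows "\<exists>u\<ge>0. \<forall>x\<in>A. norm (T (pprt (x - u))) < \<epsilon>"
proof (rule ccontr)
  assume neg: "\<not> ?thesis"
  obtain K where K: "\<And>x. norm (T x) \<le> norm x * K" "K > 0"
    using bounded_linear.pos_bounded[OF T] by auto
  obtain M where M: "\<And>x. x \<in> A \<Longrightarrow> norm x \<le> M"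
    using bdd by (auto simp: bounded_iff)
  have step: "\<exists>x\<in>A. \<epsilon> \<le> norm (T (pprt (x - u)))" if "0 \<le> u" for u
    using neg that by (meson not_le_imp_less)
  obtain sel where sel: "sel u \<in> A" "\<epsilon> \<le> norm (T (pprt (sel u - u)))" if "0 \<le> u" for u
    using step by metis
  \<comment> \<open>The pair carries the next element together with the sum of all the previous ones.\<close>
  define P where "P = rec_nat (sel 0, 0) (\<lambda>n p. (sel (4 ^ n *\<^sub>R (snd p + fst p)), snd p + fst p))"
  define x where "x n = fst (P n)" for n
  define s where "s n = snd (P (Suc n))" for n
  have s_eq: "s n = (\<Sum>i\<le>n. x i)" for n
  proof (induction n)
    case (Suc n)
    have "s (Suc n) = s n + x (Suc n)"
      by (simp add: s_def x_def P_def)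
    then show ?case using Suc by simp
  qed (simp add: s_def x_def P_def)
  have x_Suc: "x (Suc n) = sel (4 ^ n *\<^sub>R s n)" for n
    by (simp add: s_def x_def P_def)
  have xA: "x n \<in> A" for n
  proof (induction n rule: less_induct)
    case (less n)
    show ?case
    proof (cases n)
      case 0
      then show ?thesis using sel(1)[of 0] by (simp add: x_def P_def)
    next
      case (Suc m)
      then have "0 \<le> s m"
        unfolding s_eq by (intro sum_nonneg nonneg less) auto
      then show ?thesis
        unfolding Suc x_Suc by (intro sel) (simp add: scaleR_nonneg_nonneg)
    qed
  qed
  have x0: "0 \<le> x n" for n
    using nonneg[OF xA] .
  have s0: "0 \<le> s n" for n
    unfolding s_eq by (intro sum_nonneg x0)
  have x_le_s: "x i \<le> s n" if "i \<le> n" for i n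
    unfolding s_eq using that by (intro member_le_sum_lattice) (auto intro: x0)
  have big: "\<epsilon> \<le> norm (T (pprt (x (Suc n) - 4 ^ n *\<^sub>R s n)))" for n
    unfolding x_Suc using s0 by (intro sel) (simp add: scaleR_nonneg_nonneg)
  have summ: "summable (\<lambda>n. (1/2) ^ n *\<^sub>R x n)"
  proof (rule summable_comparison_test'[where N = 0 and g = "\<lambda>n. (1/2) ^ n * M"])
    show "summable (\<lambda>n. (1 / 2) ^ n * M)"
      by (intro summable_mult2) (simp add: summable_geometric)
    show "norm ((1 / 2) ^ n *\<^sub>R x n) \<le> (1 / 2) ^ n * M" for n
      using M[OF xA] by simp
  qed
  define y where "y = (\<Sum>n. (1/2) ^ n *\<^sub>R x n)"
  have x_le_y: "(1/2) ^ i *\<^sub>R x i \<le> y" for i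
  proof (rule tendsto_le_lattice[OF tendsto_const])
    show "(\<lambda>n. \<Sum>i<n. (1/2) ^ i *\<^sub>R x i) \<longlonglongrightarrow> y"
      using summ unfolding y_def by (rule summable_LIMSEQ)
    show "\<forall>\<^sub>F n in sequentially. (1/2) ^ i *\<^sub>R x i \<le> (\<Sum>i<n. (1/2) ^ i *\<^sub>R x i)"
      using eventually_gt_at_top[of i]
      by eventually_elim (rule member_le_sum_lattice; simp add: x0 scaleR_nonneg_nonneg)
  qed
  have y0: "0 \<le> y"
    using x_le_y[of 0] x0[of 0] by (simp add: order_trans)
  define w where "w n = pprt (x (Suc n) - 4 ^ n *\<^sub>R s n - (1/2) ^ n *\<^sub>R y)" for n
  have w0: "0 \<le> w n" for n
    by (simp add: w_def)
  have w_le: "w n \<le> x (Suc n)" for n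
  proof -
    have "x (Suc n) - 4 ^ n *\<^sub>R s n - (1/2) ^ n *\<^sub>R y \<le> x (Suc n) - 0 - 0"
      using s0 y0 by (intro diff_mono order_refl scaleR_nonneg_nonneg) auto
    then show ?thesis
      unfolding w_def by (metis diff_zero pprt_eq_id pprt_mono x0)
  qed
  have disj: "inf (w m) (w n) = 0" if "m < n" for m n
  proof -
    let ?c = "(4::real) ^ n" and ?d = "(2::real) ^ (m + Suc n)"
    \<comment> \<open>Here the growth rate \<open>4\<^sup>n\<close> matters: \<open>m + Suc n \<le> 2 * n\<close> because \<open>m < n\<close>.\<close>
    have "?d \<le> 2 ^ (2 * n)"
      using that by (intro power_increasing) auto
    then have cd: "?d \<le> ?c"
      by (simp add: power_mult)
    have "w m \<le> pprt (x (Suc m) - inverse ?d *\<^sub>R x (Suc n))"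
    proof -
      have "inverse ?d *\<^sub>R x (Suc n) = (1/2) ^ m *\<^sub>R ((1/2) ^ Suc n *\<^sub>R x (Suc n))"
        by (simp add: power_add field_simps)
      also have "\<dots> \<le> (1/2) ^ m *\<^sub>R y"
        by (intro scaleR_left_mono x_le_y) auto
      finally have "x (Suc m) - 4 ^ m *\<^sub>R s m - (1/2) ^ m *\<^sub>R y \<le> x (Suc m) - 0 - inverse ?d *\<^sub>R x (Suc n)"
        using s0 by (intro diff_mono order_refl scaleR_nonneg_nonneg) auto
      then show ?thesis
        unfolding w_def by (simp add: pprt_mono)
    qed
    then have "?d *\<^sub>R w m \<le> ?d *\<^sub>R pprt (x (Suc m) - inverse ?d *\<^sub>R x (Suc n))"
      by (intro scaleR_left_mono) auto
    also have "\<dots> = pprt (?d *\<^sub>R x (Suc m) - x (Suc n))"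
      by (subst scaleR_pprt) (auto simp: algebra_simps)
    also have "\<dots> \<le> pprt (?c *\<^sub>R x (Suc m) - x (Suc n))"
      by (intro pprt_mono diff_mono order_refl scaleR_right_mono cd x0)
    finally have 1: "?d *\<^sub>R w m \<le> pprt (- (x (Suc n) - ?c *\<^sub>R x (Suc m)))"
      by simp
    have "x (Suc n) - 4 ^ n *\<^sub>R s n - (1/2) ^ n *\<^sub>R y \<le> x (Suc n) - ?c *\<^sub>R x (Suc m) - 0"
      using x_le_s[of "Suc m" n] that y0
      by (intro diff_mono order_refl scaleR_nonneg_nonneg scaleR_left_mono) auto
    then have 2: "w n \<le> pprt (x (Suc n) - ?c *\<^sub>R x (Suc m))"
      unfolding w_def by (simp add: pprt_mono)
    have "inf (?d *\<^sub>R w m) (w n) = 0"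
      by (rule inf_zero_mono[OF pprt_disjoint[of "- (x (Suc n) - ?c *\<^sub>R x (Suc m))"] _ 1 _])
        (use 2 in \<open>auto simp: w0 scaleR_nonneg_nonneg\<close>)
    moreover have "w m \<le> ?d *\<^sub>R w m"
      using scaleR_right_mono[of 1 ?d "w m"] w0 one_le_power[of "2::real" "m + Suc n"] by simp
    ultimately show ?thesis
      by (intro inf_zero_mono[OF _ w0 _ w0 order_refl])
  qed
  have "disjoint_seq w"
    unfolding disjoint_seq_nonneg[of w, OF w0]
    using disj by (metis inf_commute linorder_neqE_nat)
  moreover have "range w \<subseteq> A"
    using down[OF xA w0 w_le] by auto
  ultimately have "(\<lambda>n. norm (T (w n))) \<longlonglongrightarrow> 0"
    by (rule null)
  moreover have "(\<lambda>n. (1/2) ^ n * norm y * K) \<longlonglongrightarrow> 0"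
    by (intro tendsto_mult_left_zero LIMSEQ_power_zero) auto
  ultimately have lim: "(\<lambda>n. norm (T (w n)) + (1/2) ^ n * norm y * K) \<longlonglongrightarrow> 0"
    using tendsto_add by fastforce
  have "\<epsilon> \<le> norm (T (w n)) + (1/2) ^ n * norm y * K" for n
  proof -
    let ?z = "pprt (x (Suc n) - 4 ^ n *\<^sub>R s n)"
    have "norm (T (?z - w n)) \<le> norm (?z - w n) * K"
      by (rule K(1))
    also have "\<dots> \<le> norm ((1/2) ^ n *\<^sub>R y) * K"
      unfolding w_def using y0 K(2)
      by (intro mult_right_mono norm_mono_nonneg pprt_diff_le scaleR_nonneg_nonneg) auto
    finally have "norm (T (?z - w n)) \<le> (1/2) ^ n * norm y * K"
      by simp
    moreover have "T (?z - w n) = T ?z - T (w n)"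
      using T by (simp add: bounded_linear.linear linear_diff)
    ultimately show ?thesis
      using big[of n] norm_triangle_ineq2[of "T ?z" "T (w n)"] by simp
  qed
  then have "\<epsilon> \<le> 0"
    by (intro tendsto_lowerbound[OF lim]) auto
  with \<epsilon> show False by simp
qed

section \<open>Order continuous norms\<close>

text \<open>
  The existence of the supremum of \<open>x\<close> is part of what has to be shown, so the net consists
  of the differences \<open>v - x n\<close> with \<open>v\<close> ranging over all upper bounds. It decreases to \<open>0\<close>: if
  \<open>w\<close> is a lower bound of it, then \<open>v - w\<close> is an upper bound of \<open>x\<close> whenever \<open>v\<close> is, hence so is
  every \<open>u - k w\<close>, and the Archimedean property gives \<open>w \<le> 0\<close>. Order continuity then puts some
  upper bound close to some \<open>x n\<close>, which makes \<open>x\<close> a Cauchy sequence.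
\<close>
lemma oc_incseq_convergent:
  fixes x :: "nat \<Rightarrow> 'a::banach_lattice"
  assumes oc: "order_continuous_norm TYPE('a)"
    and inc: "incseq x" and bd: "\<And>n. x n \<le> u"
  shows "convergent x"
proof -
  define I where "I = {(v, n :: nat) |v n. \<forall>k. x k \<le> v}"
  define R where "R = (\<lambda>(v, n) (v', n'). (v' :: 'a) \<le> v \<and> (n::nat) \<le> n')"
  have dir: "directed I R"
    unfolding directed_def
  proof (intro conjI ballI impI)
    show "I \<noteq> {}" using bd by (auto simp: I_def)
    fix i j assume "i \<in> I" "j \<in> I"
    then obtain v n v' n' where ij: "i = (v, n)" "j = (v', n')" "\<forall>k. x k \<le> v" "\<forall>k. x k \<le> v'"
      by (auto simp: I_def)
    then have "(inf v v', max n n') \<in> I" "R i (inf v v', max n n')" "R j (inf v v', max n n')"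
      by (auto simp: I_def R_def)
    then show "\<exists>k\<in>I. R i k \<and> R j k" by blast
  qed (auto simp: R_def)
  have "decreases_to I R (\<lambda>(v, n). v - x n) 0"
    unfolding decreases_to_def
  proof (intro conjI ballI impI)
    show "(case j of (v, n) \<Rightarrow> v - x n) \<le> (case i of (v, n) \<Rightarrow> v - x n)" if "R i j" for i j
      using that inc by (auto simp: R_def intro!: diff_mono dest: incseqD)
    show "isGlb UNIV ((\<lambda>(v, n). v - x n) ` I) 0"
      unfolding isGlb_def greatestP_def isLb_def setge_def setle_def
    proof (intro conjI ballI UNIV_I)
      fix w assume "w \<in> Collect (\<lambda>w. (\<forall>y\<in>(\<lambda>(v, n). v - x n) ` I. w \<le> y) \<and> w \<in> UNIV)"
      then have w: "w \<le> v - x n" if "\<And>k. x k \<le> v" for v n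
        using that by (auto simp: I_def)
      have "x n \<le> u - of_nat k *\<^sub>R w" for n k
      proof (induction k arbitrary: n)
        case (Suc k)
        from w[OF Suc] have "x n \<le> u - of_nat k *\<^sub>R w - w"
          by (metis diff_add_cancel le_diff_eq add.commute)
        then show ?case by (simp add: algebra_simps)
      qed (simp add: bd)
      then have "of_nat k *\<^sub>R w \<le> u - x 0" for k
        by (metis diff_add_cancel le_diff_eq add.commute)
      then show "w \<le> 0"
        by (rule archimedean_lattice)
    qed (auto simp: I_def)
  qed
  from order_continuous_normD[OF oc dir this]
  have glb: "isGlb UNIV ((\<lambda>i. norm (case i of (v, n) \<Rightarrow> v - x n)) ` I) 0"
    by (simp add: decreases_to_def)
  have "Cauchy x"
    unfolding Cauchy_altdef2
  proof (intro allI impI)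
    fix e :: real assume "e > 0"
    have "\<exists>i\<in>I. norm (case i of (v, n) \<Rightarrow> v - x n) < e"
    proof (rule ccontr)
      assume "\<not> ?thesis"
      then have "isLb UNIV ((\<lambda>i. norm (case i of (v, n) \<Rightarrow> v - x n)) ` I) e"
        by (auto simp: isLb_def setge_def not_less)
      with glb have "e \<le> 0"
        by (auto simp: isGlb_def greatestP_def setle_def)
      with \<open>e > 0\<close> show False by simp
    qed
    then obtain v n where v: "\<And>k. x k \<le> v" "norm (v - x n) < e"
      by (auto simp: I_def)
    have "dist (x m) (x n) < e" if "m \<ge> n" for m
    proof -
      have "norm (x m - x n) \<le> norm (v - x n)"
        using v inc that by (intro norm_mono_nonneg diff_mono) (auto dest: incseqD)
      with v show ?thesis by (simp add: dist_norm)
    qed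
    then show "\<exists>N. \<forall>n\<ge>N. dist (x n) (x N) < e" by blast
  qed
  then show ?thesis
    by (rule Cauchy_convergent)
qed

lemma oc_decseq_convergent:
  fixes x :: "nat \<Rightarrow> 'a::banach_lattice"
  assumes oc: "order_continuous_norm TYPE('a)"
    and dec: "decseq x" and bd: "\<And>n. u \<le> x n"
  shows "convergent x"
proof -
  have "convergent (\<lambda>n. - x n)"
    using dec bd by (intro oc_incseq_convergent[OF oc, of _ "- u"]) (auto simp: incseq_def decseq_def)
  then show ?thesis
    by (simp add: convergent_minus_iff[of x])
qed

lemma incseq_le_lim_lattice:
  fixes x :: "nat \<Rightarrow> 'a::banach_lattice"
  assumes "incseq x" "x \<longlonglongrightarrow> l"
  shows "x n \<le> l"
  by (rule tendsto_le_lattice[OF tendsto_const assms(2)])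
    (use assms(1) in \<open>auto intro!: eventually_sequentiallyI[of n] dest: incseqD\<close>)

text \<open>
  The partial sums of \<open>d\<close> increase and stay below \<open>u\<close>, so \<open>\<Sum> d n\<close> converges.
\<close>
lemma oc_disjoint_order_bounded_null:
  fixes d :: "nat \<Rightarrow> 'a::banach_lattice"
  assumes oc: "order_continuous_norm TYPE('a)"
    and disj: "disjoint_seq d" and nn: "\<And>n. 0 \<le> d n" and le: "\<And>n. d n \<le> u"
  shows "d \<longlonglongrightarrow> 0"
proof -
  have "0 \<le> u" using nn le by (rule order_trans)
  have "(\<Sum>i<n. d i) \<le> u" for n
    using nn le disj \<open>0 \<le> u\<close> by (intro disjoint_sum_le) (auto simp: disjoint_seq_nonneg)
  moreover have "incseq (\<lambda>n. \<Sum>i<n. d i)"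
    using nn by (intro incseq_SucI) simp
  ultimately have "convergent (\<lambda>n. \<Sum>i<n. d i)"
    using oc_incseq_convergent[OF oc] by blast
  then have "summable d"
    by (simp add: summable_iff_convergent)
  then show ?thesis
    by (rule summable_LIMSEQ_zero)
qed

section \<open>Positive functionals\<close>

lemma blinfun_nonneg_iff: "0 \<le> (\<phi> :: 'a::banach_lattice \<Rightarrow>\<^sub>L 'b::banach_lattice) \<longleftrightarrow> (\<forall>x\<ge>0. 0 \<le> \<phi> x)"
  by (simp add: less_eq_blinfun_def)

lemma pos_mono:
  fixes \<phi> :: "'a::banach_lattice \<Rightarrow>\<^sub>L 'b::banach_lattice"
  assumes "0 \<le> \<phi>" "x \<le> y"
  shows "\<phi> x \<le> \<phi> y"
proof -
  have "0 \<le> \<phi> (y - x)"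
    using assms by (simp add: blinfun_nonneg_iff)
  then show ?thesis
    by (simp add: blinfun.diff_right)
qed

lemma abs_pos_le:
  fixes \<phi> :: "'a::banach_lattice \<Rightarrow>\<^sub>L 'b::banach_lattice"
  assumes "0 \<le> \<phi>"
  shows "\<bar>\<phi> x\<bar> \<le> \<phi> \<bar>x\<bar>"
proof (rule abs_leI_lattice)
  show "\<phi> x \<le> \<phi> \<bar>x\<bar>" "- \<phi> x \<le> \<phi> \<bar>x\<bar>"
    using pos_mono[OF assms, of x "\<bar>x\<bar>"] pos_mono[OF assms, of "- x" "\<bar>x\<bar>"]
    by (simp_all add: abs_ge_self abs_ge_minus_self blinfun.minus_right)
qed

lemma norm_pos_functional_le:
  fixes \<phi> :: "'a::banach_lattice \<Rightarrow>\<^sub>L real"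
  assumes "0 \<le> \<phi>" "0 \<le> c" "\<And>x. 0 \<le> x \<Longrightarrow> norm x \<le> 1 \<Longrightarrow> \<phi> x \<le> c"
  shows "norm \<phi> \<le> c"
proof (rule norm_blinfun_bound)
  fix x
  show "norm (\<phi> x) \<le> c * norm x"
  proof (cases "x = 0")
    case False
    let ?y = "inverse (norm x) *\<^sub>R \<bar>x\<bar>"
    have "\<phi> ?y \<le> c"
      using False by (intro assms(3)) (auto simp: scaleR_nonneg_nonneg)
    then have "\<phi> \<bar>x\<bar> \<le> c * norm x"
      using False by (simp add: blinfun.scaleR_right field_simps)
    then show ?thesis
      using abs_pos_le[OF assms(1), of x] by simp
  qed simp
qed fact

text \<open>
  The defect \<open>h t = g (t x) - t g x\<close> is additive in \<open>t\<close> and vanishes on the integers, so it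
  takes all its values on \<open>[0, 1]\<close> and is bounded. Since \<open>h (n t) = n h t\<close>, it must vanish.
\<close>
lemma additive_bounded_imp_scaleR:
  fixes g :: "'a::real_normed_vector \<Rightarrow> real"
  assumes add: "\<And>x y. g (x + y) = g x + g y" and bd: "\<And>x. \<bar>g x\<bar> \<le> C * norm x"
  shows "g (t *\<^sub>R x) = t * g x"
proof -
  define h where "h s = g (s *\<^sub>R x) - s * g x" for s
  have h_add: "h (s + s') = h s + h s'" for s s'
    by (simp add: h_def add scaleR_add_left algebra_simps)
  have h0: "h 0 = 0"
    using h_add[of 0 0] by simp
  have h_nat: "h (real n * s) = real n * h s" for n s
    by (induction n) (simp_all add: h0 h_add algebra_simps)
  have h_neg: "h (- s) = - h s" for s
    using h_add[of s "- s"] h0 by simp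
  have h1: "h 1 = 0"
    by (simp add: h_def)
  have h_int: "h (of_int k) = 0" for k
  proof (cases k rule: int_cases2)
    case (nonneg n)
    then show ?thesis using h_nat[of n 1] h1 by simp
  next
    case (nonpos n)
    then show ?thesis using h_nat[of n 1] h1 h_neg[of "real n"] by simp
  qed
  define M where "M = C * norm x + \<bar>g x\<bar>"
  have C0: "0 \<le> C * norm x"
    using bd[of x] by linarith
  have h_bd: "\<bar>h s\<bar> \<le> M" for s
  proof -
    have "h s = h (frac s)"
      using h_add[of "frac s" "of_int \<lfloor>s\<rfloor>"] h_int by (simp add: frac_def)
    also have "\<bar>\<dots>\<bar> \<le> \<bar>g (frac s *\<^sub>R x)\<bar> + \<bar>frac s * g x\<bar>"
      unfolding h_def by (rule abs_triangle_ineq4)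
    also have "\<dots> \<le> C * norm (frac s *\<^sub>R x) + \<bar>frac s * g x\<bar>"
      using bd by (intro add_right_mono)
    also have "\<dots> = frac s * M"
      by (simp add: M_def abs_mult frac_ge_0 algebra_simps)
    also have "\<dots> \<le> 1 * M"
      using C0 by (intro mult_right_mono) (auto simp: M_def less_imp_le[OF frac_lt_1])
    finally show ?thesis by simp
  qed
  have "h t = 0"
  proof (rule ccontr)
    assume "h t \<noteq> 0"
    then obtain n where "real n * \<bar>h t\<bar> > M"
      by (metis reals_Archimedean3 zero_less_abs_iff)
    then show False
      using h_bd[of "real n * t"] h_nat[of n t] by (simp add: abs_mult)
  qed
  then show ?thesis by (simp add: h_def)
qed

text \<open>
  Kantorovich's extension: \<open>a - b \<mapsto> f a - f b\<close> is well defined on differences of positive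
  elements, and the bound on the cone gives real homogeneity for free.
\<close>
lemma positive_functional_from_cone:
  fixes f :: "'a::banach_lattice \<Rightarrow> real"
  assumes add: "\<And>x y. 0 \<le> x \<Longrightarrow> 0 \<le> y \<Longrightarrow> f (x + y) = f x + f y"
    and nn: "\<And>x. 0 \<le> x \<Longrightarrow> 0 \<le> f x" and bd: "\<And>x. 0 \<le> x \<Longrightarrow> f x \<le> C * norm x"
  obtains g :: "'a \<Rightarrow>\<^sub>L real" where "0 \<le> g" "\<And>x. 0 \<le> x \<Longrightarrow> g x = f x"
proof -
  define h where "h x = f (pprt x) - f (pprt (- x))" for x
  have f0: "f 0 = 0"
    using add[of 0 0] by simp
  have h_diff: "h x = f a - f b" if "x = a - b" "0 \<le> a" "0 \<le> b" for x a b
  proof -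
    have "pprt x - pprt (- x) = x"
      by (simp add: pprt_neg flip: prts)
    then have "pprt x + b = a + pprt (- x)"
      using that(1) by (metis add.commute add_diff_eq diff_add_cancel diff_add_eq)
    then have "f (pprt x) + f b = f a + f (pprt (- x))"
      using that by (metis add zero_le_pprt)
    then show ?thesis by (simp add: h_def)
  qed
  have h_cone: "h x = f x" if "0 \<le> x" for x
    using h_diff[of x x 0] that f0 by simp
  have h_add: "h (x + y) = h x + h y" for x y
  proof -
    have dec: "z = pprt z - pprt (- z)" for z :: 'a
      by (simp add: pprt_neg flip: prts)
    have "h (x + y) = f (pprt x + pprt y) - f (pprt (- x) + pprt (- y))"
      by (rule h_diff) (use dec[of x] dec[of y] in \<open>simp_all add: add_nonneg_nonneg add_diff_add\<close>)
    then show ?thesis by (simp add: add h_def)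
  qed
  have h_bd: "\<bar>h x\<bar> \<le> C * norm x" for x
  proof -
    have "\<bar>x\<bar> = pprt x + pprt (- x)"
      by (simp add: abs_prts pprt_neg)
    then have "f \<bar>x\<bar> = f (pprt x) + f (pprt (- x))"
      by (simp add: add)
    then have "\<bar>h x\<bar> \<le> f \<bar>x\<bar>"
      using nn[of "pprt x"] nn[of "pprt (- x)"] by (simp add: h_def)
    also have "\<dots> \<le> C * norm x"
      using bd[of "\<bar>x\<bar>"] by simp
    finally show ?thesis .
  qed
  have "bounded_linear h"
  proof (rule bounded_linear_intro[where K = C])
    show "h (r *\<^sub>R x) = r *\<^sub>R h x" for r x
      using additive_bounded_imp_scaleR[of h C, OF h_add h_bd] by simp
    show "norm (h x) \<le> norm x * C" for x
      using h_bd[of x] by (simp add: mult.commute)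
  qed (rule h_add)
  then have "blinfun_apply (Blinfun h) = h"
    by (rule bounded_linear_Blinfun_apply)
  then show ?thesis
    using that[of "Blinfun h"] by (simp add: blinfun_nonneg_iff h_cone nn)
qed

text \<open>
  For \<open>v k = k u\<close> the functional \<open>g\<close> is the component of \<open>\<phi>\<close> carried by the band of \<open>u\<close>; sequences
  \<open>v k = k u\<^sub>k\<close> with increasing \<open>u\<^sub>k\<close> give the component carried by all \<open>u\<^sub>k\<close> together. The doubling
  hypothesis yields superadditivity through \<open>x \<and> v + y \<and> v \<le> (x + y) \<and> 2 v\<close>.
\<close>
lemma component_functional:
  fixes \<phi> :: "'a::banach_lattice \<Rightarrow>\<^sub>L real"
  assumes \<phi>: "0 \<le> \<phi>" and v0: "\<And>k. 0 \<le> v k" and inc: "incseq v"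
    and dbl: "\<And>k. \<exists>k'. v k + v k \<le> v k'"
  obtains g :: "'a \<Rightarrow>\<^sub>L real" where "0 \<le> g"
    "\<And>x. 0 \<le> x \<Longrightarrow> (\<lambda>k. \<phi> (inf x (v k))) \<longlonglongrightarrow> g x"
proof -
  define f where "f x = (SUP k. \<phi> (inf x (v k)))" for x
  have inc': "incseq (\<lambda>k. \<phi> (inf x (v k)))" for x
    using inc by (auto simp: incseq_def intro!: pos_mono[OF \<phi>] inf_mono)
  have bd: "\<phi> (inf x (v k)) \<le> \<phi> x" for x k
    by (intro pos_mono[OF \<phi>]) simp
  have lim: "(\<lambda>k. \<phi> (inf x (v k))) \<longlonglongrightarrow> f x" for x
    unfolding f_def using bd by (intro LIMSEQ_incseq_SUP inc' bdd_aboveI2)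
  have le: "\<phi> (inf x (v k)) \<le> f x" for x k
    using incseq_le[OF inc' lim] .
  show ?thesis
  proof (rule positive_functional_from_cone[of f "norm \<phi>"])
    fix x y :: 'a assume x: "0 \<le> x" and y: "0 \<le> y"
    have "f (x + y) \<le> f x + f y"
    proof (rule LIMSEQ_le[OF lim tendsto_add[OF lim lim]], intro exI[of _ 0] allI impI)
      fix k
      have "\<phi> (inf (x + y) (v k)) \<le> \<phi> (inf x (v k) + inf y (v k))"
        using x y v0 by (intro pos_mono[OF \<phi>] inf_add_le)
      then show "\<phi> (inf (x + y) (v k)) \<le> \<phi> (inf x (v k)) + \<phi> (inf y (v k))"
        by (simp add: blinfun.add_right)
    qed
    moreover have "f x + f y \<le> f (x + y)"
    proof (rule LIMSEQ_le_const2[OF tendsto_add[OF lim lim]], intro exI[of _ 0] allI impI)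
      fix k
      obtain k' where k': "v k + v k \<le> v k'" using dbl by blast
      have "inf x (v k) + inf y (v k) \<le> v k + v k"
        by (intro add_mono) auto
      then have "inf x (v k) + inf y (v k) \<le> inf (x + y) (v k')"
        using order_trans[OF _ k'] by (simp add: add_mono)
      then have "\<phi> (inf x (v k)) + \<phi> (inf y (v k)) \<le> \<phi> (inf (x + y) (v k'))"
        using pos_mono[OF \<phi>] by (metis blinfun.add_right)
      then show "\<phi> (inf x (v k)) + \<phi> (inf y (v k)) \<le> f (x + y)"
        using le order_trans by blast
    qed
    ultimately show "f (x + y) = f x + f y" by simp
  next
    fix x :: 'a assume x: "0 \<le> x"
    have "0 \<le> \<phi> (inf x (v 0))"
      using \<phi> x v0 by (simp add: blinfun_nonneg_iff)
    then show "0 \<le> f x" using le[of x 0] by simp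
    have "f x \<le> \<phi> x"
      by (rule LIMSEQ_le_const2[OF lim]) (use bd in auto)
    also have "\<dots> \<le> norm \<phi> * norm x"
      using norm_blinfun[of \<phi> x] by simp
    finally show "f x \<le> norm \<phi> * norm x" .
  qed (use that lim in metis)
qed

text \<open>
  \<open>\<psi>\<close> is the positive part \<open>x \<mapsto> sup \<phi> [0, x]\<close>, whose additivity is the Riesz decomposition
  \<open>[0, x + y] = [0, x] + [0, y]\<close>.
\<close>
lemma functional_dominated_by_positive:
  fixes \<phi> :: "'a::banach_lattice \<Rightarrow>\<^sub>L real"
  obtains \<psi> :: "'a \<Rightarrow>\<^sub>L real" where "0 \<le> \<psi>" "\<And>x. 0 \<le> x \<Longrightarrow> \<phi> x \<le> \<psi> x"
proof -
  define f where "f x = Sup (blinfun_apply \<phi> ` {0..x})" for x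
  have bd: "\<phi> y \<le> norm \<phi> * norm x" if "0 \<le> y" "y \<le> x" for x y
  proof -
    have "\<phi> y \<le> norm \<phi> * norm y"
      using norm_blinfun[of \<phi> y] by simp
    also have "\<dots> \<le> norm \<phi> * norm x"
      using that by (intro mult_left_mono norm_mono_nonneg) auto
    finally show ?thesis .
  qed
  have bdd: "bdd_above (blinfun_apply \<phi> ` {0..x})" for x
    using bd by (intro bdd_aboveI2[of _ _ "norm \<phi> * norm x"]) auto
  have upper: "\<phi> y \<le> f x" if "0 \<le> y" "y \<le> x" for x y
    unfolding f_def using that by (intro cSUP_upper bdd) auto
  have least: "f x \<le> c" if "0 \<le> x" "\<And>y. 0 \<le> y \<Longrightarrow> y \<le> x \<Longrightarrow> \<phi> y \<le> c" for x c
    unfolding f_def using that by (intro cSUP_least) auto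
  show ?thesis
  proof (rule positive_functional_from_cone[of f "norm \<phi>"])
    fix x y :: 'a assume x: "0 \<le> x" and y: "0 \<le> y"
    have "f (x + y) \<le> f x + f y"
    proof (rule least)
      fix z assume z: "0 \<le> z" "z \<le> x + y"
      have "z - inf z x = sup 0 (z - x)"
        unfolding diff_inf_eq_sup add_sup_distrib_left by simp
      also have "\<dots> \<le> y"
        using z y by (simp add: diff_le_eq add.commute)
      finally have "\<phi> (z - inf z x) \<le> f y"
        by (intro upper) (simp_all only: diff_ge_0_iff_ge inf_le1)
      moreover have "\<phi> (inf z x) \<le> f x"
        using z x by (intro upper) auto
      moreover have "\<phi> z = \<phi> (z - inf z x) + \<phi> (inf z x)"
        by (metis blinfun.add_right diff_add_cancel)
      ultimately show "\<phi> z \<le> f x + f y" by simp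
    qed (use x y in simp)
    moreover have "f x \<le> f (x + y) - f y"
    proof (rule least[OF x])
      fix a assume a: "0 \<le> a" "a \<le> x"
      have "f y \<le> f (x + y) - \<phi> a"
      proof (rule least[OF y])
        fix b assume b: "0 \<le> b" "b \<le> y"
        have "\<phi> (a + b) \<le> f (x + y)"
          using a b by (intro upper add_mono add_nonneg_nonneg)
        then show "\<phi> b \<le> f (x + y) - \<phi> a"
          by (simp add: blinfun.add_right)
      qed
      then show "\<phi> a \<le> f (x + y) - f y" by simp
    qed
    ultimately show "f (x + y) = f x + f y" by simp
  next
    fix x :: 'a assume x: "0 \<le> x"
    show "0 \<le> f x"
      using upper[of 0 x] x by (simp add: blinfun.zero_right)
    show "f x \<le> norm \<phi> * norm x"
      using bd by (intro least x)
  next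
    fix g :: "'a \<Rightarrow>\<^sub>L real" assume "0 \<le> g" "\<And>x. 0 \<le> x \<Longrightarrow> g x = f x"
    then show thesis
      using that[of g] upper by auto
  qed
qed

section \<open>Order continuous dual norms\<close>

lemma isGlb_real_zero_iff:
  fixes S :: "real set"
  assumes "\<And>s. s \<in> S \<Longrightarrow> 0 \<le> s"
  shows "isGlb UNIV S 0 \<longleftrightarrow> (\<forall>e>0. \<exists>s\<in>S. s < e)"
proof
  assume glb: "isGlb UNIV S 0"
  show "\<forall>e>0. \<exists>s\<in>S. s < e"
  proof (intro allI impI, rule ccontr)
    fix e :: real assume "e > 0" "\<not> (\<exists>s\<in>S. s < e)"
    then have "isLb UNIV S e"
      by (auto simp: isLb_def setge_def not_less)
    with glb \<open>e > 0\<close> show False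
      by (auto simp: isGlb_def greatestP_def setle_def)
  qed
next
  assume r: "\<forall>e>0. \<exists>s\<in>S. s < e"
  show "isGlb UNIV S 0"
    unfolding isGlb_def greatestP_def setle_def
  proof (intro conjI ballI)
    show "isLb UNIV S 0" using assms by (simp add: isLb_def setge_def)
    fix y assume "y \<in> Collect (isLb UNIV S)"
    then show "y \<le> 0"
      using r by (force simp: isLb_def setge_def not_less[symmetric])
  qed
qed

text \<open>
  Let \<open>S N\<close> be the component of \<open>\<phi>\<close> carried by \<open>x 0 + \<dots> + x N\<close> and \<open>\<psi>\<close> the component carried by
  all \<open>x n\<close>. The differences \<open>\<psi> - S N\<close> decrease to \<open>0\<close>, hence tend to \<open>0\<close> in norm. For \<open>n > N\<close>
  disjointness gives \<open>S N (x n) = 0\<close>, while \<open>\<phi> (x n) \<le> \<psi> (x n)\<close>, so \<open>\<phi> (x n)\<close> is at most the norm of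
  \<open>\<psi> - S N\<close>.
\<close>
lemma disjoint_null_if_dual_oc:
  fixes \<phi> :: "'a::banach_lattice \<Rightarrow>\<^sub>L real"
  assumes oc: "order_continuous_norm TYPE('a \<Rightarrow>\<^sub>L real)" and \<phi>: "0 \<le> \<phi>"
    and disj: "disjoint_seq x" and x0: "\<And>n. 0 \<le> x n" and x1: "\<And>n. norm (x n) \<le> 1"
  shows "(\<lambda>n. \<phi> (x n)) \<longlonglongrightarrow> 0"
proof -
  define u where "u N = (\<Sum>i\<le>N. x i)" for N
  have u0: "0 \<le> u N" for N
    unfolding u_def by (intro sum_nonneg x0)
  have u_mono: "u M \<le> u N" if "M \<le> N" for M N
    unfolding u_def using that by (intro sum_mono2 x0) auto
  have x_le_u: "x n \<le> u N" if "n \<le> N" for n N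
    unfolding u_def using that by (intro member_le_sum_lattice x0) auto
  have "\<exists>g. 0 \<le> g \<and> (\<forall>y\<ge>0. (\<lambda>k. \<phi> (inf y (real k *\<^sub>R u N))) \<longlonglongrightarrow> blinfun_apply g y)" for N
  proof (rule component_functional[OF \<phi>, of "\<lambda>k. real k *\<^sub>R u N"])
    show "\<exists>k'. real k *\<^sub>R u N + real k *\<^sub>R u N \<le> real k' *\<^sub>R u N" for k
      by (rule exI[of _ "2 * k"]) (simp add: scaleR_add_left[symmetric])
  qed (use u0 in \<open>auto simp: incseq_def intro!: scaleR_nonneg_nonneg scaleR_right_mono\<close>)
  then obtain S where S0: "\<And>N. 0 \<le> S N"
    and S: "\<And>N y. 0 \<le> y \<Longrightarrow> (\<lambda>k. \<phi> (inf y (real k *\<^sub>R u N))) \<longlonglongrightarrow> blinfun_apply (S N) y"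
    by metis
  obtain \<psi> where \<psi>0: "0 \<le> \<psi>"
    and \<psi>: "\<And>y. 0 \<le> y \<Longrightarrow> (\<lambda>k. \<phi> (inf y (real k *\<^sub>R u k))) \<longlonglongrightarrow> blinfun_apply \<psi> y"
  proof (rule component_functional[OF \<phi>, of "\<lambda>k. real k *\<^sub>R u k"])
    show "\<exists>k'. real k *\<^sub>R u k + real k *\<^sub>R u k \<le> real k' *\<^sub>R u k'" for k
    proof
      have "real k *\<^sub>R u k + real k *\<^sub>R u k = real (2 * k) *\<^sub>R u k"
        by (simp add: scaleR_add_left[symmetric])
      also have "\<dots> \<le> real (2 * k) *\<^sub>R u (2 * k)"
        by (intro scaleR_left_mono u_mono) auto
      finally show "real k *\<^sub>R u k + real k *\<^sub>R u k \<le> real (2 * k) *\<^sub>R u (2 * k)" .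
    qed
  qed (use u0 u_mono in \<open>auto simp: incseq_def intro!: scaleR_nonneg_nonneg scaleR_mono'\<close>)
  have S_mono: "S M y \<le> S N y" if "M \<le> N" "0 \<le> y" for M N y
    by (rule LIMSEQ_le[OF S S])
      (use that u_mono in \<open>auto intro!: exI[of _ 0] pos_mono[OF \<phi>] inf_mono scaleR_left_mono\<close>)
  have S_le: "S N y \<le> \<psi> y" if "0 \<le> y" for N y
    by (rule LIMSEQ_le[OF S \<psi>])
      (use that u_mono in \<open>auto intro!: exI[of _ N] pos_mono[OF \<phi>] inf_mono scaleR_left_mono\<close>)
  have \<psi>_le: "\<psi> y \<le> c" if "0 \<le> y" "\<And>N. S N y \<le> c" for y c
  proof (rule LIMSEQ_le_const2[OF \<psi>[OF that(1)]], intro exI allI impI)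
    fix k
    have "incseq (\<lambda>j. \<phi> (inf y (real j *\<^sub>R u k)))"
      using u0 by (auto simp: incseq_def intro!: pos_mono[OF \<phi>] inf_mono scaleR_right_mono)
    then have "\<phi> (inf y (real k *\<^sub>R u k)) \<le> S k y"
      using S[OF that(1)] by (rule incseq_le)
    then show "\<phi> (inf y (real k *\<^sub>R u k)) \<le> c"
      using that(2) order_trans by blast
  qed
  have dir: "directed (UNIV :: nat set) (\<le>)"
    by (auto simp: directed_def intro: exI[of _ "max _ _"] max.cobounded1 max.cobounded2)
  have "decreases_to UNIV (\<le>) (\<lambda>N. \<psi> - S N) 0"
    unfolding decreases_to_def
  proof (intro conjI ballI impI)
    show "\<psi> - S N \<le> \<psi> - S M" if "M \<le> N" for M N
      using S_mono[OF that] by (simp add: less_eq_blinfun_def blinfun.diff_left)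
    show "isGlb UNIV (range (\<lambda>N. \<psi> - S N)) 0"
      unfolding isGlb_def greatestP_def isLb_def setge_def setle_def
    proof (intro conjI ballI UNIV_I)
      show "0 \<le> y" if "y \<in> range (\<lambda>N. \<psi> - S N)" for y
        using that S_le by (auto simp: blinfun_nonneg_iff blinfun.diff_left)
      fix \<eta> assume "\<eta> \<in> Collect (\<lambda>\<eta>. (\<forall>y\<in>range (\<lambda>N. \<psi> - S N). \<eta> \<le> y) \<and> \<eta> \<in> UNIV)"
      then have \<eta>: "\<eta> y \<le> \<psi> y - S N y" if "0 \<le> y" for N y
        using that by (simp add: less_eq_blinfun_def blinfun.diff_left)
      show "\<eta> \<le> 0"
        unfolding less_eq_blinfun_def
      proof (intro allI impI)
        fix y :: 'a assume y: "0 \<le> y"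
        have "S N y \<le> \<psi> y - \<eta> y" for N
          using \<eta>[OF y, of N] by simp
        then have "\<psi> y \<le> \<psi> y - \<eta> y"
          by (intro \<psi>_le y)
        then show "\<eta> y \<le> blinfun_apply 0 y" by simp
      qed
    qed
  qed
  from order_continuous_normD[OF oc dir this]
  have "isGlb UNIV (range (\<lambda>N. norm (\<psi> - S N))) 0"
    by (simp add: decreases_to_def)
  then have "\<forall>e>0. \<exists>s\<in>range (\<lambda>N. norm (\<psi> - S N)). s < e"
    by (subst (asm) isGlb_real_zero_iff) auto
  then have small: "\<exists>N. norm (\<psi> - S N) < e" if "e > 0" for e
    using that by auto
  show ?thesis
  proof (rule LIMSEQ_I)
    fix e :: real assume "e > 0"
    then obtain N where N: "norm (\<psi> - S N) < e" using small by blast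
    have "norm (\<phi> (x n)) < e" if n: "n > N" for n
    proof -
      have "inf (x n) (real k *\<^sub>R u N) = 0" for k
      proof -
        have "inf (u N) (x n) = 0"
          unfolding u_def using x0 disj n by (intro inf_sum_zero) (auto simp: disjoint_seq_nonneg)
        then have "inf (1 *\<^sub>R x n) (real k *\<^sub>R u N) = 0"
          by (intro inf_scaleR_zero) (auto simp: inf_commute)
        then show ?thesis by simp
      qed
      then have "S N (x n) = 0"
        using S[OF x0, of n N] by (simp add: LIMSEQ_const_iff blinfun.zero_right)
      moreover have "\<phi> (x n) \<le> \<psi> (x n)"
      proof (rule LIMSEQ_le_const[OF \<psi>[OF x0]], intro exI allI impI)
        fix k assume k: "k \<ge> max n 1"
        have "x n \<le> 1 *\<^sub>R u k" using x_le_u k by simp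
        also have "\<dots> \<le> real k *\<^sub>R u k"
          using k u0 by (intro scaleR_right_mono) auto
        finally show "\<phi> (x n) \<le> \<phi> (inf (x n) (real k *\<^sub>R u k))"
          by (simp add: inf_absorb1)
      qed
      moreover have "(\<psi> - S N) (x n) \<le> norm (\<psi> - S N) * norm (x n)"
        using norm_blinfun[of "\<psi> - S N" "x n"] by simp
      moreover have "norm (\<psi> - S N) * norm (x n) \<le> norm (\<psi> - S N)"
        using x1 by (intro mult_left_le) auto
      moreover have "0 \<le> \<phi> (x n)"
        using \<phi> x0 by (simp add: blinfun_nonneg_iff)
      ultimately show ?thesis
        using N by (simp add: blinfun.diff_left)
    qed
    then show "\<exists>no. \<forall>n\<ge>no. norm (\<phi> (x n) - 0) < e"
      by (intro exI[of _ "Suc N"]) auto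
  qed
qed

text \<open>
  The pointwise infimum of a decreasing net of positive functionals is additive on the cone, as
  the index set is directed; so a net decreasing to \<open>0\<close> tends to \<open>0\<close> pointwise. To pass to
  norms, fix a member \<open>\<psi> i0\<close>. As it is null on disjoint sequences of the ball, it is uniformly
  small on the excesses \<open>(x - u)\<^sup>+\<close> for a suitable \<open>u\<close>. Later members are dominated by
  \<open>\<psi> i0\<close> on these excesses and are small at the single point \<open>u\<close>, hence small on the whole ball.
\<close>
lemma dual_oc_if_disjoint_null:
  assumes null: "\<And>(\<phi> :: 'a::banach_lattice \<Rightarrow>\<^sub>L real) x. 0 \<le> \<phi> \<Longrightarrow> disjoint_seq x \<Longrightarrow>
    (\<And>n. 0 \<le> x n) \<Longrightarrow> (\<And>n. norm (x n) \<le> 1) \<Longrightarrow> (\<lambda>n. blinfun_apply \<phi> (x n)) \<longlonglongrightarrow> 0"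
  shows "order_continuous_norm TYPE('a \<Rightarrow>\<^sub>L real)"
  unfolding order_continuous_norm_def
proof (intro allI impI, elim conjE)
  fix I R and \<psi> :: "('a \<Rightarrow>\<^sub>L real) \<Rightarrow> ('a \<Rightarrow>\<^sub>L real)"
  assume dir: "directed I R" and dec: "decreases_to I R \<psi> 0"
  have mono: "\<psi> j y \<le> \<psi> i y" if "i \<in> I" "j \<in> I" "R i j" "0 \<le> y" for i j y
    using dec that by (auto simp: decreases_to_def less_eq_blinfun_def)
  have \<psi>0: "0 \<le> \<psi> i" if "i \<in> I" for i
    using dec that by (auto simp: decreases_to_def isGlb_def greatestP_def isLb_def setge_def)
  have greatest: "\<eta> \<le> 0" if "\<And>i. i \<in> I \<Longrightarrow> \<eta> \<le> \<psi> i" for \<eta>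
    using dec that by (auto simp: decreases_to_def isGlb_def greatestP_def isLb_def setge_def setle_def)
  have "\<forall>i\<in>I. \<forall>j\<in>I. \<exists>k\<in>I. R i k \<and> R j k"
    using dir unfolding directed_def by (elim conjE)
  then have join: "\<exists>k\<in>I. R i k \<and> R j k" if "i \<in> I" "j \<in> I" for i j
    using that by blast
  obtain i0 where i0: "i0 \<in> I" using dir by (auto simp: directed_def)
  define f where "f y = (INF i\<in>I. \<psi> i y)" for y
  have lower: "f y \<le> \<psi> i y" if "i \<in> I" "0 \<le> y" for i y
    unfolding f_def using that \<psi>0
    by (intro cINF_lower bdd_belowI2[of _ 0]) (auto simp: blinfun_nonneg_iff)
  have ge: "c \<le> f y" if "\<And>i. i \<in> I \<Longrightarrow> c \<le> \<psi> i y" for c y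
    unfolding f_def using that i0 by (intro cINF_greatest) auto
  obtain g :: "'a \<Rightarrow>\<^sub>L real" where g: "0 \<le> g" "\<And>y. 0 \<le> y \<Longrightarrow> g y = f y"
  proof (rule positive_functional_from_cone[of f "norm (\<psi> i0)"])
    fix x y :: 'a assume x: "0 \<le> x" and y: "0 \<le> y"
    have "f x + f y \<le> f (x + y)"
      by (rule ge) (simp add: blinfun.add_right add_mono lower x y)
    moreover have "f (x + y) - f y \<le> f x"
    proof (rule ge)
      fix i assume i: "i \<in> I"
      have "f (x + y) - \<psi> i x \<le> f y"
      proof (rule ge)
        fix j assume j: "j \<in> I"
        from join[OF i j] obtain k where k: "k \<in> I" "R i k" "R j k" by blast
        have "f (x + y) \<le> \<psi> k x + \<psi> k y"
          using lower[OF k(1), of "x + y"] x y by (simp add: blinfun.add_right)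
        then show "f (x + y) - \<psi> i x \<le> \<psi> j y"
          using mono[OF i k(1,2) x] mono[OF j k(1,3) y] by simp
      qed
      then show "f (x + y) - f y \<le> \<psi> i x" by simp
    qed
    ultimately show "f (x + y) = f x + f y" by simp
  next
    fix x :: 'a assume x: "0 \<le> x"
    show "0 \<le> f x"
      using \<psi>0 x by (intro ge) (auto simp: blinfun_nonneg_iff)
    show "f x \<le> norm (\<psi> i0) * norm x"
      using lower[OF i0 x] norm_blinfun[of "\<psi> i0" x] by simp
  qed blast
  have "g \<le> 0"
    using g lower by (intro greatest) (simp add: less_eq_blinfun_def)
  then have f_le: "f y \<le> 0" if "0 \<le> y" for y
    using that g by (auto simp: less_eq_blinfun_def)
  have small: "\<exists>i\<in>I. norm (\<psi> i) < e" if e: "e > 0" for e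
  proof -
    have "\<exists>u\<ge>0. \<forall>x\<in>{x. 0 \<le> x \<and> norm x \<le> 1}. norm (\<psi> i0 (pprt (x - u))) < e / 4"
    proof (rule small_above_if_disjoint_null)
      show "bounded {x :: 'a. 0 \<le> x \<and> norm x \<le> 1}"
        by (auto simp: bounded_iff)
      show "y \<in> {x. 0 \<le> x \<and> norm x \<le> 1}"
        if "x \<in> {x. 0 \<le> x \<and> norm x \<le> 1}" "0 \<le> y" "y \<le> x" for x y :: 'a
        using that norm_mono_nonneg[of y x] by auto
      show "(\<lambda>n. norm (\<psi> i0 (y n))) \<longlonglongrightarrow> 0"
        if "disjoint_seq y" "range y \<subseteq> {x. 0 \<le> x \<and> norm x \<le> 1}" for y
        using that by (intro tendsto_norm_zero null \<psi>0 i0) auto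
    qed (use e in \<open>auto intro: blinfun.bounded_linear_right\<close>)
    then obtain u where u: "0 \<le> u"
      "\<And>x. 0 \<le> x \<Longrightarrow> norm x \<le> 1 \<Longrightarrow> norm (\<psi> i0 (pprt (x - u))) < e / 4"
      by auto
    obtain j where j: "j \<in> I" "\<psi> j u < e / 4"
    proof (rule ccontr)
      assume "\<not> thesis"
      then have "e / 4 \<le> f u" using that by (intro ge) (meson not_le)
      then show False using f_le[OF u(1)] e by simp
    qed
    from join[OF i0 j(1)] obtain k where k: "k \<in> I" "R i0 k" "R j k" by blast
    have "norm (\<psi> k) \<le> e / 2"
    proof (rule norm_pos_functional_le)
      fix x :: 'a assume x: "0 \<le> x" "norm x \<le> 1"
      have "\<psi> k x = \<psi> k (inf x u) + \<psi> k (pprt (x - u))"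
        by (metis blinfun.add_right inf_add_pprt_diff)
      also have "\<psi> k (inf x u) \<le> \<psi> k u"
        by (intro pos_mono \<psi>0 k) simp
      also have "\<psi> k u \<le> \<psi> j u"
        using mono j k u by blast
      also have "\<psi> k (pprt (x - u)) \<le> \<psi> i0 (pprt (x - u))"
        using mono i0 k by simp
      also have "\<psi> i0 (pprt (x - u)) \<le> e / 4"
        using u(2)[OF x] by simp
      finally show "\<psi> k x \<le> e / 2" using j(2) by simp
    qed (use e \<psi>0 k in auto)
    then show ?thesis using k e by (intro bexI[of _ k]) auto
  qed
  show "decreases_to I R (\<lambda>i. norm (\<psi> i)) 0"
    unfolding decreases_to_def
  proof (intro conjI ballI impI)
    fix i j assume ij: "i \<in> I" "j \<in> I" "R i j"
    show "norm (\<psi> j) \<le> norm (\<psi> i)"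
    proof (rule norm_pos_functional_le)
      fix x :: 'a assume x: "0 \<le> x" "norm x \<le> 1"
      have "\<psi> j x \<le> \<psi> i x" using mono ij x by blast
      also have "\<dots> \<le> norm (\<psi> i) * norm x"
        using norm_blinfun[of "\<psi> i" x] by simp
      also have "\<dots> \<le> norm (\<psi> i)"
        using x by (intro mult_left_le) auto
      finally show "\<psi> j x \<le> norm (\<psi> i)" .
    qed (use \<psi>0 ij in auto)
  next
    show "isGlb UNIV ((\<lambda>i. norm (\<psi> i)) ` I) 0"
      using small by (subst isGlb_real_zero_iff) auto
  qed
qed

section \<open>The Hahn--Banach theorem\<close>

text \<open>
  Subhomogeneity is the convenient half to verify; equality for \<open>t \<ge> 0\<close> follows.
\<close>
definition sublinear :: "('a::real_vector \<Rightarrow> real) \<Rightarrow> bool"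
  where "sublinear p \<longleftrightarrow> (\<forall>x y. p (x + y) \<le> p x + p y) \<and> (\<forall>t x. 0 \<le> t \<longrightarrow> p (t *\<^sub>R x) \<le> t * p x)"

lemma sublinear_add: "sublinear p \<Longrightarrow> p (x + y) \<le> p x + p y"
  by (simp add: sublinear_def)

lemma sublinear_zero: "sublinear p \<Longrightarrow> p 0 = 0"
  unfolding sublinear_def by (metis add.right_neutral add_le_same_cancel1 antisym mult_zero_left
      order_refl scale_zero_left add_le_cancel_left)

lemma sublinear_scaleR: 
  assumes "sublinear p" "0 \<le> t"
  shows "p (t *\<^sub>R x) = t * p x"
proof (cases "t = 0")
  case True
  then show ?thesis using sublinear_zero[OF assms(1)] by simp
next
  case False
  then have t: "t > 0" using assms by simp
  have "p (inverse t *\<^sub>R (t *\<^sub>R x)) \<le> inverse t * p (t *\<^sub>R x)"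
    using assms unfolding sublinear_def by (metis inverse_nonnegative_iff_nonnegative)
  then have "t * p x \<le> p (t *\<^sub>R x)"
    using t by (simp add: field_simps)
  moreover have "p (t *\<^sub>R x) \<le> t * p x"
    using assms by (simp add: sublinear_def)
  ultimately show ?thesis by simp
qed

lemma sublinear_minus_le: "sublinear p \<Longrightarrow> - p (- x) \<le> p x"
  using sublinear_add[of p x "- x"] sublinear_zero[of p] by simp

text \<open>
  The pointwise infimum of a chain of sublinear functionals below \<open>p\<close> is sublinear; it is finite
  because \<open>- p (- x)\<close> is a lower bound at \<open>x\<close>. Zorn's lemma applies.
\<close>
lemma minimal_sublinear:
  fixes p :: "'a::real_vector \<Rightarrow> real"
  assumes p: "sublinear p"
  obtains q where "sublinear q" "q \<le> p" "\<And>r. sublinear r \<Longrightarrow> r \<le> q \<Longrightarrow> r = q"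
proof -
  let ?A = "{q. sublinear q \<and> q \<le> p}"
  have "\<exists>m\<in>?A. \<forall>a\<in>?A. a \<le> m \<longrightarrow> a = m"
  proof (rule predicate_Zorn)
    show "partial_order_on ?A (relation_of (\<lambda>a b. b \<le> a) ?A)"
      by (intro partial_order_on_relation_ofI) auto
    fix C assume "C \<in> Chains (relation_of (\<lambda>a b. b \<le> a) ?A)"
    then have C: "\<And>q. q \<in> C \<Longrightarrow> sublinear q" "\<And>q. q \<in> C \<Longrightarrow> q \<le> p"
      and ch: "\<And>q r. q \<in> C \<Longrightarrow> r \<in> C \<Longrightarrow> q \<le> r \<or> r \<le> q"
      by (auto simp: Chains_def relation_of_def)
    show "\<exists>u\<in>?A. \<forall>a\<in>C. u \<le> a"
    proof (cases "C = {}")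
      case True
      then show ?thesis using p by auto
    next
      case False
      define u where "u x = (INF q\<in>C. q x)" for x
      have lower: "u x \<le> q x" if "q \<in> C" for q x
        unfolding u_def
      proof (rule cINF_lower[OF _ that])
        show "bdd_below ((\<lambda>q. q x) ` C)"
        proof (rule bdd_belowI2)
          fix r assume r: "r \<in> C"
          have "- p (- x) \<le> - r (- x)"
            using C(2)[OF r] by (simp add: le_fun_def)
          also have "\<dots> \<le> r x" using sublinear_minus_le[OF C(1)[OF r]] .
          finally show "- p (- x) \<le> r x" .
        qed
      qed
      have ge: "c \<le> u x" if "\<And>q. q \<in> C \<Longrightarrow> c \<le> q x" for c x
        unfolding u_def using that False by (intro cINF_greatest) auto
      have "u (x + y) \<le> u x + u y" for x y
      proof -
        have "u (x + y) - u y \<le> u x"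
        proof (rule ge)
          fix q assume q: "q \<in> C"
          have "u (x + y) - q x \<le> u y"
          proof (rule ge)
            fix r assume r: "r \<in> C"
            have "\<exists>s\<in>C. s \<le> q \<and> s \<le> r" using ch[OF q r] q r by auto
            then obtain s where s: "s \<in> C" "s \<le> q" "s \<le> r" by blast
            have "u (x + y) \<le> s (x + y)" by (rule lower[OF s(1)])
            also have "\<dots> \<le> s x + s y" by (rule sublinear_add[OF C(1)[OF s(1)]])
            also have "\<dots> \<le> q x + r y" using s by (intro add_mono) (auto simp: le_fun_def)
            finally show "u (x + y) - q x \<le> r y" by simp
          qed
          then show "u (x + y) - u y \<le> q x" by simp
        qed
        then show ?thesis by simp
      qed
      moreover have "u (t *\<^sub>R x) \<le> t * u x" if t: "0 \<le> t" for t x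
      proof (cases "t = 0")
        case True
        obtain q where "q \<in> C" using False by blast
        then show ?thesis
          using lower[OF \<open>q \<in> C\<close>, of 0] sublinear_zero[OF C(1)[OF \<open>q \<in> C\<close>]] True by simp
      next
        case False
        have "u (t *\<^sub>R x) / t \<le> u x"
        proof (rule ge)
          fix q assume q: "q \<in> C"
          have "u (t *\<^sub>R x) \<le> t * q x"
            using lower[OF q, of "t *\<^sub>R x"] sublinear_scaleR[OF C(1)[OF q] t] by simp
          then show "u (t *\<^sub>R x) / t \<le> q x"
            using t False by (simp add: field_simps)
        qed
        then show ?thesis using t False by (simp add: field_simps)
      qed
      ultimately have "sublinear u" by (simp add: sublinear_def)
      moreover have "u \<le> p"
        using False lower C(2) by (metis all_not_in_conv le_funI order_trans)
      ultimately show ?thesis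
        using lower by (auto simp: le_fun_def)
    qed
  qed
  then obtain q where "sublinear q" "q \<le> p" "\<And>r. sublinear r \<Longrightarrow> r \<le> p \<Longrightarrow> r \<le> q \<Longrightarrow> r = q"
    by auto
  then show ?thesis using that order_trans by metis
qed

text \<open>
  \<open>r x = inf\<^bsub>t \<ge> 0\<^esub> (q (x + t y) - t q y)\<close>. A minimal sublinear functional equals its own \<open>r\<close> for
  every \<open>y\<close>, so it is odd and therefore linear.
\<close>
lemma shrink_sublinear:
  fixes q :: "'a::real_vector \<Rightarrow> real"
  assumes q: "sublinear q"
  obtains r where "sublinear r" "r \<le> q" "r (- y) \<le> - q y"
proof -
  define r where "r x = (INF t\<in>{0..}. q (x + t *\<^sub>R y) - t * q y)" for x
  have lower: "r x \<le> q (x + t *\<^sub>R y) - t * q y" if "0 \<le> t" for t x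
    unfolding r_def
  proof (rule cINF_lower)
    show "bdd_below ((\<lambda>t. q (x + t *\<^sub>R y) - t * q y) ` {0..})"
    proof (rule bdd_belowI2)
      fix t :: real assume t: "t \<in> {0..}"
      have "t * q y = q ((x + t *\<^sub>R y) + (- x))"
        using sublinear_scaleR[OF q, of t y] t by simp
      also have "\<dots> \<le> q (x + t *\<^sub>R y) + q (- x)"
        by (rule sublinear_add[OF q])
      finally show "- q (- x) \<le> q (x + t *\<^sub>R y) - t * q y" by simp
    qed
  qed (use that in simp)
  have ge: "c \<le> r x" if "\<And>t. 0 \<le> t \<Longrightarrow> c \<le> q (x + t *\<^sub>R y) - t * q y" for c x
    unfolding r_def using that by (intro cINF_greatest) auto
  have le: "r \<le> q"
    using lower[of 0] by (auto simp: le_fun_def)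
  have "r (x + z) \<le> r x + r z" for x z
  proof -
    have "r (x + z) - r z \<le> r x"
    proof (rule ge)
      fix s :: real assume s: "0 \<le> s"
      have "r (x + z) - (q (x + s *\<^sub>R y) - s * q y) \<le> r z"
      proof (rule ge)
        fix t :: real assume t: "0 \<le> t"
        have "r (x + z) \<le> q (x + z + (s + t) *\<^sub>R y) - (s + t) * q y"
          using s t by (intro lower) simp
        moreover have "q (x + z + (s + t) *\<^sub>R y) \<le> q (x + s *\<^sub>R y) + q (z + t *\<^sub>R y)"
          using sublinear_add[OF q, of "x + s *\<^sub>R y" "z + t *\<^sub>R y"] by (simp add: algebra_simps)
        ultimately show "r (x + z) - (q (x + s *\<^sub>R y) - s * q y) \<le> q (z + t *\<^sub>R y) - t * q y"
          by (simp add: algebra_simps)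
      qed
      then show "r (x + z) - r z \<le> q (x + s *\<^sub>R y) - s * q y" by simp
    qed
    then show ?thesis by simp
  qed
  moreover have "r (t *\<^sub>R x) \<le> t * r x" if t: "0 \<le> t" for t x
  proof (cases "t = 0")
    case True
    then show ?thesis using le sublinear_zero[OF q] by (simp add: le_fun_def) metis
  next
    case False
    have "r (t *\<^sub>R x) / t \<le> r x"
    proof (rule ge)
      fix s :: real assume s: "0 \<le> s"
      have "r (t *\<^sub>R x) \<le> q (t *\<^sub>R x + (t * s) *\<^sub>R y) - (t * s) * q y"
        using s t by (intro lower) simp
      also have "t *\<^sub>R x + (t * s) *\<^sub>R y = t *\<^sub>R (x + s *\<^sub>R y)"
        by (simp add: algebra_simps)
      also have "q (t *\<^sub>R (x + s *\<^sub>R y)) = t * q (x + s *\<^sub>R y)"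
        by (rule sublinear_scaleR[OF q t])
      finally show "r (t *\<^sub>R x) / t \<le> q (x + s *\<^sub>R y) - s * q y"
        using t False by (simp add: field_simps)
    qed
    then show ?thesis using t False by (simp add: field_simps)
  qed
  ultimately have "sublinear r" by (simp add: sublinear_def)
  moreover have "r (- y) \<le> - q y"
    using lower[of 1 "- y"] sublinear_zero[OF q] by simp
  ultimately show ?thesis using le that by blast
qed

text \<open>
  Shrinking \<open>p\<close> in direction \<open>y\<close> before passing to a minimal functional forces \<open>f (- y) \<le> - p y\<close>,
  that is \<open>f y = p y\<close>.
\<close>
lemma Hahn_Banach_sublinear:
  fixes p :: "'a::real_vector \<Rightarrow> real"
  assumes p: "sublinear p"
  obtains f where "linear f" "\<And>x. f x \<le> p x" "f y = p y"
proof -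
  obtain r where r: "sublinear r" "r \<le> p" "r (- y) \<le> - p y"
    by (rule shrink_sublinear[OF p])
  obtain f where f: "sublinear f" "f \<le> r" and min: "\<And>g. sublinear g \<Longrightarrow> g \<le> f \<Longrightarrow> g = f"
    by (rule minimal_sublinear[OF r(1)]) blast
  have neg: "f (- z) = - f z" for z
  proof -
    obtain g where "sublinear g" "g \<le> f" "g (- z) \<le> - f z"
      by (rule shrink_sublinear[OF f(1)])
    then have "f (- z) \<le> - f z"
      using min by metis
    then show ?thesis
      using sublinear_minus_le[OF f(1), of z] by simp
  qed
  have "linear f"
  proof (rule linearI)
    fix x z
    show "f (x + z) = f x + f z"
      using sublinear_add[OF f(1), of x z] sublinear_add[OF f(1), of "- x" "- z"]
        neg[of "x + z"] neg[of x] neg[of z] by simp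
  next
    fix t :: real and x
    show "f (t *\<^sub>R x) = t *\<^sub>R f x"
    proof (cases "0 \<le> t")
      case True
      then show ?thesis using sublinear_scaleR[OF f(1)] by simp
    next
      case False
      then show ?thesis
        using sublinear_scaleR[OF f(1), of "- t" x] neg[of "t *\<^sub>R x"] by simp
    qed
  qed
  moreover have le: "f x \<le> p x" for x
    using f(2) r(2) by (meson le_funD order_trans)
  moreover have "p y \<le> f y"
    using f(2) r(3) neg[of y] by (metis le_funD neg_le_iff_le order_trans)
  ultimately show ?thesis
    using that by (metis antisym)
qed

text \<open>
  A linear functional dominated by \<open>x \<mapsto> norm (x\<^sup>+)\<close> is positive, because this sublinear functional
  vanishes on the negative cone.
\<close>
lemma positive_norming_functional:
  fixes y :: "'a::banach_lattice"
  obtains \<phi> :: "'a \<Rightarrow>\<^sub>L real" where "0 \<le> \<phi>" "norm \<phi> \<le> 1" "\<phi> y = norm (pprt y)"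
proof -
  have "sublinear (\<lambda>x :: 'a. norm (pprt x))"
    unfolding sublinear_def
  proof (intro conjI allI impI)
    fix x z :: 'a
    have "x + z \<le> pprt x + pprt z"
      by (intro add_mono) (simp_all add: pprt_def)
    then have "pprt (x + z) \<le> pprt x + pprt z"
      unfolding pprt_def[of "x + z"] by simp
    then have "norm (pprt (x + z)) \<le> norm (pprt x + pprt z)"
      by (intro norm_mono_nonneg) simp_all
    then show "norm (pprt (x + z)) \<le> norm (pprt x) + norm (pprt z)"
      using norm_triangle_ineq order_trans by blast
  next
    fix t :: real and x :: 'a assume "0 \<le> t"
    then show "norm (pprt (t *\<^sub>R x)) \<le> t * norm (pprt x)"
      by (simp flip: scaleR_pprt)
  qed
  then obtain f where f: "linear f" "\<And>x :: 'a. f x \<le> norm (pprt x)" "f y = norm (pprt y)"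
    by (rule Hahn_Banach_sublinear[where y = y]) blast
  have bd: "\<bar>f x\<bar> \<le> norm x" for x
    using f(2)[of x] f(2)[of "- x"] norm_pprt_le[of x] norm_pprt_le[of "- x"] linear_neg[OF f(1), of x]
    by simp
  then have "bounded_linear f"
    using f(1) by (intro bounded_linear_intro[where K = 1]) (auto simp: linear_add linear_scale)
  then have F: "blinfun_apply (Blinfun f) = f"
    by (rule bounded_linear_Blinfun_apply)
  have "0 \<le> Blinfun f"
  proof (unfold blinfun_nonneg_iff, intro allI impI)
    fix x :: 'a assume "0 \<le> x"
    then have "f (- x) \<le> 0"
      using f(2)[of "- x"] by simp
    then show "0 \<le> Blinfun f x"
      by (simp add: F linear_neg[OF f(1)])
  qed
  moreover have "norm (Blinfun f) \<le> 1"
    by (rule norm_blinfun_bound) (use bd in \<open>auto simp: F\<close>)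
  ultimately show ?thesis
    using that f(3) by (simp add: F)
qed

section \<open>Weakly null sequences and order intervals\<close>

lemma eventually_all_subseq:
  assumes "\<And>i :: nat. \<forall>\<^sub>F n in sequentially. P i n"
  obtains r :: "nat \<Rightarrow> nat" where "strict_mono r" "\<And>i. P i (r i)"
proof -
  have "\<exists>r. \<forall>n. P n (r n) \<and> r n < r (Suc n)"
  proof (rule dependent_nat_choice)
    show "\<exists>x. P 0 x"
      using assms[of 0] by (auto simp: eventually_sequentially)
    show "\<exists>y. P (Suc n) y \<and> x < y" for x n
      using eventually_conj[OF assms[of "Suc n"] eventually_gt_at_top[of x]]
      by (auto simp: eventually_sequentially)
  qed
  then show ?thesis using that by (auto simp: strict_mono_Suc_iff)
qed

lemma not_null_subseq:
  fixes x :: "nat \<Rightarrow> real"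
  assumes "\<not> x \<longlonglongrightarrow> 0" "\<And>n. 0 \<le> x n"
  obtains \<delta> and r :: "nat \<Rightarrow> nat" where "\<delta> > 0" "strict_mono r" "\<And>n. \<delta> \<le> x (r n)"
proof -
  obtain \<delta> where \<delta>: "\<delta> > 0" "\<And>N. \<exists>n\<ge>N. \<not> norm (x n - 0) < \<delta>"
    using assms(1) by (auto simp: LIMSEQ_iff)
  have "\<exists>r :: nat \<Rightarrow> nat. \<forall>n. \<delta> \<le> x (r n) \<and> r n < r (Suc n)"
  proof (rule dependent_nat_choice)
    have *: "\<exists>n\<ge>N. \<delta> \<le> x n" for N
      using \<delta>(2)[of N] assms(2) by (auto simp: not_less)
    show "\<exists>n. \<delta> \<le> x n" using * by blast
    show "\<exists>n. \<delta> \<le> x n \<and> m < n" for m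
      using *[of "Suc m"] by auto
  qed
  then obtain r :: "nat \<Rightarrow> nat" where r: "\<forall>n. \<delta> \<le> x (r n) \<and> r n < r (Suc n)"
    by blast
  show ?thesis
    by (rule that[OF \<delta>(1), of r]) (use r in \<open>auto simp: strict_mono_Suc_iff\<close>)
qed

lemma oc_sequence_lub:
  fixes z :: "nat \<Rightarrow> 'a::banach_lattice"
  assumes oc: "order_continuous_norm TYPE('a)" and bd: "\<And>n. z n \<le> u"
  obtains s where "\<And>n. z n \<le> s" "\<And>b. (\<And>n. z n \<le> b) \<Longrightarrow> s \<le> b"
    "(\<lambda>n. \<Squnion>\<^sub>f\<^sub>i\<^sub>n (z ` {..n})) \<longlonglongrightarrow> s"
proof -
  let ?v = "\<lambda>n. \<Squnion>\<^sub>f\<^sub>i\<^sub>n (z ` {..n})"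
  have inc: "incseq ?v"
    by (intro incseq_SucI Sup_fin.subset_imp) auto
  have least: "?v n \<le> b" if "\<And>n. z n \<le> b" for b n
    using that by (intro Sup_fin.boundedI) auto
  obtain s where s: "?v \<longlonglongrightarrow> s"
    using oc_incseq_convergent[OF oc inc least[OF bd]] by (auto simp: convergent_def)
  show ?thesis
  proof (rule that[OF _ _ s])
    fix n
    have "z n \<le> ?v n" by (intro Sup_fin.coboundedI) auto
    also have "?v n \<le> s" by (rule incseq_le_lim_lattice[OF inc s])
    finally show "z n \<le> s" .
  next
    fix b assume "\<And>n. z n \<le> b"
    then show "s \<le> b"
      by (intro tendsto_le_lattice[OF s tendsto_const]) (simp add: least)
  qed
qed

lemma pos_functional_lub_le:
  fixes z :: "nat \<Rightarrow> 'a::banach_lattice" and \<phi> :: "'a \<Rightarrow>\<^sub>L real"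
  assumes \<phi>: "0 \<le> \<phi>" and z0: "\<And>n. 0 \<le> z n"
    and s: "(\<lambda>n. \<Squnion>\<^sub>f\<^sub>i\<^sub>n (z ` {..n})) \<longlonglongrightarrow> s"
    and c: "\<And>n. (\<Sum>i\<le>n. \<phi> (z i)) \<le> c"
  shows "\<phi> s \<le> c"
proof (rule LIMSEQ_le_const2)
  show "(\<lambda>n. \<phi> (\<Squnion>\<^sub>f\<^sub>i\<^sub>n (z ` {..n}))) \<longlonglongrightarrow> \<phi> s"
    by (rule blinfun.tendsto[OF tendsto_const s])
  have "\<phi> (\<Squnion>\<^sub>f\<^sub>i\<^sub>n (z ` {..n})) \<le> \<phi> (\<Sum>i\<le>n. z i)" for n
    by (intro pos_mono[OF \<phi>] Sup_fin.boundedI) (auto intro: member_le_sum_lattice z0)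
  then show "\<exists>N. \<forall>n\<ge>N. \<phi> (\<Squnion>\<^sub>f\<^sub>i\<^sub>n (z ` {..n})) \<le> c"
    using c by (auto simp: blinfun.sum_right intro: order_trans)
qed

text \<open>
  Suppose the elements \<open>z\<^sub>n = y\<^sub>n \<and> u\<close> have norm at least \<open>\<delta>\<close>, and write \<open>S r\<close> for the supremum of
  the subsequence \<open>z \<circ> r\<close>. Let \<open>\<phi>\<close> be a positive functional norming \<open>S r\<close>. As \<open>\<phi> (z\<^sub>n)\<close> tends to \<open>0\<close>,
  a further subsequence has \<open>\<Sum> \<phi> (z\<^sub>n) \<le> \<delta>/2\<close>, so \<open>\<phi>\<close> is at most \<open>\<delta>/2\<close> at its supremum, which
  therefore has distance at least \<open>\<delta>/2\<close> from \<open>S r\<close>. Iterating gives a decreasing sequence of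
  positive elements with steps of norm at least \<open>\<delta>/2\<close>, which order continuity forbids.
\<close>
lemma inf_null_if_weakly_null:
  fixes y :: "nat \<Rightarrow> 'a::banach_lattice"
  assumes oc: "order_continuous_norm TYPE('a)"
    and y0: "\<And>n. 0 \<le> y n" and u: "0 \<le> u"
    and weak: "\<And>\<phi> :: 'a \<Rightarrow>\<^sub>L real. 0 \<le> \<phi> \<Longrightarrow> (\<lambda>n. blinfun_apply \<phi> (y n)) \<longlonglongrightarrow> 0"
  shows "(\<lambda>n. norm (inf (y n) u)) \<longlonglongrightarrow> 0"
proof (rule ccontr)
  assume "\<not> ?thesis"
  then obtain \<delta> and r0 :: "nat \<Rightarrow> nat" where \<delta>: "\<delta> > 0" and r0: "strict_mono r0"
    and big: "\<And>n. \<delta> \<le> norm (inf (y (r0 n)) u)"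
    by (rule not_null_subseq) auto
  define z where "z n = inf (y (r0 n)) u" for n
  have z0: "0 \<le> z n" and zu: "z n \<le> u" for n
    using y0 u by (auto simp: z_def)
  have z_weak: "(\<lambda>n. blinfun_apply \<phi> (z n)) \<longlonglongrightarrow> 0" if \<phi>: "0 \<le> \<phi>" for \<phi> :: "'a \<Rightarrow>\<^sub>L real"
  proof (rule tendsto_sandwich[OF _ _ tendsto_const])
    show "(\<lambda>n. \<phi> (y (r0 n))) \<longlonglongrightarrow> 0"
      using LIMSEQ_subseq_LIMSEQ[OF weak[OF \<phi>] r0] by (simp add: o_def)
    show "\<forall>\<^sub>F n in sequentially. 0 \<le> \<phi> (z n)"
      using \<phi> z0 by (simp add: blinfun_nonneg_iff)
    show "\<forall>\<^sub>F n in sequentially. \<phi> (z n) \<le> \<phi> (y (r0 n))"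
      by (simp add: z_def pos_mono[OF \<phi>])
  qed
  have "\<exists>s. (\<forall>n. z (r n) \<le> s) \<and> (\<forall>b. (\<forall>n. z (r n) \<le> b) \<longrightarrow> s \<le> b) \<and>
      (\<lambda>n. \<Squnion>\<^sub>f\<^sub>i\<^sub>n ((\<lambda>i. z (r i)) ` {..n})) \<longlonglongrightarrow> s" for r :: "nat \<Rightarrow> nat"
    by (rule oc_sequence_lub[OF oc, of "\<lambda>i. z (r i)" u, OF zu]) blast
  then obtain S where S_upper: "\<And>r n. z (r n) \<le> S r"
    and S_least: "\<And>r b. (\<And>n. z (r n) \<le> b) \<Longrightarrow> S r \<le> b"
    and S_lim: "\<And>r :: nat \<Rightarrow> nat. (\<lambda>n. \<Squnion>\<^sub>f\<^sub>i\<^sub>n ((\<lambda>i. z (r i)) ` {..n})) \<longlonglongrightarrow> S r"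
    by metis
  have "\<exists>R. \<forall>n. strict_mono (R n) \<and> (S (R (Suc n)) \<le> S (R n) \<and> \<delta> / 2 \<le> norm (S (R n) - S (R (Suc n))))"
  proof (rule dependent_nat_choice)
    show "\<exists>r :: nat \<Rightarrow> nat. strict_mono r"
      using strict_mono_id by blast
    fix r :: "nat \<Rightarrow> nat" and n :: nat assume r: "strict_mono r"
    have Sr0: "0 \<le> S r" using z0 S_upper order_trans by blast
    obtain \<phi> :: "'a \<Rightarrow>\<^sub>L real" where \<phi>: "0 \<le> \<phi>" "norm \<phi> \<le> 1" "\<phi> (S r) = norm (S r)"
      using positive_norming_functional[of "S r"] Sr0 by auto
    have zr: "(\<lambda>n. \<phi> (z (r n))) \<longlonglongrightarrow> 0"
      using LIMSEQ_subseq_LIMSEQ[OF z_weak[OF \<phi>(1)] r] by (simp add: o_def)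
    have "\<forall>\<^sub>F n in sequentially. \<phi> (z (r n)) < \<delta> / 4 * (1/2) ^ i" for i :: nat
      using zr \<delta> by (intro order_tendstoD) auto
    then obtain q where q: "strict_mono q" "\<And>i. \<phi> (z (r (q i))) < \<delta> / 4 * (1/2) ^ i"
      by (rule eventually_all_subseq[where P = "\<lambda>i n. \<phi> (z (r n)) < \<delta> / 4 * (1/2) ^ i"]) blast
    have "(\<Sum>i\<le>n. \<phi> (z (r (q i)))) \<le> \<delta> / 2" for n
    proof -
      have "(\<Sum>i\<le>n. \<phi> (z (r (q i)))) \<le> (\<Sum>i\<le>n. \<delta> / 4 * (1/2) ^ i)"
        using q(2) by (intro sum_mono less_imp_le)
      also have "\<dots> = \<delta> / 4 * (\<Sum>i\<le>n. (1/2) ^ i)"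
        by (simp add: sum_distrib_left)
      also have "(\<Sum>i\<le>n. (1/2 :: real) ^ i) = 2 - (1/2) ^ n"
        by (induction n) (simp_all add: field_simps)
      also have "\<delta> / 4 * (2 - (1/2) ^ n) \<le> \<delta> / 4 * 2"
        using \<delta> by (intro mult_left_mono) auto
      finally show ?thesis by simp
    qed
    then have small: "\<phi> (S (r \<circ> q)) \<le> \<delta> / 2"
      by (intro pos_functional_lub_le[OF \<phi>(1) _ S_lim[of "r \<circ> q"]]) (simp_all only: o_apply z0)
    have "\<delta> \<le> norm (S r)"
      using big[of "r 0"] norm_mono_nonneg[OF z0 S_upper[of r 0]] by (simp add: z_def)
    then have "\<delta> / 2 \<le> \<phi> (S r - S (r \<circ> q))"
      using small \<phi>(3) by (simp add: blinfun.diff_right)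
    also have "\<dots> \<le> norm \<phi> * norm (S r - S (r \<circ> q))"
      using norm_blinfun[of \<phi> "S r - S (r \<circ> q)"] by simp
    also have "\<dots> \<le> norm (S r - S (r \<circ> q))"
      using \<phi>(2) by (intro mult_left_le_one_le) auto
    finally show "\<exists>r'. strict_mono r' \<and> (S r' \<le> S r \<and> \<delta> / 2 \<le> norm (S r - S r'))"
      using r q(1) S_upper by (intro exI[of _ "r \<circ> q"]) (auto intro!: S_least strict_mono_o)
  qed
  then obtain R where dec: "\<And>n. S (R (Suc n)) \<le> S (R n)"
    and far: "\<And>n. \<delta> / 2 \<le> norm (S (R n) - S (R (Suc n)))"
    by blast
  have "0 \<le> S r" for r using z0 S_upper order_trans by blast
  then have "convergent (\<lambda>n. S (R n))"
    using dec by (intro oc_decseq_convergent[OF oc] decseq_SucI) auto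
  then obtain l where l: "(\<lambda>n. S (R n)) \<longlonglongrightarrow> l"
    by (auto simp: convergent_def)
  have "(\<lambda>n. norm (S (R n) - S (R (Suc n)))) \<longlonglongrightarrow> norm (l - l)"
    by (intro tendsto_norm tendsto_diff l LIMSEQ_Suc)
  then have "\<delta> / 2 \<le> norm (l - l)"
    by (rule LIMSEQ_le_const) (use far in blast)
  with \<delta> show False by simp
qed

section \<open>Weak compactness\<close>

lemma topspace_weak_topology [simp]: "topspace weak_topology = UNIV"
  by (simp add: weak_topology_def topspace_pullback_topology)

lemma continuous_map_weak_topology_eval:
  "continuous_map weak_topology euclidean (\<lambda>x (\<phi> :: 'a::real_normed_vector \<Rightarrow>\<^sub>L real). \<phi> x)"
  using continuous_map_pullback[of euclidean euclidean id UNIV "\<lambda>x (\<phi> :: 'a \<Rightarrow>\<^sub>L real). \<phi> x"]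
  by (simp add: weak_topology_def)

lemma Hausdorff_weak_topology: "Hausdorff_space (weak_topology :: 'a::banach_lattice topology)"
proof (rule Hausdorff_space_injective_preimage[OF _ continuous_map_weak_topology_eval])
  have "Hausdorff_space (product_topology (\<lambda>_ :: 'a \<Rightarrow>\<^sub>L real. euclidean :: real topology) UNIV)"
    by (simp add: Hausdorff_space_product_topology)
  then show "Hausdorff_space (euclidean :: (('a \<Rightarrow>\<^sub>L real) \<Rightarrow> real) topology)"
    by (simp only: euclidean_product_topology)
  show "inj_on (\<lambda>x (\<phi> :: 'a \<Rightarrow>\<^sub>L real). \<phi> x) (topspace weak_topology)"
  proof (rule inj_onI)
    fix x y :: 'a assume "(\<lambda>\<phi> :: 'a \<Rightarrow>\<^sub>L real. \<phi> x) = (\<lambda>\<phi>. \<phi> y)"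
    then have eq: "\<phi> x = \<phi> y" for \<phi> :: "'a \<Rightarrow>\<^sub>L real"
      by metis
    have le: "v \<le> 0" if "\<And>\<phi> :: 'a \<Rightarrow>\<^sub>L real. \<phi> v = 0" for v :: 'a
    proof -
      obtain \<phi> :: "'a \<Rightarrow>\<^sub>L real" where "\<phi> v = norm (pprt v)"
        by (rule positive_norming_functional)
      with that show ?thesis
        by (simp add: le_zero_iff_zero_pprt)
    qed
    have "x - y \<le> 0" "y - x \<le> 0"
      by (rule le, simp add: blinfun.diff_right eq)+
    then show "x = y" by simp
  qed
qed

text \<open>
  A sequence together with its limit is compact, and closed because the weak topology is
  Hausdorff, so it contains the weak closure of the sequence.
\<close>
lemma relatively_weakly_compact_if_weakly_null:
  fixes w :: "nat \<Rightarrow> 'a::banach_lattice"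
  assumes "\<And>\<phi> :: 'a \<Rightarrow>\<^sub>L real. (\<lambda>n. blinfun_apply \<phi> (w n)) \<longlonglongrightarrow> 0"
  shows "relatively_weakly_compact (range w)"
proof -
  let ?ev = "\<lambda>x (\<phi> :: 'a \<Rightarrow>\<^sub>L real). \<phi> x"
  have "limitin (product_topology (\<lambda>_. euclidean) UNIV) (\<lambda>n. ?ev (w n)) (?ev 0) sequentially"
    unfolding limitin_componentwise using assms by (simp add: blinfun.zero_right)
  then have lim: "(\<lambda>n. ?ev (w n)) \<longlonglongrightarrow> ?ev 0"
    by (simp only: euclidean_product_topology limitin_canonical_iff)
  have "limitin weak_topology w 0 sequentially"
    unfolding limitin_def weak_topology_def
  proof (intro conjI allI impI, simp add: topspace_pullback_topology, elim conjE)
    fix U assume "openin (pullback_topology UNIV ?ev euclidean) U" "0 \<in> U"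
    then obtain V where V: "open V" "U = ?ev -` V"
      by (auto simp: openin_pullback_topology)
    then have "\<forall>\<^sub>F n in sequentially. ?ev (w n) \<in> V"
      using \<open>0 \<in> U\<close> by (intro topological_tendstoD[OF lim]) auto
    then show "\<forall>\<^sub>F n in sequentially. w n \<in> U"
      by (simp add: V)
  qed
  then have K: "compactin weak_topology (insert 0 (range w))"
    by (rule compactin_sequence_with_limit) auto
  then have "closedin weak_topology (insert 0 (range w))"
    by (rule compactin_imp_closedin[OF Hausdorff_weak_topology])
  then have "weak_topology closure_of range w \<subseteq> insert 0 (range w)"
    by (intro closure_of_minimal) auto
  then show ?thesis
    unfolding relatively_weakly_compact_def
    by (rule closed_compactin[OF K]) simp
qed

text \<open>
  Countably many functionals map the weakly compact closure of \<open>A\<close> onto a compact subset of the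
  metrizable space \<open>\<real>\<^sup>\<nat>\<close>, where sequences have convergent subsequences. This is
  the part of the Eberlein--Smulian theorem on which the Schur argument rests.
\<close>
lemma relatively_weakly_compact_subseq:
  fixes f :: "nat \<Rightarrow> 'a::real_normed_vector \<Rightarrow>\<^sub>L real"
  assumes A: "relatively_weakly_compact A" and b: "\<And>n. b n \<in> A"
  obtains a and r :: "nat \<Rightarrow> nat" where "strict_mono r" "\<And>i. (\<lambda>k. f i (b (r k))) \<longlonglongrightarrow> f i a"
proof -
  let ?K = "weak_topology closure_of A" and ?\<Phi> = "\<lambda>x i. blinfun_apply (f i) x"
  have "continuous_map euclidean euclidean (\<lambda>(F :: ('a \<Rightarrow>\<^sub>L real) \<Rightarrow> real) i. F (f i))"
    by (simp add: continuous_on_coordinatewise_then_product)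
  from continuous_map_compose[OF continuous_map_weak_topology_eval this]
  have "continuous_map weak_topology euclidean ?\<Phi>"
    by (simp add: o_def)
  then have "compact (?\<Phi> ` ?K)"
    using A image_compactin unfolding relatively_weakly_compact_def by fastforce
  then have "seq_compact (?\<Phi> ` ?K)"
    by (rule compact_imp_seq_compact)
  moreover have "\<forall>n. ?\<Phi> (b n) \<in> ?\<Phi> ` ?K"
    using b closure_of_subset[of A weak_topology] by auto
  ultimately obtain l and r :: "nat \<Rightarrow> nat" where l: "l \<in> ?\<Phi> ` ?K" and r: "strict_mono r"
    and lim: "((\<lambda>n. ?\<Phi> (b n)) \<circ> r) \<longlonglongrightarrow> l"
    by (rule seq_compactE)
  from l obtain a where a: "l = ?\<Phi> a" by blast
  have "(\<lambda>k. f i (b (r k))) \<longlonglongrightarrow> f i a" for i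
  proof -
    have "isCont (\<lambda>F :: nat \<Rightarrow> real. F i) l"
      using continuous_on_product_coordinates by (metis UNIV_I continuous_on_eq_continuous_at open_UNIV)
    from isCont_tendsto_compose[OF this lim] show ?thesis
      by (simp add: o_def a)
  qed
  with r that show ?thesis by blast
qed

section \<open>Disjoint sequences and dimension\<close>

text \<open>
  If \<open>a = \<Sum> r\<^sub>s s\<close>, then \<open>a \<le> \<Sum> \<bar>r\<^sub>s\<bar> s\<close>, and the right-hand side is disjoint from \<open>a\<close>.
\<close>
lemma disjoint_family_independent:
  fixes S :: "'a::banach_lattice set"
  assumes pos: "\<And>s. s \<in> S \<Longrightarrow> 0 \<le> s \<and> s \<noteq> 0"
    and disj: "\<And>s t. s \<in> S \<Longrightarrow> t \<in> S \<Longrightarrow> s \<noteq> t \<Longrightarrow> inf s t = 0"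
  shows "independent S"
  unfolding dependent_def
proof
  assume "\<exists>a\<in>S. a \<in> span (S - {a})"
  then obtain a t r where a: "a \<in> S" and t: "finite t" "t \<subseteq> S - {a}" and eq: "a = (\<Sum>s\<in>t. r s *\<^sub>R s)"
    by (auto simp: span_explicit)
  let ?b = "\<Sum>s\<in>t. \<bar>r s\<bar> *\<^sub>R s"
  have "a \<le> ?b"
    by (subst eq, rule sum_mono, rule scaleR_right_mono) (use t pos in auto)
  moreover have "inf ?b a = 0"
  proof (rule inf_sum_zero)
    fix s assume s: "s \<in> t"
    then have "inf (\<bar>r s\<bar> *\<^sub>R s) (1 *\<^sub>R a) = 0"
      using t a by (intro inf_scaleR_zero disj) auto
    then show "inf (\<bar>r s\<bar> *\<^sub>R s) a = 0" by simp
  qed (use t pos a in \<open>auto intro!: scaleR_nonneg_nonneg\<close>)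
  ultimately have "a = 0"
    by (simp add: inf_absorb2)
  with pos a show False by blast
qed

lemma finite_dimensional_disjoint_null:
  fixes y :: "nat \<Rightarrow> 'a::banach_lattice"
  assumes fd: "finite_dimensional TYPE('a)" and disj: "disjoint_seq y" and y0: "\<And>n. 0 \<le> y n"
  shows "(\<lambda>n. norm (y n)) \<longlonglongrightarrow> 0"
proof -
  let ?N = "{n. y n \<noteq> 0}"
  have dis: "inf (y m) (y n) = 0" if "m \<noteq> n" for m n
    using disj that unfolding disjoint_seq_nonneg[of y, OF y0] by blast
  have inj: "inj_on y ?N"
    by (rule inj_onI) (metis (mono_tags) dis inf.idem mem_Collect_eq)
  have "independent (y ` ?N)"
  proof (rule disjoint_family_independent)
    fix s t assume "s \<in> y ` ?N" "t \<in> y ` ?N" "s \<noteq> t"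
    then obtain m n where "s = y m" "t = y n" "m \<noteq> n" by blast
    then show "inf s t = 0" using dis by simp
  qed (use y0 in auto)
  moreover obtain B :: "'a set" where "finite_dimensional_vector_space scaleR B"
    using fd by (auto simp: finite_dimensional_def)
  ultimately have "finite (y ` ?N)"
    using finite_dimensional_vector_space.finiteI_independent unfolding dependent_raw_def by blast
  then have "finite ?N"
    using inj by (simp add: finite_image_iff)
  then have "\<forall>\<^sub>F n in sequentially. n \<notin> ?N"
    using eventually_cofinite[of "\<lambda>n. n \<notin> ?N"] by (simp add: cofinite_eq_sequentially)
  then have "\<forall>\<^sub>F n in sequentially. norm (y n) = 0"
    by simp
  then show ?thesis by (rule tendsto_eventually)
qed

text \<open>
  In a Banach lattice this disjointness condition says that the ideal generated by \<open>a\<close> is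
  one-dimensional, which is the usual definition of an atom.
\<close>
definition lattice_atom :: "'a::banach_lattice \<Rightarrow> bool"
  where "lattice_atom a \<longleftrightarrow> 0 \<le> a \<and> a \<noteq> 0 \<and>
    (\<forall>p q. 0 \<le> p \<longrightarrow> p \<le> a \<longrightarrow> 0 \<le> q \<longrightarrow> q \<le> a \<longrightarrow> inf p q = 0 \<longrightarrow> p = 0 \<or> q = 0)"

text \<open>
  Otherwise \<open>x\<close> splits into two disjoint nonzero pieces \<open>p, q \<le> x\<close>, then \<open>q\<close> splits in the same way,
  and so on; the pieces \<open>p\<close> set aside form an infinite disjoint sequence.
\<close>
lemma lattice_atom_below:
  fixes x :: "'a::banach_lattice"
  assumes no_seq: "\<And>y :: nat \<Rightarrow> 'a. disjoint_seq y \<Longrightarrow> (\<And>n. 0 \<le> y n) \<Longrightarrow> \<exists>n. y n = 0"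
    and x: "0 \<le> x" "x \<noteq> 0"
  shows "\<exists>a\<le>x. lattice_atom a"
proof (rule ccontr)
  assume neg: "\<not> ?thesis"
  have split: "\<exists>p q. 0 \<le> p \<and> p \<noteq> 0 \<and> p \<le> z \<and> 0 \<le> q \<and> q \<noteq> 0 \<and> q \<le> z \<and> inf p q = 0"
    if "0 \<le> z" "z \<noteq> 0" "z \<le> x" for z
    using neg that unfolding lattice_atom_def by blast
  have "\<exists>f. \<forall>n. (case f n of (p, q) \<Rightarrow> 0 \<le> p \<and> p \<noteq> 0 \<and> 0 \<le> q \<and> q \<noteq> 0 \<and> q \<le> x \<and> inf p q = 0) \<and>
      fst (f (Suc n)) \<le> snd (f n) \<and> snd (f (Suc n)) \<le> snd (f n)"
  proof (rule dependent_nat_choice)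
    show "\<exists>f. case f of (p, q) \<Rightarrow> 0 \<le> p \<and> p \<noteq> 0 \<and> 0 \<le> q \<and> q \<noteq> 0 \<and> q \<le> x \<and> inf p q = 0"
      using split[OF x] by auto
    fix f :: "'a \<times> 'a" and n :: nat
    assume f: "case f of (p, q) \<Rightarrow> 0 \<le> p \<and> p \<noteq> 0 \<and> 0 \<le> q \<and> q \<noteq> 0 \<and> q \<le> x \<and> inf p q = 0"
    obtain p q where "0 \<le> p" "p \<noteq> 0" "p \<le> snd f" "0 \<le> q" "q \<noteq> 0" "q \<le> snd f" "inf p q = 0"
      using split[of "snd f"] f by (auto simp: case_prod_beta)
    then show "\<exists>g. (case g of (p, q) \<Rightarrow> 0 \<le> p \<and> p \<noteq> 0 \<and> 0 \<le> q \<and> q \<noteq> 0 \<and> q \<le> x \<and> inf p q = 0) \<and>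
        fst g \<le> snd f \<and> snd g \<le> snd f"
      using f by (intro exI[of _ "(p, q)"]) (auto simp: case_prod_beta)
  qed
  then obtain f where F: "\<forall>n. (0 \<le> fst (f n) \<and> fst (f n) \<noteq> 0 \<and> 0 \<le> snd (f n) \<and> snd (f n) \<noteq> 0 \<and>
      snd (f n) \<le> x \<and> inf (fst (f n)) (snd (f n)) = 0) \<and>
      fst (f (Suc n)) \<le> snd (f n) \<and> snd (f (Suc n)) \<le> snd (f n)"
    unfolding case_prod_beta by (elim exE)
  have f: "0 \<le> fst (f n)" "fst (f n) \<noteq> 0" "0 \<le> snd (f n)" "inf (fst (f n)) (snd (f n)) = 0"
    and step: "fst (f (Suc n)) \<le> snd (f n)" "snd (f (Suc n)) \<le> snd (f n)" for n
    using spec[OF F, of n] by blast+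
  have dec: "decseq (\<lambda>n. snd (f n))"
    using step(2) by (rule decseq_SucI)
  have less: "inf (fst (f m)) (fst (f n)) = 0" if mn: "m < n" for m n
  proof (rule inf_zero_mono[OF f(4)[of m] f(1) order_refl f(1)])
    obtain k where n: "n = Suc k" "m \<le> k"
      using mn by (cases n) auto
    show "fst (f n) \<le> snd (f m)"
      unfolding n using step(1)[of k] decseqD[OF dec n(2)] by (rule order_trans)
  qed
  have "disjoint_seq (\<lambda>n. fst (f n))"
    unfolding disjoint_seq_nonneg[of "\<lambda>n. fst (f n)", OF f(1)]
    using less by (metis inf_commute linorder_neqE_nat)
  then show False
    using no_seq[of "\<lambda>n. fst (f n)"] f by blast
qed

text \<open>
  Take the largest multiple of \<open>a\<close> below \<open>x\<close>. Let \<open>y\<close> be what the remainder has in common with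
  \<open>a\<close>. The positive and negative parts of \<open>y - s a\<close> are disjoint and lie below the atom \<open>a\<close>, so one of
  them vanishes. It cannot be that \<open>s a \<le> y\<close> for some \<open>s > 0\<close>, by maximality, so \<open>y \<le> s a\<close> for all
  small \<open>s\<close>, that is \<open>y = 0\<close>.
\<close>
lemma lattice_atom_split:
  fixes a x :: "'a::banach_lattice"
  assumes a: "lattice_atom a" and x: "0 \<le> x"
  shows "\<exists>t\<ge>0. t *\<^sub>R a \<le> x \<and> inf (x - t *\<^sub>R a) a = 0"
proof -
  have a0: "0 \<le> a" "a \<noteq> 0"
    using a by (auto simp: lattice_atom_def)
  define C where "C = {t. 0 \<le> t \<and> t *\<^sub>R a \<le> x}"
  have "0 \<in> C" using x by (simp add: C_def)
  have bd: "t \<le> norm x / norm a" if "t \<in> C" for t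
    using that a0 norm_mono_nonneg[of "t *\<^sub>R a" x]
    by (simp add: C_def scaleR_nonneg_nonneg field_simps)
  then have bdd: "bdd_above C" by (rule bdd_aboveI)
  define t where "t = Sup C"
  have t0: "0 \<le> t"
    unfolding t_def using \<open>0 \<in> C\<close> bdd by (rule cSup_upper)
  have "closure C \<subseteq> C"
  proof
    fix s assume "s \<in> closure C"
    then obtain c where c: "\<And>n. c n \<in> C" "c \<longlonglongrightarrow> s"
      by (auto simp: closure_sequential)
    have "0 \<le> s"
      by (rule LIMSEQ_le_const[OF c(2)]) (use c(1) in \<open>auto simp: C_def\<close>)
    moreover have "s *\<^sub>R a \<le> x"
      by (rule tendsto_le_lattice[OF tendsto_scaleR[OF c(2) tendsto_const] tendsto_const])
        (use c(1) in \<open>auto simp: C_def\<close>)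
    ultimately show "s \<in> C" by (simp add: C_def)
  qed
  moreover have "t \<in> closure C"
    unfolding t_def using \<open>0 \<in> C\<close> bdd by (intro closure_contains_Sup) auto
  ultimately have tC: "t *\<^sub>R a \<le> x" by (auto simp: C_def)
  define y where "y = inf (x - t *\<^sub>R a) a"
  have y0: "0 \<le> y" using tC a0 by (simp add: y_def)
  have y_le: "y \<le> a" "y \<le> x - t *\<^sub>R a" by (simp_all add: y_def)
  have small: "y \<le> s *\<^sub>R a" if s: "0 < s" "s \<le> 1" for s
  proof -
    have sa: "s *\<^sub>R a \<le> a" "0 \<le> s *\<^sub>R a"
      using s a0 scaleR_right_mono[of s 1 a] by (simp_all add: scaleR_nonneg_nonneg)
    have "y - s *\<^sub>R a \<le> a" "- (y - s *\<^sub>R a) \<le> a"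
      unfolding minus_diff_eq diff_le_eq using sa y_le y0 by (simp_all add: add_increasing2)
    then have "pprt (y - s *\<^sub>R a) \<le> a" "pprt (- (y - s *\<^sub>R a)) \<le> a"
      unfolding pprt_def using a0 by (blast intro: le_supI)+
    then have "pprt (y - s *\<^sub>R a) = 0 \<or> pprt (- (y - s *\<^sub>R a)) = 0"
      using a pprt_disjoint[of "y - s *\<^sub>R a"] unfolding lattice_atom_def by (meson zero_le_pprt)
    then show ?thesis
    proof
      assume "pprt (y - s *\<^sub>R a) = 0"
      then show ?thesis by (simp only: le_zero_iff_zero_pprt[symmetric] diff_le_0_iff_le)
    next
      assume "pprt (- (y - s *\<^sub>R a)) = 0"
      then have "s *\<^sub>R a \<le> y"
        by (simp only: le_zero_iff_zero_pprt[symmetric] neg_le_0_iff_le diff_ge_0_iff_ge)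
      also note y_le(2)
      finally have "(t + s) *\<^sub>R a \<le> x"
        by (simp add: scaleR_add_left le_diff_eq add.commute)
      then have "t + s \<in> C" using t0 s by (simp add: C_def)
      then have "t + s \<le> t" unfolding t_def using bdd by (rule cSup_upper)
      with s show ?thesis by simp
    qed
  qed
  have "(\<lambda>k. inverse (real (Suc k)) *\<^sub>R a) \<longlonglongrightarrow> 0 *\<^sub>R a"
    by (intro tendsto_scaleR LIMSEQ_inverse_real_of_nat tendsto_const)
  moreover have "y \<le> inverse (real (Suc k)) *\<^sub>R a" for k
    by (rule small) (simp_all add: inverse_le_1_iff)
  ultimately have "y \<le> 0 *\<^sub>R a"
    by (intro tendsto_le_lattice[OF tendsto_const]) auto
  with y0 have "y = 0" by (simp add: antisym)
  with t0 tC show ?thesis unfolding y_def by blast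
qed

text \<open>
  If there is no infinite disjoint sequence, then some finite disjoint family \<open>S\<close> of atoms is
  maximal. Splitting the multiples of all members of \<open>S\<close> off a positive \<open>x\<close> leaves an element disjoint
  from \<open>S\<close>; it dominates no atom and is therefore \<open>0\<close>. Hence \<open>S\<close> spans the space.
\<close>
lemma infinite_dimensional_disjoint_seq:
  assumes infd: "\<not> finite_dimensional TYPE('a::banach_lattice)"
  obtains y :: "nat \<Rightarrow> 'a::banach_lattice" where "disjoint_seq y" "\<And>n. 0 \<le> y n" "\<And>n. norm (y n) = 1"
proof (cases "\<exists>y :: nat \<Rightarrow> 'a. disjoint_seq y \<and> (\<forall>n. 0 \<le> y n \<and> y n \<noteq> 0)")
  case True
  then obtain y :: "nat \<Rightarrow> 'a" where y: "disjoint_seq y" "\<And>n. 0 \<le> y n" "\<And>n. y n \<noteq> 0"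
    by blast
  define z where "z n = inverse (norm (y n)) *\<^sub>R y n" for n
  have z0: "0 \<le> z n" for n
    using y by (simp add: z_def scaleR_nonneg_nonneg)
  have "disjoint_seq z"
    unfolding disjoint_seq_nonneg[of z, OF z0]
  proof (intro allI impI)
    fix m n :: nat assume "m \<noteq> n"
    then have "inf (y m) (y n) = 0"
      using y(1) unfolding disjoint_seq_nonneg[of y, OF y(2)] by blast
    then show "inf (z m) (z n) = 0"
      unfolding z_def by (rule inf_scaleR_zero) simp_all
  qed
  moreover have "norm (z n) = 1" for n
    using y by (simp add: z_def)
  ultimately show ?thesis using that z0 by blast
next
  case False
  have no_seq: "\<exists>n. y n = 0" if "disjoint_seq y" "\<And>n. 0 \<le> y n" for y :: "nat \<Rightarrow> 'a"
  proof (rule ccontr)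
    assume "\<not> (\<exists>n. y n = 0)"
    then have "disjoint_seq y \<and> (\<forall>n. 0 \<le> y n \<and> y n \<noteq> 0)"
      by (simp add: that)
    then have "\<exists>y :: nat \<Rightarrow> 'a. disjoint_seq y \<and> (\<forall>n. 0 \<le> y n \<and> y n \<noteq> 0)"
      by (rule exI[of _ y])
    with False show False by (rule notE)
  qed
  let ?P = "\<lambda>S :: 'a set. finite S \<and> (\<forall>s\<in>S. lattice_atom s) \<and> (\<forall>s\<in>S. \<forall>t\<in>S. s \<noteq> t \<longrightarrow> inf s t = 0)"
  let ?Q = "\<lambda>S :: 'a set. \<exists>a. lattice_atom a \<and> (\<forall>s\<in>S. inf s a = 0)"
  have "\<exists>S. ?P S \<and> \<not> ?Q S"
  proof (rule ccontr)
    assume neg: "\<not> (\<exists>S. ?P S \<and> \<not> ?Q S)"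
    have extend: "?Q S" if "?P S" for S
    proof (rule ccontr)
      assume "\<not> ?Q S"
      with that have "?P S \<and> \<not> ?Q S" by (rule conjI)
      then have "\<exists>S. ?P S \<and> \<not> ?Q S" by (rule exI[where x = S])
      with neg show False by (rule notE)
    qed
    have "\<exists>S. \<forall>n::nat. ?P (S n) \<and> (\<exists>a. lattice_atom a \<and> (\<forall>s\<in>S n. inf s a = 0) \<and> S (Suc n) = insert a (S n))"
    proof (rule dependent_nat_choice)
      show "\<exists>S. ?P S" by (rule exI[of _ "{}"]) simp
      fix S :: "'a set" and n :: nat assume S: "?P S"
      from extend[OF S] obtain a where a: "lattice_atom a" "\<forall>s\<in>S. inf s a = 0"
        by (elim exE conjE)
      then have "\<forall>s\<in>S. inf a s = 0" by (simp add: inf_commute)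
      with S a show "\<exists>S'. ?P S' \<and> (\<exists>a. lattice_atom a \<and> (\<forall>s\<in>S. inf s a = 0) \<and> S' = insert a S)"
        by (intro exI[of _ "insert a S"]) auto
    qed
    then obtain S where "\<forall>n::nat. ?P (S n) \<and>
        (\<exists>a. lattice_atom a \<and> (\<forall>s\<in>S n. inf s a = 0) \<and> S (Suc n) = insert a (S n))"
      by (elim exE)
    then have "\<forall>n. \<exists>a. lattice_atom a \<and> (\<forall>s\<in>S n. inf s a = 0) \<and> S (Suc n) = insert a (S n)"
      by simp
    then obtain a where aS: "\<forall>n. lattice_atom (a n) \<and> (\<forall>s\<in>S n. inf s (a n) = 0) \<and> S (Suc n) = insert (a n) (S n)"
      unfolding choice_iff by (elim exE)
    have a: "lattice_atom (a n)" "s \<in> S n \<Longrightarrow> inf s (a n) = 0" and S: "S (Suc n) = insert (a n) (S n)"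
      for n s using spec[OF aS, of n] by simp_all
    have in_S: "a m \<in> S n" if "m < n" for m n
      using that by (induction n) (auto simp: S less_Suc_eq)
    have a0: "0 \<le> a n" "a n \<noteq> 0" for n
      using a(1)[of n] by (simp_all add: lattice_atom_def)
    have "disjoint_seq a"
      unfolding disjoint_seq_nonneg[of a, OF a0(1)]
      using a(2) in_S by (metis inf_commute linorder_neqE_nat)
    with no_seq a0 show False by blast
  qed
  then obtain S where max_S: "?P S \<and> \<not> ?Q S"
    by (elim exE)
  then have S: "finite S" "s \<in> S \<Longrightarrow> lattice_atom s" "s \<in> S \<Longrightarrow> t \<in> S \<Longrightarrow> s \<noteq> t \<Longrightarrow> inf s t = 0"
    for s t by simp_all
  have maximal: "\<exists>s\<in>S. inf s a \<noteq> 0" if "lattice_atom a" for a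
    using conjunct2[OF max_S] that by blast
  have S0: "0 \<le> s" if "s \<in> S" for s
    using S(2)[OF that] by (simp add: lattice_atom_def)
  have cone: "x \<in> span S" if x: "0 \<le> x" for x
  proof -
    have "\<forall>s\<in>S. \<exists>t\<ge>0. t *\<^sub>R s \<le> x \<and> inf (x - t *\<^sub>R s) s = 0"
      using lattice_atom_split[OF S(2) x] by blast
    then obtain t where t: "\<And>s. s \<in> S \<Longrightarrow> 0 \<le> t s \<and> t s *\<^sub>R s \<le> x \<and> inf (x - t s *\<^sub>R s) s = 0"
      by metis
    let ?b = "\<lambda>s. t s *\<^sub>R s"
    have b0: "0 \<le> ?b s" if "s \<in> S" for s
      using t S0 that by (simp add: scaleR_nonneg_nonneg)
    have le: "sum ?b S \<le> x"
      by (rule disjoint_sum_le) (use S t x b0 in \<open>auto intro!: inf_scaleR_zero\<close>)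
    have "x - sum ?b S = 0"
    proof (rule ccontr)
      assume "x - sum ?b S \<noteq> 0"
      then obtain a where a: "a \<le> x - sum ?b S" "lattice_atom a"
        using lattice_atom_below[OF no_seq, of "x - sum ?b S"] le by auto
      have "inf s a = 0" if s: "s \<in> S" for s
      proof (rule inf_zero_mono)
        show "inf s (x - ?b s) = 0"
          using t[OF s] by (simp add: inf_commute)
        have "?b s \<le> sum ?b S"
          using S(1) s b0 by (rule member_le_sum_lattice)
        then show "a \<le> x - ?b s"
          using a(1) by (meson diff_left_mono order_trans)
      qed (use S0 s a in \<open>auto simp: lattice_atom_def\<close>)
      with maximal[OF a(2)] show False by blast
    qed
    then have "x = sum ?b S" by simp
    also have "\<dots> \<in> span S"
      by (intro span_sum span_scale span_base)
    finally show ?thesis .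
  qed
  have span_S: "x \<in> span S" for x
  proof -
    have "x = pprt x - pprt (- x)" by (simp add: pprt_neg flip: prts)
    also have "\<dots> \<in> span S" by (intro span_diff cone zero_le_pprt)
    finally show ?thesis .
  qed
  obtain B where B: "B \<subseteq> S" "independent B" "S \<subseteq> span B"
    by (rule maximal_independent_subset)
  have "span B = UNIV"
    using span_minimal[OF B(3) subspace_span] span_S by auto
  moreover have "finite B" using B(1) S(1) by (rule finite_subset)
  ultimately have "finite_dimensional_vector_space scaleR B"
    using B(2) unfolding dependent_raw_def span_raw_def
    by unfold_locales
  then have "finite_dimensional TYPE('a)"
    unfolding finite_dimensional_def by blast
  with infd show ?thesis by blast
qed

section \<open>Absolutely summable families of functionals\<close>

text \<open>
  The rows \<open>h k\<close> lie in \<open>\<ell>\<^sup>1\<close> and tend to \<open>0\<close> coordinatewise, so one can choose rows whose masses are,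
  up to \<open>\<epsilon>/4\<close>, concentrated on successive disjoint blocks. Taking \<open>\<xi>\<close> on each block to be the sign
  of its row yields the pairing at least \<open>\<epsilon> - 4 \<epsilon>/8\<close>, as head and tail count twice.
\<close>
lemma schur_gliding_hump:
  fixes h :: "nat \<Rightarrow> nat \<Rightarrow> real"
  assumes \<epsilon>: "\<epsilon> > 0" and summ: "\<And>k. summable (\<lambda>n. \<bar>h k n\<bar>)"
    and coord: "\<And>n. (\<lambda>k. h k n) \<longlonglongrightarrow> 0" and big: "\<And>k. \<epsilon> \<le> (\<Sum>n. \<bar>h k n\<bar>)"
  obtains \<xi> and s :: "nat \<Rightarrow> nat" where "\<And>n. \<bar>\<xi> n\<bar> \<le> (1::real)" "strict_mono s"
    "\<And>j. \<epsilon> / 2 \<le> (\<Sum>n. \<xi> n * h (s j) n)"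
proof -
  \<comment> \<open>\<open>f j\<close> is the pair of a row and the beginning of its block, which ends where the next block
    begins.\<close>
  have "\<exists>f. \<forall>j. (\<Sum>n<snd (f j). \<bar>h (fst (f j)) n\<bar>) \<le> \<epsilon> / 8 \<and>
    (fst (f j) < fst (f (Suc j)) \<and> snd (f j) \<le> snd (f (Suc j)) \<and>
      (\<Sum>n. \<bar>h (fst (f j)) (n + snd (f (Suc j)))\<bar>) \<le> \<epsilon> / 8)"
  proof (rule dependent_nat_choice)
    show "\<exists>p. (\<Sum>n<snd p. \<bar>h (fst p) n\<bar>) \<le> \<epsilon> / 8"
      using \<epsilon> by (intro exI[of _ "(0, 0)"]) simp
    fix p :: "nat \<times> nat" and j :: nat
    have "\<forall>\<^sub>F N in sequentially. (\<Sum>n. \<bar>h (fst p) (n + N)\<bar>) < \<epsilon> / 8"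
      using suminf_exist_split2[OF summ] \<epsilon> by (intro order_tendstoD) auto
    then have "\<forall>\<^sub>F N in sequentially. snd p \<le> N \<and> (\<Sum>n. \<bar>h (fst p) (n + N)\<bar>) < \<epsilon> / 8"
      using eventually_ge_at_top[of "snd p"] by eventually_elim auto
    then obtain N where N: "snd p \<le> N" "(\<Sum>n. \<bar>h (fst p) (n + N)\<bar>) < \<epsilon> / 8"
      by (auto simp: eventually_sequentially)
    have "(\<lambda>k. \<Sum>n<N. \<bar>h k n\<bar>) \<longlonglongrightarrow> (\<Sum>n<N. \<bar>0\<bar>)"
      by (intro tendsto_sum tendsto_rabs coord)
    then have "\<forall>\<^sub>F k in sequentially. (\<Sum>n<N. \<bar>h k n\<bar>) < \<epsilon> / 8"
      using \<epsilon> by (intro order_tendstoD) auto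
    then have "\<forall>\<^sub>F k in sequentially. fst p < k \<and> (\<Sum>n<N. \<bar>h k n\<bar>) < \<epsilon> / 8"
      using eventually_gt_at_top[of "fst p"] by eventually_elim auto
    then obtain k where k: "fst p < k" "(\<Sum>n<N. \<bar>h k n\<bar>) < \<epsilon> / 8"
      by (auto simp: eventually_sequentially)
    show "\<exists>p'. (\<Sum>n<snd p'. \<bar>h (fst p') n\<bar>) \<le> \<epsilon> / 8 \<and>
      (fst p < fst p' \<and> snd p \<le> snd p' \<and> (\<Sum>n. \<bar>h (fst p) (n + snd p')\<bar>) \<le> \<epsilon> / 8)"
      using N k by (intro exI[of _ "(k, N)"]) auto
  qed
  then obtain f where f: "\<And>j. (\<Sum>n<snd (f j). \<bar>h (fst (f j)) n\<bar>) \<le> \<epsilon> / 8"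
    "\<And>j. fst (f j) < fst (f (Suc j))" "\<And>j. snd (f j) \<le> snd (f (Suc j))"
    "\<And>j. (\<Sum>n. \<bar>h (fst (f j)) (n + snd (f (Suc j)))\<bar>) \<le> \<epsilon> / 8"
    by blast
  define s where "s j = fst (f j)" for j
  define N where "N j = snd (f j)" for j
  have head: "(\<Sum>n<N j. \<bar>h (s j) n\<bar>) \<le> \<epsilon> / 8"
    and tail: "(\<Sum>n. \<bar>h (s j) (n + N (Suc j))\<bar>) \<le> \<epsilon> / 8" for j
    using f by (simp_all add: s_def N_def)
  have s: "strict_mono s"
    using f(2) by (simp add: strict_mono_Suc_iff s_def)
  have N: "incseq N"
    using f(3) by (intro incseq_SucI) (simp add: N_def)
  define \<xi> where "\<xi> n = sgn (h (s (LEAST j. n < N (Suc j))) n)" for n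
  have \<xi>1: "\<bar>\<xi> n\<bar> \<le> 1" for n
    by (simp add: \<xi>_def sgn_if)
  have \<xi>_block: "\<xi> n * h (s j) n = \<bar>h (s j) n\<bar>" if "N j \<le> n" "n < N (Suc j)" for n j
  proof -
    have "(LEAST j. n < N (Suc j)) = j"
    proof (rule Least_equality)
      fix i assume i: "n < N (Suc i)"
      show "j \<le> i"
      proof (rule ccontr)
        assume "\<not> j \<le> i"
        then have "N (Suc i) \<le> N j" using incseqD[OF N, of "Suc i" j] by simp
        with i that show False by simp
      qed
    qed (use that in simp)
    then show ?thesis by (simp add: \<xi>_def abs_sgn mult.commute)
  qed
  have "\<epsilon> / 2 \<le> (\<Sum>n. \<xi> n * h (s j) n)" for j
  proof -
    let ?g = "\<lambda>n. \<bar>h (s j) n\<bar>" and ?k = "\<lambda>n. \<xi> n * h (s j) n" and ?N = "N (Suc j)"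
    have k_le: "\<bar>?k n\<bar> \<le> ?g n" for n
      using \<xi>1[of n] by (simp add: abs_mult mult_left_le_one_le)
    have g: "summable ?g" by (rule summ)
    have k: "summable ?k"
      by (rule summable_rabs_cancel[OF summable_rabs_comparison_test[OF _ g]]) (use k_le in auto)
    have split: "(\<Sum>n. F n) = (\<Sum>n. F (n + ?N)) + (sum F {..<N j} + sum F {N j..<?N})"
      if "summable F" for F :: "nat \<Rightarrow> real"
    proof -
      have "{..<?N} = {..<N j} \<union> {N j..<?N}"
        using incseqD[OF N, of j "Suc j"] by auto
      then have "sum F {..<?N} = sum F {..<N j} + sum F {N j..<?N}"
        by (simp add: sum.union_disjoint ivl_disj_int)
      then show ?thesis
        using suminf_split_initial_segment[OF that, of ?N] by simp
    qed
    have "sum ?k {N j..<?N} = sum ?g {N j..<?N}"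
      by (intro sum.cong) (auto simp: \<xi>_block)
    moreover have "\<bar>sum ?k {..<N j}\<bar> \<le> sum ?g {..<N j}"
      by (intro order_trans[OF sum_abs] sum_mono k_le)
    moreover have "\<bar>\<Sum>n. ?k (n + ?N)\<bar> \<le> (\<Sum>n. ?g (n + ?N))"
    proof -
      have gN: "summable (\<lambda>n. ?g (n + ?N))"
        using g by (rule summable_ignore_initial_segment)
      have akN: "summable (\<lambda>n. \<bar>?k (n + ?N)\<bar>)"
        by (rule summable_rabs_comparison_test[OF _ gN]) (use k_le in auto)
      have "\<bar>\<Sum>n. ?k (n + ?N)\<bar> \<le> (\<Sum>n. \<bar>?k (n + ?N)\<bar>)"
        by (rule summable_rabs[OF akN])
      also have "\<dots> \<le> (\<Sum>n. ?g (n + ?N))"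
        by (rule suminf_le[OF _ akN gN]) (rule k_le)
      finally show ?thesis .
    qed
    ultimately show ?thesis
      using split[OF g] split[OF k] big[of "s j"] head[of j] tail[of j] by linarith
  qed
  with \<xi>1 s that show ?thesis by blast
qed

lemma summable_of_bounded_sums:
  fixes f :: "nat \<Rightarrow> 'a::real_normed_vector \<Rightarrow>\<^sub>L real"
  assumes "\<And>x N. (\<Sum>n<N. \<bar>f n x\<bar>) \<le> C * norm x"
  shows "summable (\<lambda>n. \<bar>f n x\<bar>)"
  using assms by (intro summableI_nonneg_bounded[where x = "C * norm x"]) auto

lemma series_operator:
  fixes f :: "nat \<Rightarrow> 'a::real_normed_vector \<Rightarrow>\<^sub>L real" and v :: "nat \<Rightarrow> 'b::banach"
  assumes f: "\<And>x N. (\<Sum>n<N. \<bar>f n x\<bar>) \<le> C * norm x" and v: "\<And>n. norm (v n) \<le> 1"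
  obtains T :: "'a \<Rightarrow>\<^sub>L 'b" where "\<And>x. (\<lambda>n. f n x *\<^sub>R v n) sums T x"
    "\<And>x. norm (T x) \<le> (\<Sum>n. \<bar>f n x\<bar>)"
proof -
  have le: "norm (f n x *\<^sub>R v n) \<le> \<bar>f n x\<bar>" for n x
    using v[of n] by (simp add: mult_left_le)
  have abs: "summable (\<lambda>n. \<bar>f n x\<bar>)" for x
    using f by (rule summable_of_bounded_sums)
  have ns: "summable (\<lambda>n. norm (f n x *\<^sub>R v n))" for x
    by (rule summable_comparison_test'[OF abs[of x], of 0]) (use le in auto)
  have s: "summable (\<lambda>n. f n x *\<^sub>R v n)" for x
    using ns by (rule summable_norm_cancel)
  define t where "t x = (\<Sum>n. f n x *\<^sub>R v n)" for x
  have t_le: "norm (t x) \<le> (\<Sum>n. \<bar>f n x\<bar>)" for x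
    unfolding t_def using summable_norm[OF ns] suminf_le[OF le ns abs] by (rule order_trans)
  have "bounded_linear t"
  proof (rule bounded_linear_intro[where K = C])
    show "t (x + y) = t x + t y" for x y
      unfolding t_def using suminf_add[OF s s, of x y]
      by (simp add: blinfun.add_right scaleR_add_left)
    show "t (r *\<^sub>R x) = r *\<^sub>R t x" for r x
      unfolding t_def using suminf_scaleR_right[OF s, of r x]
      by (simp add: blinfun.scaleR_right)
    have "(\<Sum>n. \<bar>f n x\<bar>) \<le> C * norm x" for x
      by (rule suminf_le_const[OF abs f])
    then show "norm (t x) \<le> norm x * C" for x
      using t_le[of x] order_trans by (metis mult.commute)
  qed
  then have "blinfun_apply (Blinfun t) = t"
    by (rule bounded_linear_Blinfun_apply)
  then show ?thesis
    using that[of "Blinfun t"] t_le s by (simp add: t_def summable_sums)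
qed

text \<open>
  The operator \<open>x \<mapsto> (f n x)\<^sub>n\<close> into \<open>\<ell>\<^sup>1\<close> maps relatively weakly compact sets to relatively norm compact
  sets, by the Schur property. Along a subsequence all coordinates converge to those of some \<open>a\<close>. If
  the \<open>\<ell>\<^sup>1\<close>-distances did not tend to \<open>0\<close>, the gliding hump would give a functional \<open>g = \<Sum> \<xi>\<^sub>n f\<^sub>n\<close> that
  stays \<open>\<epsilon>/2\<close> above \<open>g a\<close> along a further subsequence. Weak compactness, applied to \<open>g\<close> together
  with all \<open>f n\<close>, provides \<open>a'\<close> with the same coordinates as \<open>a\<close> but \<open>g a' > g a\<close>, although \<open>g\<close>
  is determined by the coordinates.
\<close>
lemma relatively_weakly_compact_l1_subseq:
  fixes f :: "nat \<Rightarrow> 'a::real_normed_vector \<Rightarrow>\<^sub>L real"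
  assumes f: "\<And>x N. (\<Sum>n<N. \<bar>f n x\<bar>) \<le> C * norm x"
    and A: "relatively_weakly_compact A" and b: "\<And>n. b n \<in> A"
  obtains a and r :: "nat \<Rightarrow> nat" where "strict_mono r" "(\<lambda>k. \<Sum>n. \<bar>f n (b (r k) - a)\<bar>) \<longlonglongrightarrow> 0"
proof -
  obtain a and r :: "nat \<Rightarrow> nat" where r: "strict_mono r"
    and coord: "\<And>i. (\<lambda>k. f i (b (r k))) \<longlonglongrightarrow> f i a"
    using relatively_weakly_compact_subseq[of A b f, OF A b] by metis
  have abs: "summable (\<lambda>n. \<bar>f n x\<bar>)" for x
    using f by (rule summable_of_bounded_sums)
  have "(\<lambda>k. \<Sum>n. \<bar>f n (b (r k) - a)\<bar>) \<longlonglongrightarrow> 0"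
  proof (rule ccontr)
    assume "\<not> ?thesis"
    then obtain \<epsilon> and q :: "nat \<Rightarrow> nat" where \<epsilon>: "\<epsilon> > 0" and q: "strict_mono q"
      and big: "\<And>k. \<epsilon> \<le> (\<Sum>n. \<bar>f n (b (r (q k)) - a)\<bar>)"
      by (rule not_null_subseq) (auto intro: suminf_nonneg abs)
    have "(\<lambda>k. f n (b (r (q k)) - a)) \<longlonglongrightarrow> 0" for n
      using LIMSEQ_subseq_LIMSEQ[OF LIM_zero[OF coord[of n]] q]
      by (simp add: o_def blinfun.diff_right)
    then obtain \<xi> and s :: "nat \<Rightarrow> nat" where \<xi>: "\<And>n. \<bar>\<xi> n\<bar> \<le> 1" and s: "strict_mono s"
      and hump: "\<And>j. \<epsilon> / 2 \<le> (\<Sum>n. \<xi> n * f n (b (r (q (s j))) - a))"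
      using schur_gliding_hump[of \<epsilon> "\<lambda>k n. f n (b (r (q k)) - a)", OF \<epsilon> abs _ big] by metis
    obtain g :: "'a \<Rightarrow>\<^sub>L real" where g: "\<And>x. (\<lambda>n. f n x *\<^sub>R \<xi> n) sums g x"
      by (rule series_operator[OF f, of \<xi>]) (use \<xi> in auto)
    have g_eq: "g x = (\<Sum>n. \<xi> n * f n x)" for x
      using sums_unique[OF g[of x]] by (simp add: mult.commute)
    \<comment> \<open>\<open>g\<close> and the coordinates \<open>f n\<close> as a single countable family.\<close>
    define F where "F i = (case i of 0 \<Rightarrow> g | Suc m \<Rightarrow> f m)" for i
    obtain a' and t :: "nat \<Rightarrow> nat" where t: "strict_mono t"
      and lim: "\<And>i. (\<lambda>k. F i (b (r (q (s (t k)))))) \<longlonglongrightarrow> F i a'"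
      using relatively_weakly_compact_subseq[where f = F and b = "\<lambda>j. b (r (q (s j)))", OF A b] by metis
    have "f n a' = f n a" for n
    proof -
      have "strict_mono (\<lambda>k. q (s (t k)))"
        using q s t by (simp add: strict_mono_def)
      then have "(\<lambda>k. f n (b (r (q (s (t k)))))) \<longlonglongrightarrow> f n a"
        using LIMSEQ_subseq_LIMSEQ[OF coord[of n], of "\<lambda>k. q (s (t k))"] by (simp add: o_def)
      then show ?thesis
        using LIMSEQ_unique lim[of "Suc n"] by (simp add: F_def)
    qed
    then have "g a' = g a" by (simp add: g_eq)
    moreover have "g a + \<epsilon> / 2 \<le> g a'"
    proof (rule LIMSEQ_le_const)
      show "(\<lambda>k. g (b (r (q (s (t k)))))) \<longlonglongrightarrow> g a'"
        using lim[of 0] by (simp add: F_def)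
      have ge: "\<epsilon> / 2 \<le> g (b (r (q (s j))) - a)" for j
        using hump[of j] by (simp add: g_eq)
      have "g a + \<epsilon> / 2 \<le> g (b (r (q (s j))))" for j
        using ge[of j] by (simp add: blinfun.diff_right)
      then show "\<exists>N. \<forall>k\<ge>N. g a + \<epsilon> / 2 \<le> g (b (r (q (s (t k)))))" by blast
    qed
    ultimately show False using \<epsilon> by simp
  qed
  with r that show ?thesis by blast
qed

section \<open>Semi-compact operators\<close>

text \<open>
  Truncating the positive and the negative part \<open>y\<^sup>+, y\<^sup>-\<close> of \<open>y = T x\<close> at \<open>u\<close> gives an element of
  \<open>[- u, u]\<close>. The error \<open>(y\<^sup>+ - u)\<^sup>+ - (y\<^sup>- - u)\<^sup>+\<close> is bounded in modulus by \<open>(\<bar>y\<bar> - u)\<^sup>+\<close>, since the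
  modulus of a difference of positive elements is at most their supremum.
\<close>
lemma semi_compactI:
  fixes T :: "'a::banach \<Rightarrow>\<^sub>L 'b::banach_lattice"
  assumes "\<And>\<epsilon>. \<epsilon> > 0 \<Longrightarrow> \<exists>u\<ge>0. \<forall>x. norm x \<le> 1 \<longrightarrow> norm (pprt (\<bar>blinfun_apply T x\<bar> - u)) \<le> \<epsilon>"
  shows "semi_compact T"
  unfolding semi_compact_def
proof (intro allI impI)
  fix \<epsilon> :: real assume \<epsilon>: "\<epsilon> > 0"
  then obtain u where u: "0 \<le> u" "\<And>x. norm x \<le> 1 \<Longrightarrow> norm (pprt (\<bar>T x\<bar> - u)) \<le> \<epsilon>"
    using assms by blast
  have "blinfun_apply T ` cball 0 1 \<subseteq> {v + \<epsilon> *\<^sub>R w |v w. v \<in> {- u..u} \<and> w \<in> cball 0 1}"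
  proof (rule image_subsetI)
    fix x :: 'a assume x: "x \<in> cball 0 1"
    define y where "y = T x"
    define v where "v = inf (pprt y) u - inf (pprt (- y)) u"
    define a where "a = pprt (pprt y - u)"
    define b where "b = pprt (pprt (- y) - u)"
    have "y = pprt y - pprt (- y)"
      by (simp add: pprt_neg flip: prts)
    also have "\<dots> = (inf (pprt y) u + a) - (inf (pprt (- y)) u + b)"
      by (simp only: a_def b_def inf_add_pprt_diff)
    also have "\<dots> = v + (a - b)"
      unfolding v_def by (rule add_diff_add)
    finally have y: "y = v + (a - b)" .
    have "v \<le> u - 0" "0 - u \<le> v"
      unfolding v_def using u(1) by (intro diff_mono; simp)+
    then have v: "v \<in> {- u..u}" by simp
    have ab0: "0 \<le> a" "0 \<le> b" by (simp_all add: a_def b_def)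
    have "pprt y \<le> \<bar>y\<bar>" "pprt (- y) \<le> \<bar>y\<bar>"
      using pprt_le_abs[of y] pprt_le_abs[of "- y"] by simp_all
    then have ab: "a \<le> pprt (\<bar>y\<bar> - u)" "b \<le> pprt (\<bar>y\<bar> - u)"
      unfolding a_def b_def by (simp_all add: diff_right_mono)
    have "\<bar>a - b\<bar> \<le> pprt (\<bar>y\<bar> - u)"
    proof (rule abs_leI_lattice)
      have "a - b \<le> a" using ab0 by simp
      then show "a - b \<le> pprt (\<bar>y\<bar> - u)" using ab(1) by (rule order_trans)
      have "- (a - b) \<le> b" using ab0 by simp
      then show "- (a - b) \<le> pprt (\<bar>y\<bar> - u)" using ab(2) by (rule order_trans)
    qed
    then have "norm (a - b) \<le> norm (pprt (\<bar>y\<bar> - u))"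
      by (rule norm_le_norm_of_abs_le)
    also have "\<dots> \<le> \<epsilon>"
      unfolding y_def using x by (intro u(2)) simp
    finally have ab_le: "norm (a - b) \<le> \<epsilon>" .
    have "T x = v + \<epsilon> *\<^sub>R (inverse \<epsilon> *\<^sub>R (a - b))"
      using \<epsilon> y by (simp add: y_def)
    moreover have "inverse \<epsilon> *\<^sub>R (a - b) \<in> cball 0 1"
    proof -
      have "norm (inverse \<epsilon> *\<^sub>R (a - b)) \<le> inverse \<epsilon> * \<epsilon>"
        unfolding norm_scaleR using ab_le \<epsilon> by (intro mult_mono) auto
      then show ?thesis using \<epsilon> by simp
    qed
    ultimately show "T x \<in> {v + \<epsilon> *\<^sub>R w |v w. v \<in> {- u..u} \<and> w \<in> cball 0 1}"
      using v by blast
  qed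
  then show "\<exists>u\<ge>0. blinfun_apply T ` cball 0 1 \<subseteq> {v + \<epsilon> *\<^sub>R w |v w. v \<in> {- u..u} \<and> w \<in> cball 0 1}"
    using u(1) by blast
qed

lemma semi_compactD:
  fixes T :: "'a::banach \<Rightarrow>\<^sub>L 'b::banach_lattice"
  assumes T: "semi_compact T" and \<epsilon>: "\<epsilon> > 0"
  obtains u where "0 \<le> u" "\<And>x. norm x \<le> 1 \<Longrightarrow> norm (pprt (\<bar>T x\<bar> - u)) \<le> \<epsilon>"
proof -
  obtain u where u: "0 \<le> u"
    and sub: "blinfun_apply T ` cball 0 1 \<subseteq> {v + \<epsilon> *\<^sub>R w |v w. v \<in> {- u..u} \<and> w \<in> cball 0 1}"
    using T \<epsilon> unfolding semi_compact_def by blast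
  have "norm (pprt (\<bar>T x\<bar> - u)) \<le> \<epsilon>" if "norm x \<le> 1" for x
  proof -
    have "T x \<in> {v + \<epsilon> *\<^sub>R w |v w. v \<in> {- u..u} \<and> w \<in> cball 0 1}"
      using that by (intro subsetD[OF sub] imageI) simp
    then obtain v w where v: "- u \<le> v" "v \<le> u" and w: "norm w \<le> 1" and Tx: "T x = v + \<epsilon> *\<^sub>R w"
      by auto
    have "\<bar>v\<bar> \<le> u"
      using v by (intro abs_leI_lattice) (simp_all add: minus_le_iff)
    moreover have "\<bar>T x\<bar> \<le> \<bar>v\<bar> + \<bar>\<epsilon> *\<^sub>R w\<bar>"
      unfolding Tx by (rule abs_triangle_ineq)
    ultimately have "\<bar>T x\<bar> \<le> u + \<bar>\<epsilon> *\<^sub>R w\<bar>"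
      by (meson add_right_mono order_trans)
    then have "\<bar>T x\<bar> - u \<le> \<bar>\<epsilon> *\<^sub>R w\<bar>"
      by (simp add: diff_le_eq add.commute)
    then have "pprt (\<bar>T x\<bar> - u) \<le> \<bar>\<epsilon> *\<^sub>R w\<bar>"
      unfolding pprt_def by simp
    then have "norm (pprt (\<bar>T x\<bar> - u)) \<le> norm \<bar>\<epsilon> *\<^sub>R w\<bar>"
      by (intro norm_mono_nonneg) simp_all
    also have "\<dots> \<le> \<epsilon>"
      using \<epsilon> w by (simp add: mult_left_le)
    finally show ?thesis .
  qed
  with u that show ?thesis by blast
qed

lemma cone_ball_down_closed:
  fixes x y :: "'a::banach_lattice"
  shows "x \<in> {x. 0 \<le> x \<and> norm x \<le> c} \<Longrightarrow> 0 \<le> y \<Longrightarrow> y \<le> x \<Longrightarrow> y \<in> {x. 0 \<le> x \<and> norm x \<le> c}"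
  using norm_mono_nonneg[of y x] by simp

text \<open>
  For positive \<open>T\<close> one has \<open>\<bar>T x\<bar> \<le> T (\<bar>x\<bar> \<and> u) + T ((\<bar>x\<bar> - u)\<^sup>+) \<le> T u + T ((\<bar>x\<bar> - u)\<^sup>+)\<close>, and the
  last term is uniformly small on the ball for a suitable \<open>u\<close>.
\<close>
lemma semi_compact_if_disjoint_null:
  fixes T :: "'a::banach_lattice \<Rightarrow>\<^sub>L 'b::banach_lattice"
  assumes T: "0 \<le> T"
    and null: "\<And>w. disjoint_seq w \<Longrightarrow> (\<And>n. 0 \<le> w n) \<Longrightarrow> (\<And>n. norm (w n) \<le> 1) \<Longrightarrow>
      (\<lambda>n. norm (blinfun_apply T (w n))) \<longlonglongrightarrow> 0"
  shows "semi_compact T"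
proof (rule semi_compactI)
  fix \<epsilon> :: real assume \<epsilon>: "\<epsilon> > 0"
  have "\<exists>u\<ge>0. \<forall>x\<in>{x. 0 \<le> x \<and> norm x \<le> 1}. norm (T (pprt (x - u))) < \<epsilon>"
  proof (rule small_above_if_disjoint_null[OF blinfun.bounded_linear_right _ _ cone_ball_down_closed _ \<epsilon>])
    show "bounded {x :: 'a. 0 \<le> x \<and> norm x \<le> 1}"
      by (auto simp: bounded_iff)
    show "(\<lambda>n. norm (T (y n))) \<longlonglongrightarrow> 0"
      if "disjoint_seq y" "range y \<subseteq> {x. 0 \<le> x \<and> norm x \<le> 1}" for y
      using that by (intro null) auto
  qed auto
  then obtain u where u: "0 \<le> u" "\<And>x. 0 \<le> x \<Longrightarrow> norm x \<le> 1 \<Longrightarrow> norm (T (pprt (x - u))) < \<epsilon>"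
    by auto
  have "norm (pprt (\<bar>T x\<bar> - T u)) \<le> \<epsilon>" if "norm x \<le> 1" for x
  proof -
    let ?p = "pprt (\<bar>x\<bar> - u)"
    have "\<bar>T x\<bar> \<le> T \<bar>x\<bar>" by (rule abs_pos_le[OF T])
    also have "T \<bar>x\<bar> = T (inf \<bar>x\<bar> u) + T ?p"
      by (simp only: inf_add_pprt_diff flip: blinfun.add_right)
    also have "\<dots> \<le> T u + T ?p"
      by (intro add_right_mono pos_mono[OF T]) simp
    finally have "\<bar>T x\<bar> - T u \<le> T ?p"
      by (simp add: diff_le_eq add.commute)
    moreover have "0 \<le> T ?p"
      using T unfolding blinfun_nonneg_iff by simp
    ultimately have "pprt (\<bar>T x\<bar> - T u) \<le> T ?p"
      unfolding pprt_def[of "\<bar>T x\<bar> - T u"] by (rule le_supI)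
    then have "norm (pprt (\<bar>T x\<bar> - T u)) \<le> norm (T ?p)"
      by (intro norm_mono_nonneg) simp_all
    also have "\<dots> \<le> \<epsilon>"
      using u(2)[of "\<bar>x\<bar>"] that by simp
    finally show ?thesis .
  qed
  moreover have "0 \<le> T u"
    using T u(1) by (simp add: blinfun_nonneg_iff)
  ultimately show "\<exists>u\<ge>0. \<forall>x. norm x \<le> 1 \<longrightarrow> norm (pprt (\<bar>T x\<bar> - u)) \<le> \<epsilon>"
    by blast
qed

text \<open>
  In a finite dimensional lattice every disjoint sequence is eventually \<open>0\<close>, so balls of the
  codomain are almost order bounded.
\<close>
lemma semi_compact_if_finite_dimensional_codomain:
  fixes T :: "'a::banach_lattice \<Rightarrow>\<^sub>L 'b::banach_lattice"
  assumes fd: "finite_dimensional TYPE('b)"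
  shows "semi_compact T"
proof (rule semi_compactI)
  fix \<epsilon> :: real assume \<epsilon>: "\<epsilon> > 0"
  have "\<exists>u\<ge>0. \<forall>y\<in>{y :: 'b. 0 \<le> y \<and> norm y \<le> norm T}. norm (id (pprt (y - u))) < \<epsilon>"
  proof (rule small_above_if_disjoint_null[OF _ _ _ cone_ball_down_closed _ \<epsilon>])
    show "bounded_linear (id :: 'b \<Rightarrow> 'b)"
      by (simp add: bounded_linear_ident id_def)
    show "bounded {y :: 'b. 0 \<le> y \<and> norm y \<le> norm T}"
      by (auto simp: bounded_iff)
    show "(\<lambda>n. norm (id (y n))) \<longlonglongrightarrow> 0"
      if "disjoint_seq y" "range y \<subseteq> {y :: 'b. 0 \<le> y \<and> norm y \<le> norm T}" for y
    proof -
      have "0 \<le> y n" for n using that(2) by auto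
      then show ?thesis using finite_dimensional_disjoint_null[OF fd that(1)] by simp
    qed
  qed auto
  then obtain u where u: "0 \<le> u" "\<And>y :: 'b. 0 \<le> y \<Longrightarrow> norm y \<le> norm T \<Longrightarrow> norm (pprt (y - u)) < \<epsilon>"
    by auto
  have "norm (pprt (\<bar>T x\<bar> - u)) \<le> \<epsilon>" if "norm x \<le> 1" for x
  proof -
    have "norm (T x) \<le> norm T * norm x" by (rule norm_blinfun)
    also have "\<dots> \<le> norm T" using that by (intro mult_left_le) auto
    finally show ?thesis using u(2)[of "\<bar>T x\<bar>"] by simp
  qed
  with u(1) show "\<exists>u\<ge>0. \<forall>x. norm x \<le> 1 \<longrightarrow> norm (pprt (\<bar>T x\<bar> - u)) \<le> \<epsilon>"
    by blast
qed

section \<open>Almost L-weakly compact operators\<close>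

text \<open>
  The disjoint sequence device for the identity, on the positive part of the solid hull.
\<close>
lemma L_weakly_compact_small_above:
  fixes A :: "'a::banach_lattice set"
  assumes A: "L_weakly_compact A" and \<epsilon>: "\<epsilon> > 0"
  obtains u where "0 \<le> u" "\<And>y. y \<in> A \<Longrightarrow> norm (pprt (\<bar>y\<bar> - u)) < \<epsilon>"
proof -
  let ?S = "{y. 0 \<le> y \<and> y \<in> solid_hull A}"
  have bdA: "bounded A"
    and null: "\<And>y. disjoint_seq y \<Longrightarrow> range y \<subseteq> solid_hull A \<Longrightarrow> (\<lambda>n. norm (y n)) \<longlonglongrightarrow> 0"
    using A by (auto simp: L_weakly_compact_def)
  have "\<exists>u\<ge>0. \<forall>y\<in>?S. norm (id (pprt (y - u))) < \<epsilon>"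
  proof (rule small_above_if_disjoint_null)
    show "bounded_linear (id :: 'a \<Rightarrow> 'a)"
      by (simp add: bounded_linear_ident id_def)
    show "bounded ?S"
    proof -
      obtain M where "\<And>a. a \<in> A \<Longrightarrow> norm a \<le> M"
        using bdA by (auto simp: bounded_iff)
      then show ?thesis
        unfolding bounded_iff solid_hull_def using lattice_norm
        by (intro exI[of _ M]) (blast intro: order_trans)
    qed
    show "y \<in> ?S" if "x \<in> ?S" "0 \<le> y" "y \<le> x" for x y
    proof -
      have "\<bar>y\<bar> \<le> \<bar>x\<bar>" using that by (simp add: abs_of_nonneg)
      with that show ?thesis unfolding solid_hull_def by (auto intro: order_trans)
    qed
    show "(\<lambda>n. norm (id (y n))) \<longlonglongrightarrow> 0" if "disjoint_seq y" "range y \<subseteq> ?S" for y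
      unfolding id_apply by (rule null) (use that in auto)
  qed (use \<epsilon> in auto)
  then obtain u where u: "0 \<le> u" "\<And>y. y \<in> ?S \<Longrightarrow> norm (pprt (y - u)) < \<epsilon>"
    by auto
  moreover have "\<bar>y\<bar> \<in> ?S" if "y \<in> A" for y
    unfolding solid_hull_def using that by (auto intro!: bexI[of _ y])
  ultimately show ?thesis using that by blast
qed

text \<open>
  An arbitrary functional lies between \<open>- \<psi>2\<close> and \<open>\<psi>1\<close> on the cone for some positive \<open>\<psi>1, \<psi>2\<close>.
\<close>
lemma functional_disjoint_null_if_dual_oc:
  fixes \<phi> :: "'a::banach_lattice \<Rightarrow>\<^sub>L real"
  assumes oc: "order_continuous_norm TYPE('a \<Rightarrow>\<^sub>L real)"
    and w: "disjoint_seq w" "\<And>n. 0 \<le> w n" "\<And>n. norm (w n) \<le> 1"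
  shows "(\<lambda>n. \<phi> (w n)) \<longlonglongrightarrow> 0"
proof -
  obtain \<psi>1 :: "'a \<Rightarrow>\<^sub>L real" where 1: "0 \<le> \<psi>1" "\<And>x. 0 \<le> x \<Longrightarrow> \<phi> x \<le> \<psi>1 x"
    using functional_dominated_by_positive[of \<phi>] by blast
  obtain \<psi>2 :: "'a \<Rightarrow>\<^sub>L real" where 2: "0 \<le> \<psi>2" "\<And>x. 0 \<le> x \<Longrightarrow> (- \<phi>) x \<le> \<psi>2 x"
    using functional_dominated_by_positive[of "- \<phi>"] by blast
  show ?thesis
  proof (rule tendsto_sandwich)
    show "(\<lambda>n. - \<psi>2 (w n)) \<longlonglongrightarrow> 0"
      using tendsto_minus[OF disjoint_null_if_dual_oc[OF oc 2(1) w]] by simp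
    show "(\<lambda>n. \<psi>1 (w n)) \<longlonglongrightarrow> 0"
      by (rule disjoint_null_if_dual_oc[OF oc 1(1) w])
    show "\<forall>\<^sub>F n in sequentially. - \<psi>2 (w n) \<le> \<phi> (w n)"
      using 2(2)[OF w(2)] by (simp add: blinfun.minus_left minus_le_iff)
    show "\<forall>\<^sub>F n in sequentially. \<phi> (w n) \<le> \<psi>1 (w n)"
      using 1(2)[OF w(2)] by simp
  qed
qed

text \<open>
  Let \<open>w\<close> be a disjoint sequence in the positive part of the ball. It is weakly null, so
  its range is relatively weakly compact and \<open>T\<close> maps it onto an L-weakly compact set. The excesses
  \<open>(T w\<^sub>n - u)\<^sup>+\<close> are therefore small for some \<open>u\<close>, and \<open>T w\<^sub>n \<and> u\<close> tends to \<open>0\<close> because \<open>T w\<^sub>n\<close> is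
  positive and weakly null. Hence \<open>T\<close> is null on disjoint sequences.
\<close>
lemma semi_compact_if_dual_oc:
  fixes T :: "'e::banach_lattice \<Rightarrow>\<^sub>L 'f::banach_lattice"
  assumes ocF: "order_continuous_norm TYPE('f)"
    and oc: "order_continuous_norm TYPE('e \<Rightarrow>\<^sub>L real)"
    and T: "0 \<le> T" and alw: "almost_L_weakly_compact T"
  shows "semi_compact T"
proof (rule semi_compact_if_disjoint_null[OF T])
  fix w :: "nat \<Rightarrow> 'e"
  assume w: "disjoint_seq w" "\<And>n. 0 \<le> w n" "\<And>n. norm (w n) \<le> 1"
  have weak: "(\<lambda>n. \<phi> (w n)) \<longlonglongrightarrow> 0" for \<phi> :: "'e \<Rightarrow>\<^sub>L real"
    by (rule functional_disjoint_null_if_dual_oc[OF oc w])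
  have "relatively_weakly_compact (range w)"
    by (rule relatively_weakly_compact_if_weakly_null[OF weak])
  then have Lw: "L_weakly_compact (blinfun_apply T ` range w)"
    using alw unfolding almost_L_weakly_compact_def by blast
  have T0: "0 \<le> T (w n)" for n
    using T w(2) by (simp add: blinfun_nonneg_iff)
  have "(\<lambda>n. blinfun_apply \<phi> (T (w n))) \<longlonglongrightarrow> 0" for \<phi> :: "'f \<Rightarrow>\<^sub>L real"
    using weak[of "\<phi> o\<^sub>L T"] by simp
  then have inf_null: "(\<lambda>n. norm (inf (T (w n)) u)) \<longlonglongrightarrow> 0" if "0 \<le> u" for u
    using inf_null_if_weakly_null[OF ocF, of "\<lambda>n. T (w n)"] T0 that by blast
  show "(\<lambda>n. norm (T (w n))) \<longlonglongrightarrow> 0"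
  proof (rule LIMSEQ_I)
    fix \<epsilon> :: real assume \<epsilon>: "\<epsilon> > 0"
    then have "\<epsilon> / 2 > 0" by simp
    from L_weakly_compact_small_above[OF Lw this]
    obtain u where u: "0 \<le> u" "\<And>y. y \<in> blinfun_apply T ` range w \<Longrightarrow> norm (pprt (\<bar>y\<bar> - u)) < \<epsilon> / 2"
      by blast
    have "\<forall>\<^sub>F n in sequentially. norm (inf (T (w n)) u) < \<epsilon> / 2"
      using inf_null[OF u(1)] \<epsilon> by (intro order_tendstoD) auto
    then have "\<forall>\<^sub>F n in sequentially. norm (norm (T (w n)) - 0) < \<epsilon>"
    proof eventually_elim
      fix n assume n: "norm (inf (T (w n)) u) < \<epsilon> / 2"
      have "norm (T (w n)) \<le> norm (inf (T (w n)) u) + norm (pprt (T (w n) - u))"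
        using norm_triangle_ineq[of "inf (T (w n)) u" "pprt (T (w n) - u)"]
        by (simp only: inf_add_pprt_diff)
      moreover have "norm (pprt (T (w n) - u)) < \<epsilon> / 2"
        using u(2)[of "T (w n)"] T0[of n] by (simp add: abs_of_nonneg)
      ultimately show "norm (norm (T (w n)) - 0) < \<epsilon>"
        using n by simp
    qed
    then show "\<exists>N. \<forall>n\<ge>N. norm (norm (T (w n)) - 0) < \<epsilon>"
      by (simp only: eventually_sequentially)
  qed
qed

section \<open>Positive operators that are not semi-compact\<close>

text \<open>
  Relatively norm compact sets are L-weakly compact when the norm is order continuous: if \<open>\<bar>z\<^sub>k\<bar> \<le> \<bar>T a\<^sub>k\<bar>\<close>
  with \<open>z\<close> disjoint and \<open>T a\<^sub>k\<close> converging to \<open>y\<close>, then \<open>\<bar>z\<^sub>k\<bar> \<and> \<bar>y\<bar>\<close> is disjoint and order bounded, hence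
  null, and the excess of \<open>\<bar>z\<^sub>k\<bar>\<close> over \<open>\<bar>y\<bar>\<close> is at most \<open>\<bar>T a\<^sub>k - y\<bar>\<close>.
\<close>
lemma almost_L_weakly_compact_if_norm_subseq:
  fixes T :: "'e::banach_lattice \<Rightarrow>\<^sub>L 'f::banach_lattice"
  assumes ocF: "order_continuous_norm TYPE('f)"
    and cpt: "\<And>A b. relatively_weakly_compact A \<Longrightarrow> (\<And>n :: nat. b n \<in> A) \<Longrightarrow>
      \<exists>y r. strict_mono (r :: nat \<Rightarrow> nat) \<and> (\<lambda>k. blinfun_apply T (b (r k))) \<longlonglongrightarrow> y"
  shows "almost_L_weakly_compact T"
  unfolding almost_L_weakly_compact_def L_weakly_compact_def
proof (intro allI impI conjI)
  fix A :: "'e set" assume "A \<noteq> {} \<and> relatively_weakly_compact A"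
  then have A: "relatively_weakly_compact A" and ne: "A \<noteq> {}" by auto
  show "blinfun_apply T ` A \<noteq> {}" using ne by simp
  show "bounded (blinfun_apply T ` A)"
  proof (rule ccontr)
    assume "\<not> ?thesis"
    then have "\<forall>n :: nat. \<exists>b\<in>A. real n < norm (T b)"
      by (auto simp: bounded_iff not_le)
    then obtain b where b: "\<And>n :: nat. b n \<in> A" "\<And>n. real n < norm (T (b n))"
      by metis
    obtain y and r :: "nat \<Rightarrow> nat" where r: "strict_mono r" and lim: "(\<lambda>k. T (b (r k))) \<longlonglongrightarrow> y"
      using cpt[OF A, of b] b(1) by blast
    obtain M where "\<And>k. norm (T (b (r k))) \<le> M"
      using convergent_imp_Bseq[OF convergentI[OF lim]] by (auto simp: Bseq_def)
    moreover obtain k where "M < real k" using reals_Archimedean2 by blast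
    moreover have "real k \<le> real (r k)" using seq_suble[OF r] by simp
    ultimately show False using b(2)[of "r k"] by (meson less_le_trans not_le order_trans less_imp_le)
  qed
next
  fix A :: "'e set" and z :: "nat \<Rightarrow> 'f"
  assume "A \<noteq> {} \<and> relatively_weakly_compact A"
    and "disjoint_seq z \<and> range z \<subseteq> solid_hull (blinfun_apply T ` A)"
  then have A: "relatively_weakly_compact A" and z: "disjoint_seq z"
    and "range z \<subseteq> solid_hull (blinfun_apply T ` A)" by auto
  then have "\<forall>n. \<exists>a\<in>A. \<bar>z n\<bar> \<le> \<bar>T a\<bar>"
    by (auto simp: solid_hull_def)
  then obtain a where a: "\<And>n. a n \<in> A" "\<And>n. \<bar>z n\<bar> \<le> \<bar>T (a n)\<bar>"
    by metis
  show "(\<lambda>n. norm (z n)) \<longlonglongrightarrow> 0"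
  proof (rule ccontr)
    assume "\<not> ?thesis"
    then obtain \<delta> and q :: "nat \<Rightarrow> nat" where \<delta>: "\<delta> > 0" and q: "strict_mono q"
      and big: "\<And>n. \<delta> \<le> norm (z (q n))"
      by (rule not_null_subseq) auto
    obtain y and r :: "nat \<Rightarrow> nat" where r: "strict_mono r"
      and lim: "(\<lambda>k. T (a (q (r k)))) \<longlonglongrightarrow> y"
      using cpt[OF A, of "\<lambda>n. a (q n)"] a(1) by blast
    define d where "d k = \<bar>z (q (r k))\<bar>" for k
    have d0: "0 \<le> d k" for k by (simp add: d_def)
    have "disjoint_seq d"
      using disjoint_seq_abs[OF disjoint_seq_subseq[OF z, of "\<lambda>k. q (r k)"]] q r
      by (simp add: strict_mono_def d_def[abs_def])
    then have "disjoint_seq (\<lambda>k. inf (d k) \<bar>y\<bar>)"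
      by (rule disjoint_seq_mono) (simp_all add: d0)
    then have "(\<lambda>k. inf (d k) \<bar>y\<bar>) \<longlonglongrightarrow> 0"
      by (rule oc_disjoint_order_bounded_null[OF ocF, where u = "\<bar>y\<bar>"]) (simp_all add: d0)
    then have "(\<lambda>k. norm (inf (d k) \<bar>y\<bar>) + norm (T (a (q (r k))) - y)) \<longlonglongrightarrow> 0 + 0"
      by (intro tendsto_add tendsto_norm_zero LIM_zero lim)
    then have "\<delta> \<le> 0 + 0"
    proof (rule LIMSEQ_le_const, intro exI allI impI)
      fix k
      let ?t = "T (a (q (r k)))"
      have "d k \<le> \<bar>y + (?t - y)\<bar>"
        using a(2) by (simp add: d_def)
      also have "\<dots> \<le> \<bar>y\<bar> + \<bar>?t - y\<bar>"
        by (rule abs_triangle_ineq)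
      finally have "d k - \<bar>y\<bar> \<le> \<bar>?t - y\<bar>"
        by (simp add: diff_le_eq add.commute)
      then have "pprt (d k - \<bar>y\<bar>) \<le> \<bar>?t - y\<bar>"
        unfolding pprt_def by simp
      then have "norm (pprt (d k - \<bar>y\<bar>)) \<le> norm (?t - y)"
        using norm_mono_nonneg[OF zero_le_pprt] norm_abs_lattice by metis
      moreover have "norm (d k) \<le> norm (inf (d k) \<bar>y\<bar>) + norm (pprt (d k - \<bar>y\<bar>))"
        using norm_triangle_ineq[of "inf (d k) \<bar>y\<bar>" "pprt (d k - \<bar>y\<bar>)"]
        by (simp only: inf_add_pprt_diff)
      moreover have "\<delta> \<le> norm (d k)"
        using big by (simp add: d_def)
      ultimately show "\<delta> \<le> norm (inf (d k) \<bar>y\<bar>) + norm (?t - y)" by simp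
    qed
    with \<delta> show False by simp
  qed
qed

text \<open>
  \<open>f n\<close> is the component of \<open>\<phi>\<close> carried by \<open>x n\<close>. The elements \<open>z \<and> k x n\<close> for different \<open>n\<close> are disjoint
  parts of \<open>z \<ge> 0\<close>, which bounds the sum of the components by \<open>\<phi>\<close>.
\<close>
lemma disjoint_components:
  fixes \<phi> :: "'e::banach_lattice \<Rightarrow>\<^sub>L real"
  assumes \<phi>: "0 \<le> \<phi>" and x: "disjoint_seq x" "\<And>n. 0 \<le> x n"
  obtains f :: "nat \<Rightarrow> 'e \<Rightarrow>\<^sub>L real" where "\<And>n. 0 \<le> f n" "\<And>n. f n (x n) = \<phi> (x n)"
    "\<And>m n. m \<noteq> n \<Longrightarrow> f m (x n) = 0" "\<And>z N. (\<Sum>n<N. \<bar>f n z\<bar>) \<le> norm \<phi> * norm z"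
proof -
  have "\<exists>g. 0 \<le> g \<and> (\<forall>z\<ge>0. (\<lambda>k. \<phi> (inf z (real k *\<^sub>R x n))) \<longlonglongrightarrow> blinfun_apply g z)" for n
  proof (rule component_functional[OF \<phi>, of "\<lambda>k. real k *\<^sub>R x n"])
    show "\<exists>k'. real k *\<^sub>R x n + real k *\<^sub>R x n \<le> real k' *\<^sub>R x n" for k
      by (rule exI[of _ "2 * k"]) (simp add: scaleR_add_left[symmetric])
  qed (use x(2) in \<open>auto simp: incseq_def intro!: scaleR_nonneg_nonneg scaleR_right_mono\<close>)
  then obtain f where f0: "\<And>n. 0 \<le> f n"
    and f: "\<And>n z. 0 \<le> z \<Longrightarrow> (\<lambda>k. \<phi> (inf z (real k *\<^sub>R x n))) \<longlonglongrightarrow> blinfun_apply (f n) z"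
    by metis
  have dis: "inf (s *\<^sub>R x m) (t *\<^sub>R x n) = 0" if "m \<noteq> n" "0 \<le> s" "0 \<le> t" for m n s t
    using x(1) that unfolding disjoint_seq_nonneg[of x, OF x(2)] by (intro inf_scaleR_zero) auto
  have own: "f n (x n) = \<phi> (x n)" for n
  proof (rule LIMSEQ_unique[OF f[OF x(2)]])
    have "\<forall>\<^sub>F k in sequentially. \<phi> (inf (x n) (real k *\<^sub>R x n)) = \<phi> (x n)"
      using eventually_ge_at_top[of 1]
    proof eventually_elim
      fix k :: nat assume "1 \<le> k"
      then have "1 *\<^sub>R x n \<le> real k *\<^sub>R x n"
        using x(2) by (intro scaleR_right_mono) auto
      then show "\<phi> (inf (x n) (real k *\<^sub>R x n)) = \<phi> (x n)"
        by (simp add: inf_absorb1)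
    qed
    then show "(\<lambda>k. \<phi> (inf (x n) (real k *\<^sub>R x n))) \<longlonglongrightarrow> \<phi> (x n)"
      by (rule tendsto_eventually)
  qed
  have other: "f m (x n) = 0" if "m \<noteq> n" for m n
  proof (rule LIMSEQ_unique[OF f[OF x(2)]])
    have "inf (x n) (real k *\<^sub>R x m) = 0" for k
      using dis[of n m 1 "real k"] that by simp
    then show "(\<lambda>k. \<phi> (inf (x n) (real k *\<^sub>R x m))) \<longlonglongrightarrow> 0"
      by (simp add: blinfun.zero_right)
  qed
  have "(\<Sum>n<N. \<bar>f n z\<bar>) \<le> norm \<phi> * norm z" for z N
  proof -
    have "(\<Sum>n<N. \<bar>f n z\<bar>) \<le> (\<Sum>n<N. f n \<bar>z\<bar>)"
      by (intro sum_mono abs_pos_le f0)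
    also have "\<dots> \<le> \<phi> \<bar>z\<bar>"
    proof (rule LIMSEQ_le_const2)
      show "(\<lambda>k. \<Sum>n<N. \<phi> (inf \<bar>z\<bar> (real k *\<^sub>R x n))) \<longlonglongrightarrow> (\<Sum>n<N. f n \<bar>z\<bar>)"
        by (intro tendsto_sum f) simp
      have "(\<Sum>n<N. inf \<bar>z\<bar> (real k *\<^sub>R x n)) \<le> \<bar>z\<bar>" for k
      proof (rule disjoint_sum_le)
        show "inf (inf \<bar>z\<bar> (real k *\<^sub>R x m)) (inf \<bar>z\<bar> (real k *\<^sub>R x n)) = 0" if "m \<noteq> n" for m n
          by (rule inf_zero_mono[OF dis[OF that, of "real k" "real k"]])
            (use x(2) in \<open>auto intro: scaleR_nonneg_nonneg\<close>)
      qed (use x(2) in \<open>auto intro: scaleR_nonneg_nonneg\<close>)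
      then have "\<phi> (\<Sum>n<N. inf \<bar>z\<bar> (real k *\<^sub>R x n)) \<le> \<phi> \<bar>z\<bar>" for k
        by (intro pos_mono[OF \<phi>])
      then show "\<exists>K. \<forall>k\<ge>K. (\<Sum>n<N. \<phi> (inf \<bar>z\<bar> (real k *\<^sub>R x n))) \<le> \<phi> \<bar>z\<bar>"
        by (simp add: blinfun.sum_right)
    qed
    also have "\<dots> \<le> norm \<phi> * norm z"
      using norm_blinfun[of \<phi> "\<bar>z\<bar>"] by simp
    finally show ?thesis .
  qed
  with f0 own other that show ?thesis by blast
qed

text \<open>
  Since \<open>E'\<close> is not order continuous, some positive \<open>\<phi>\<close> stays above \<open>\<delta>\<close> on a disjoint sequence
  \<open>x n\<close> of the ball. With the components \<open>f n\<close> of \<open>\<phi>\<close> at \<open>x n\<close> and a disjoint normalized sequence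
  \<open>y n\<close> in \<open>F\<close>, put \<open>T z = \<Sum> f n z \<cdot> y n\<close>. This operator factors through \<open>\<ell>\<^sup>1\<close>, so the Schur property makes
  it almost L-weakly compact. But \<open>T (x n) = \<phi> (x n) y n\<close> is disjoint with norms at least \<open>\<delta>\<close>, while the
  infimum of such a sequence with a fixed \<open>u\<close> tends to \<open>0\<close>; so no \<open>[- u, u]\<close> comes within
  \<open>\<delta>/2\<close> of all \<open>T (x n)\<close>.
\<close>
lemma exists_not_semi_compact:
  assumes ocF: "order_continuous_norm TYPE('f::banach_lattice)"
    and not_oc: "\<not> order_continuous_norm TYPE('e::banach_lattice \<Rightarrow>\<^sub>L real)"
    and infd: "\<not> finite_dimensional TYPE('f)"
  obtains T :: "'e::banach_lattice \<Rightarrow>\<^sub>L 'f::banach_lattice"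
  where "0 \<le> T" "almost_L_weakly_compact T" "\<not> semi_compact T"
proof -
  have "\<exists>(\<phi> :: 'e \<Rightarrow>\<^sub>L real) x. 0 \<le> \<phi> \<and> disjoint_seq x \<and> (\<forall>n. 0 \<le> x n) \<and> (\<forall>n. norm (x n) \<le> 1) \<and>
      \<not> (\<lambda>n. blinfun_apply \<phi> (x n)) \<longlonglongrightarrow> 0"
    using not_oc dual_oc_if_disjoint_null[where 'a = 'e] by blast
  then obtain \<phi> :: "'e \<Rightarrow>\<^sub>L real" and x0 where \<phi>: "0 \<le> \<phi>" and x0: "disjoint_seq x0" "\<And>n. 0 \<le> x0 n"
      "\<And>n. norm (x0 n) \<le> 1" and not_null: "\<not> (\<lambda>n. \<phi> (x0 n)) \<longlonglongrightarrow> 0"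
    by blast
  obtain \<delta> and q :: "nat \<Rightarrow> nat" where \<delta>: "\<delta> > 0" and q: "strict_mono q"
      and big: "\<And>n. \<delta> \<le> \<phi> (x0 (q n))"
    by (rule not_null_subseq[OF not_null]) (use \<phi> x0(2) in \<open>auto simp: blinfun_nonneg_iff\<close>)
  define x where "x n = x0 (q n)" for n
  have x: "disjoint_seq x" "\<And>n. 0 \<le> x n" "\<And>n. norm (x n) \<le> 1"
    using disjoint_seq_subseq[OF x0(1) q] x0 by (auto simp: x_def[abs_def])
  obtain f :: "nat \<Rightarrow> 'e \<Rightarrow>\<^sub>L real" where f0: "\<And>n. 0 \<le> f n"
    and own: "\<And>n. f n (x n) = \<phi> (x n)" and other: "\<And>m n. m \<noteq> n \<Longrightarrow> f m (x n) = 0"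
    and f_sum: "\<And>z N. (\<Sum>n<N. \<bar>f n z\<bar>) \<le> norm \<phi> * norm z"
    using disjoint_components[OF \<phi> x(1,2)] by blast
  obtain y :: "nat \<Rightarrow> 'f" where y: "disjoint_seq y" "\<And>n. 0 \<le> y n" "\<And>n. norm (y n) = 1"
    using infinite_dimensional_disjoint_seq[OF infd] by blast
  obtain T :: "'e \<Rightarrow>\<^sub>L 'f" where T: "\<And>z. (\<lambda>n. f n z *\<^sub>R y n) sums T z"
    and T_le: "\<And>z. norm (T z) \<le> (\<Sum>n. \<bar>f n z\<bar>)"
    by (rule series_operator[OF f_sum, of y]) (use y(3) in auto)
  have T0: "0 \<le> T"
    unfolding blinfun_nonneg_iff
  proof (intro allI impI)
    fix z :: 'e assume "0 \<le> z"
    then have "0 \<le> f n z" for n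
      using f0 by (simp add: blinfun_nonneg_iff)
    then show "0 \<le> T z"
      using y(2) by (intro tendsto_nonneg[OF T[unfolded sums_def]] always_eventually)
        (auto intro!: sum_nonneg scaleR_nonneg_nonneg)
  qed
  have Tx: "T (x n) = \<phi> (x n) *\<^sub>R y n" for n
  proof -
    have "(\<lambda>m. f m (x n) *\<^sub>R y m) = (\<lambda>m. if m = n then \<phi> (x n) *\<^sub>R y m else 0)"
      by (auto simp: own other)
    then show ?thesis
      using T[of "x n"] sums_single[of n "\<lambda>m. \<phi> (x n) *\<^sub>R y m"] by (metis sums_unique2)
  qed
  have "almost_L_weakly_compact T"
  proof (rule almost_L_weakly_compact_if_norm_subseq[OF ocF])
    fix A and b :: "nat \<Rightarrow> 'e" assume A: "relatively_weakly_compact A" "\<And>n. b n \<in> A"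
    obtain a and r :: "nat \<Rightarrow> nat" where r: "strict_mono r"
      and lim: "(\<lambda>k. \<Sum>n. \<bar>f n (b (r k) - a)\<bar>) \<longlonglongrightarrow> 0"
      by (rule relatively_weakly_compact_l1_subseq[OF f_sum A])
    have "(\<lambda>k. T (b (r k)) - T a) \<longlonglongrightarrow> 0"
      by (rule Lim_null_comparison[OF _ lim]) (simp add: T_le flip: blinfun.diff_right)
    then have "(\<lambda>k. T (b (r k))) \<longlonglongrightarrow> T a"
      by (rule LIM_zero_cancel)
    with r show "\<exists>y r. strict_mono (r :: nat \<Rightarrow> nat) \<and> (\<lambda>k. T (b (r k))) \<longlonglongrightarrow> y"
      by blast
  qed
  moreover have "\<not> semi_compact T"
  proof
    assume "semi_compact T"
    moreover have "\<delta> / 2 > 0" using \<delta> by simp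
    ultimately obtain u where u: "0 \<le> u" "\<And>z. norm z \<le> 1 \<Longrightarrow> norm (pprt (\<bar>T z\<bar> - u)) \<le> \<delta> / 2"
      using semi_compactD by blast
    define p where "p n = T (x n)" for n
    have p0: "0 \<le> p n" for n
      using T0 x(2) by (simp add: blinfun_nonneg_iff p_def)
    have "disjoint_seq p"
      unfolding disjoint_seq_nonneg[of p, OF p0]
    proof (intro allI impI)
      fix m n :: nat assume "m \<noteq> n"
      then have "inf (y m) (y n) = 0"
        using y(1) unfolding disjoint_seq_nonneg[of y, OF y(2)] by blast
      then show "inf (p m) (p n) = 0"
        unfolding p_def Tx by (rule inf_scaleR_zero) (use \<phi> x(2) in \<open>auto simp: blinfun_nonneg_iff\<close>)
    qed
    then have "disjoint_seq (\<lambda>n. inf (p n) u)"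
      by (rule disjoint_seq_mono) (simp_all add: p0 u)
    then have "(\<lambda>n. inf (p n) u) \<longlonglongrightarrow> 0"
      by (rule oc_disjoint_order_bounded_null[OF ocF, where u = u]) (simp_all add: p0 u)
    then have "(\<lambda>n. norm (inf (p n) u) + \<delta> / 2) \<longlonglongrightarrow> 0 + \<delta> / 2"
      by (intro tendsto_add tendsto_norm_zero tendsto_const)
    then have "\<delta> \<le> 0 + \<delta> / 2"
    proof (rule LIMSEQ_le_const, intro exI allI impI)
      fix n
      have "\<delta> \<le> norm (p n)"
        using big[of n] y(3)[of n] unfolding p_def Tx by (simp add: x_def)
      also have "\<dots> \<le> norm (inf (p n) u) + norm (pprt (p n - u))"
        using norm_triangle_ineq[of "inf (p n) u" "pprt (p n - u)"]
        by (simp only: inf_add_pprt_diff)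
      also have "norm (pprt (p n - u)) \<le> \<delta> / 2"
        using u(2)[OF x(3)[of n]] p0[of n] by (simp add: p_def abs_of_nonneg)
      finally show "\<delta> \<le> norm (inf (p n) u) + \<delta> / 2" by simp
    qed
    with \<delta> show False by simp
  qed
  ultimately show ?thesis using T0 that by blast
qed

section \<open>The characterization\<close>

theorem theorem2p5:
  assumes "order_continuous_norm TYPE('f::banach_lattice)"
  shows "(\<forall>T :: 'e::banach_lattice \<Rightarrow>\<^sub>L 'f. 0 \<le> T \<and> almost_L_weakly_compact T \<longrightarrow> semi_compact T)
    \<longleftrightarrow> (order_continuous_norm TYPE('e \<Rightarrow>\<^sub>L real) \<or>
         (finite_dimensional TYPE('e) \<or> finite_dimensional TYPE('f)))"
proof
  assume "\<forall>T :: 'e \<Rightarrow>\<^sub>L 'f. 0 \<le> T \<and> almost_L_weakly_compact T \<longrightarrow> semi_compact T"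
  then show "order_continuous_norm TYPE('e \<Rightarrow>\<^sub>L real) \<or>
      (finite_dimensional TYPE('e) \<or> finite_dimensional TYPE('f))"
    using exists_not_semi_compact[OF assms, where 'e = 'e] by metis
next
  assume cond: "order_continuous_norm TYPE('e \<Rightarrow>\<^sub>L real) \<or>
      (finite_dimensional TYPE('e) \<or> finite_dimensional TYPE('f))"
  show "\<forall>T :: 'e \<Rightarrow>\<^sub>L 'f. 0 \<le> T \<and> almost_L_weakly_compact T \<longrightarrow> semi_compact T"
  proof (intro allI impI, elim conjE)
    fix T :: "'e \<Rightarrow>\<^sub>L 'f" assume T: "0 \<le> T" "almost_L_weakly_compact T"
    from cond consider "order_continuous_norm TYPE('e \<Rightarrow>\<^sub>L real)" | "finite_dimensional TYPE('e)"
      | "finite_dimensional TYPE('f)" by blast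
    then show "semi_compact T"
    proof cases
      case 1
      then show ?thesis using semi_compact_if_dual_oc assms T by blast
    next
      case 2
      have "(\<lambda>n. norm (T (w n))) \<longlonglongrightarrow> 0" if "disjoint_seq w" "\<And>n. 0 \<le> w n" for w
      proof -
        have "w \<longlonglongrightarrow> 0"
          using finite_dimensional_disjoint_null[OF 2 that] by (rule tendsto_norm_zero_cancel)
        then have "(\<lambda>n. T (w n)) \<longlonglongrightarrow> T 0"
          by (intro blinfun.tendsto tendsto_const)
        then show ?thesis
          by (simp add: blinfun.zero_right tendsto_norm_zero)
      qed
      then show ?thesis using semi_compact_if_disjoint_null[OF T(1)] by blast
    next
      case 3
      then show ?thesis by (rule semi_compact_if_finite_dimensional_codomain)
    qed
  qed
qed

end
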